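(* Let $f$ be a $C^2$ diffeomorphism of a compact boundaryless Riemannian surface $M$ and let $\Lambda$ be a dissipative compact $f$-invariant set satisfying $$\limsup_{k\to+\infty}\tfrac1k\log\|Df^k_{|\Lambda}\|\le0 .$$ Suppose that $\Lambda$ contains a critical point $c\in\mathrm{Crit}(f,\Lambda)$ with exponential recurrence, i.e. $$\liminf_{k\to+\infty}\tfrac1k\log d(f^k(c),c)<0 .$$ Then $\Lambda$ contains a sink (an attracting periodic point).
   Context: $\Lambda$ is dissipative if $|\det D_xf|<1$ for all $x\in\Lambda$. $\|Df^k_{|\Lambda}\|=\max_{x\in\Lambda}\|D_xf^k\|$. For a unit vector $v\in T^1_xM$ and $n\in\mathbb Z$, let $g^n(v)=|\det D_xf^n|/\|D_xf^n(v)\|^2$; this is the absolute value of the derivative at $v$ of the map $w\mapsto D_xf^n(w)/\|D_xf^n(w)\|$ from $T^1_xM$ to $T^1_{f^n(x)}M$. The critical set is $\mathrm{Crit}(f,\Lambda)=\{x\in\Lambda:\exists v\in T^1_xM,\ \forall n\in\mathbb Z,\ g^n(v)\ge1\}$. *)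

theory Defs
  imports "HOL-Analysis.Analysis"
begin

section \<open>Compact Riemannian surfaces\<close>

text \<open>
  The underlying space of a surface is a Hausdorff topological type. A chart is a pair of an open
  set and a coordinate map, whose values off that set are irrelevant; an atlas is a set of charts.
\<close>

type_synonym 'a chart = "'a set \<times> ('a \<Rightarrow> real^2)"

definition chart_inv :: "'a chart \<Rightarrow> real^2 \<Rightarrow> 'a" where
  "chart_inv c = inv_into (fst c) (snd c)"

definition is_chart :: "'a::topological_space chart \<Rightarrow> bool" where
  "is_chart c \<longleftrightarrow> open (fst c) \<and> open (snd c ` fst c) \<and>
     homeomorphism (fst c) (snd c ` fst c) (snd c) (chart_inv c)"

text \<open>Only used for open \<open>S\<close>; all iterated directional derivatives of order at most \<open>k\<close>
  exist and are continuous.\<close>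

primrec ck_on :: "nat \<Rightarrow> ('a::real_normed_vector \<Rightarrow> 'b::real_normed_vector) \<Rightarrow> 'a set \<Rightarrow> bool" where
  "ck_on 0 f S \<longleftrightarrow> continuous_on S f"
| "ck_on (Suc k) f S \<longleftrightarrow> (\<forall>x\<in>S. f differentiable (at x)) \<and>
     (\<forall>v. ck_on k (\<lambda>x. frechet_derivative f (at x) v) S)"

definition smooth_on :: "('a::real_normed_vector \<Rightarrow> 'b::real_normed_vector) \<Rightarrow> 'a set \<Rightarrow> bool" where
  "smooth_on f S \<longleftrightarrow> (\<forall>k. ck_on k f S)"

text \<open>
  A tangent vector at \<open>x\<close> is the family of its coordinate representations in all the charts
  around \<open>x\<close>, related by the derivatives of the coordinate changes; by convention the family is
  \<open>0\<close> on everything which is not a chart of the atlas around \<open>x\<close>.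
  \<open>tangent_of A x c e\<close> is the tangent vector at \<open>x\<close> with coordinates \<open>e\<close> in the chart \<open>c\<close>.
\<close>

type_synonym 'a tangent = "'a chart \<Rightarrow> real^2"

definition tangent_of :: "'a chart set \<Rightarrow> 'a \<Rightarrow> 'a chart \<Rightarrow> real^2 \<Rightarrow> 'a tangent" where
  "tangent_of A x c e = (\<lambda>d. if d \<in> A \<and> x \<in> fst d
     then frechet_derivative (snd d \<circ> chart_inv c) (at (snd c x)) e else 0)"

definition tangent_space :: "'a chart set \<Rightarrow> 'a \<Rightarrow> 'a tangent set" where
  "tangent_space A x = {v. \<forall>c\<in>A. x \<in> fst c \<longrightarrow> v = tangent_of A x c (v c)}"

locale compact_riemannian_surface =
  fixes A :: "'a::t2_space chart set"
    and g :: "'a \<Rightarrow> 'a tangent \<Rightarrow> 'a tangent \<Rightarrow> real"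
  assumes compact_surface: "compact (UNIV :: 'a set)"
    and charts: "\<And>c. c \<in> A \<Longrightarrow> is_chart c"
    and charts_cover: "(\<Union>c\<in>A. fst c) = UNIV"
    and smooth_coordinate_change:
      "\<And>c d. c \<in> A \<Longrightarrow> d \<in> A \<Longrightarrow> smooth_on (snd d \<circ> chart_inv c) (snd c ` (fst c \<inter> fst d))"
    and metric_bilinear:
      "\<And>c x. c \<in> A \<Longrightarrow> x \<in> fst c \<Longrightarrow>
         bilinear (\<lambda>e e'. g x (tangent_of A x c e) (tangent_of A x c e'))"
    and metric_sym:
      "\<And>x v w. v \<in> tangent_space A x \<Longrightarrow> w \<in> tangent_space A x \<Longrightarrow> g x v w = g x w v"
    and metric_pos:
      "\<And>x v. v \<in> tangent_space A x \<Longrightarrow> v \<noteq> (\<lambda>_. 0) \<Longrightarrow> g x v v > 0"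
    and metric_smooth:
      "\<And>c e e'. c \<in> A \<Longrightarrow>
         smooth_on (\<lambda>u. g (chart_inv c u) (tangent_of A (chart_inv c u) c e)
                                         (tangent_of A (chart_inv c u) c e'))
                   (snd c ` fst c)"

definition tangent_norm :: "('a \<Rightarrow> 'a tangent \<Rightarrow> 'a tangent \<Rightarrow> real) \<Rightarrow> 'a \<Rightarrow> 'a tangent \<Rightarrow> real" where
  "tangent_norm g x v = sqrt (g x v v)"

definition unit_tangent ::
    "'a chart set \<Rightarrow> ('a \<Rightarrow> 'a tangent \<Rightarrow> 'a tangent \<Rightarrow> real) \<Rightarrow> 'a \<Rightarrow> 'a tangent set" where
  "unit_tangent A g x = {v \<in> tangent_space A x. tangent_norm g x v = 1}"

subsection \<open>Riemannian distance\<close>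

text \<open>\<open>C\<^sup>1\<close> on the closed interval, with one-sided derivatives at the end points.\<close>

definition c1_curve_on :: "'a::topological_space chart set \<Rightarrow> (real \<Rightarrow> 'a) \<Rightarrow> real set \<Rightarrow> bool" where
  "c1_curve_on A \<gamma> I \<longleftrightarrow> continuous_on I \<gamma> \<and>
     (\<forall>c\<in>A. \<exists>D. continuous_on (I \<inter> \<gamma> -` fst c) D \<and>
        (\<forall>t \<in> I \<inter> \<gamma> -` fst c. ((snd c \<circ> \<gamma>) has_vector_derivative D t) (at t within I)))"

definition piecewise_c1_curve :: "'a::topological_space chart set \<Rightarrow> (real \<Rightarrow> 'a) \<Rightarrow> bool" where
  "piecewise_c1_curve A \<gamma> \<longleftrightarrow> continuous_on {0..1} \<gamma> \<and>
     (\<exists>S. finite S \<and> (\<forall>a b. 0 \<le> a \<and> a < b \<and> b \<le> 1 \<and> {a<..<b} \<inter> S = {}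
        \<longrightarrow> c1_curve_on A \<gamma> {a..b}))"

definition velocity :: "'a chart set \<Rightarrow> (real \<Rightarrow> 'a) \<Rightarrow> real \<Rightarrow> 'a tangent" where
  "velocity A \<gamma> t = (\<lambda>c. if c \<in> A \<and> \<gamma> t \<in> fst c
     then vector_derivative (snd c \<circ> \<gamma>) (at t) else 0)"

text \<open>The finitely many break points, where \<open>velocity\<close> is meaningless, do not affect the integral.\<close>

definition curve_length ::
    "'a chart set \<Rightarrow> ('a \<Rightarrow> 'a tangent \<Rightarrow> 'a tangent \<Rightarrow> real) \<Rightarrow> (real \<Rightarrow> 'a) \<Rightarrow> ennreal" where
  "curve_length A g \<gamma> =
     (\<integral>\<^sup>+t\<in>{0..1}. ennreal (tangent_norm g (\<gamma> t) (velocity A \<gamma> t)) \<partial>lborel)"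

text \<open>The surface need not be connected: the distance between points of different components is
  the infimum of the empty set, that is \<open>\<infinity>\<close>.\<close>

definition rdist ::
    "'a::topological_space chart set \<Rightarrow> ('a \<Rightarrow> 'a tangent \<Rightarrow> 'a tangent \<Rightarrow> real) \<Rightarrow>
     'a \<Rightarrow> 'a \<Rightarrow> ennreal" where
  "rdist A g x y =
     (INF \<gamma> \<in> {\<gamma>. piecewise_c1_curve A \<gamma> \<and> \<gamma> 0 = x \<and> \<gamma> 1 = y}. curve_length A g \<gamma>)"

text \<open>Unlike \<open>ln 0 = 0\<close> on the reals, the logarithm of a vanishing distance has to be \<open>-\<infinity>\<close>.\<close>

definition elog :: "ennreal \<Rightarrow> ereal" where
  "elog d = (if d = 0 then -\<infinity> else if d = \<infinity> then \<infinity> else ereal (ln (enn2real d)))"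

section \<open>Surface diffeomorphisms\<close>

definition ck_map :: "nat \<Rightarrow> 'a::topological_space chart set \<Rightarrow> ('a \<Rightarrow> 'a) \<Rightarrow> bool" where
  "ck_map k A f \<longleftrightarrow> continuous_on UNIV f \<and>
     (\<forall>c\<in>A. \<forall>d\<in>A. ck_on k (snd d \<circ> f \<circ> chart_inv c) (snd c ` (fst c \<inter> f -` fst d)))"

definition ck_diffeo :: "nat \<Rightarrow> 'a::topological_space chart set \<Rightarrow> ('a \<Rightarrow> 'a) \<Rightarrow> bool" where
  "ck_diffeo k A f \<longleftrightarrow> bij f \<and> ck_map k A f \<and> ck_map k A (inv f)"

definition int_iter :: "('a \<Rightarrow> 'a) \<Rightarrow> int \<Rightarrow> 'a \<Rightarrow> 'a" where
  "int_iter f n = (if 0 \<le> n then f ^^ nat n else inv f ^^ nat (- n))"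

text \<open>\<open>tangent_map A f x\<close> is \<open>D\<^sub>xf\<close>; by the chain rule the choice of the chart \<open>c\<close> around \<open>x\<close>
  is immaterial on the tangent space at \<open>x\<close>.\<close>

definition tangent_map :: "'a chart set \<Rightarrow> ('a \<Rightarrow> 'a) \<Rightarrow> 'a \<Rightarrow> 'a tangent \<Rightarrow> 'a tangent" where
  "tangent_map A f x v =
     (let c = (SOME c. c \<in> A \<and> x \<in> fst c)
      in (\<lambda>d. if d \<in> A \<and> f x \<in> fst d
              then frechet_derivative (snd d \<circ> f \<circ> chart_inv c) (at (snd c x)) (v c) else 0))"

definition tangent_map_norm ::
    "'a chart set \<Rightarrow> ('a \<Rightarrow> 'a tangent \<Rightarrow> 'a tangent \<Rightarrow> real) \<Rightarrow> ('a \<Rightarrow> 'a) \<Rightarrow> 'a \<Rightarrow> real" where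
  "tangent_map_norm A g f x =
     (SUP v \<in> unit_tangent A g x. tangent_norm g (f x) (tangent_map A f x v))"

definition onb :: "'a chart set \<Rightarrow> ('a \<Rightarrow> 'a tangent \<Rightarrow> 'a tangent \<Rightarrow> real) \<Rightarrow> 'a \<Rightarrow> 2 \<Rightarrow> 'a tangent" where
  "onb A g x = (SOME b. (\<forall>i. b i \<in> tangent_space A x) \<and>
     (\<forall>i j. g x (b i) (b j) = (if i = j then 1 else 0)))"

text \<open>The matrix of \<open>D\<^sub>xf\<close> with respect to the chosen orthonormal bases at \<open>x\<close> and \<open>f x\<close>. The absolute
  value of its determinant does not depend on the bases; if \<open>f x = x\<close>, then the two bases
  coincide, and the eigenvalues do not depend on the basis either.\<close>

definition tangent_matrix ::
    "'a chart set \<Rightarrow> ('a \<Rightarrow> 'a tangent \<Rightarrow> 'a tangent \<Rightarrow> real) \<Rightarrow> ('a \<Rightarrow> 'a) \<Rightarrow> 'a \<Rightarrow> real^2^2" where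
  "tangent_matrix A g f x =
     (\<chi> i j. g (f x) (tangent_map A f x (onb A g x j)) (onb A g (f x) i))"

definition abs_det ::
    "'a chart set \<Rightarrow> ('a \<Rightarrow> 'a tangent \<Rightarrow> 'a tangent \<Rightarrow> real) \<Rightarrow> ('a \<Rightarrow> 'a) \<Rightarrow> 'a \<Rightarrow> real" where
  "abs_det A g f x = \<bar>det (tangent_matrix A g f x)\<bar>"

definition dissipative ::
    "'a chart set \<Rightarrow> ('a \<Rightarrow> 'a tangent \<Rightarrow> 'a tangent \<Rightarrow> real) \<Rightarrow> ('a \<Rightarrow> 'a) \<Rightarrow> 'a set \<Rightarrow> bool" where
  "dissipative A g f \<Lambda> \<longleftrightarrow> (\<forall>x\<in>\<Lambda>. abs_det A g f x < 1)"

text \<open>On a compact set and for a \<open>C\<^sup>1\<close> map, the supremum is a maximum.\<close>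

definition tangent_map_norm_on ::
    "'a chart set \<Rightarrow> ('a \<Rightarrow> 'a tangent \<Rightarrow> 'a tangent \<Rightarrow> real) \<Rightarrow> ('a \<Rightarrow> 'a) \<Rightarrow> 'a set \<Rightarrow> real" where
  "tangent_map_norm_on A g f \<Lambda> = (SUP x \<in> \<Lambda>. tangent_map_norm A g f x)"

definition proj_deriv ::
    "'a chart set \<Rightarrow> ('a \<Rightarrow> 'a tangent \<Rightarrow> 'a tangent \<Rightarrow> real) \<Rightarrow> ('a \<Rightarrow> 'a) \<Rightarrow> int \<Rightarrow>
     'a \<Rightarrow> 'a tangent \<Rightarrow> real" where
  "proj_deriv A g f n x v =
     abs_det A g (int_iter f n) x /
     (tangent_norm g (int_iter f n x) (tangent_map A (int_iter f n) x v))\<^sup>2"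

definition Crit ::
    "'a chart set \<Rightarrow> ('a \<Rightarrow> 'a tangent \<Rightarrow> 'a tangent \<Rightarrow> real) \<Rightarrow> ('a \<Rightarrow> 'a) \<Rightarrow> 'a set \<Rightarrow> 'a set" where
  "Crit A g f \<Lambda> = {x \<in> \<Lambda>. \<exists>v \<in> unit_tangent A g x. \<forall>n. proj_deriv A g f n x v \<ge> 1}"

definition is_eigenvalue :: "real^2^2 \<Rightarrow> complex \<Rightarrow> bool" where
  "is_eigenvalue B z \<longleftrightarrow> (\<exists>w. w \<noteq> 0 \<and> map_matrix complex_of_real B *v w = z *s w)"

text \<open>A periodic point is attracting if all the eigenvalues of the derivative of the return map,
  which may be complex, have modulus less than \<open>1\<close>.\<close>

definition is_sink ::
    "'a chart set \<Rightarrow> ('a \<Rightarrow> 'a tangent \<Rightarrow> 'a tangent \<Rightarrow> real) \<Rightarrow> ('a \<Rightarrow> 'a) \<Rightarrow> 'a \<Rightarrow> bool" where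
  "is_sink A g f p \<longleftrightarrow> (\<exists>n>0. (f ^^ n) p = p \<and>
     (\<forall>z. is_eigenvalue (tangent_matrix A g (f ^^ n) p) z \<longrightarrow> cmod z < 1))"

end

theory Submission
  imports Defs
begin

text \<open>
  Let \<open>v\<close> be the critical direction at \<open>c\<close>, \<open>M = D f^j\<close> at \<open>y = f^(-j) c\<close> and \<open>N = D f^j\<close> at \<open>c\<close>.
  Criticality for negative times says that the component of \<open>M x\<close> orthogonal to \<open>v\<close> is at most
  \<open>sqrt |det M|\<close>, and for positive times that \<open>|N v|\<close> is at most \<open>sqrt |det N|\<close>. By dissipation and
  subexponential growth, \<open>D f^(2j) = N M\<close> at \<open>y\<close> is then an exponentially strong contraction. If
  \<open>k\<close> is a time with \<open>d (f^k c) c \<le> exp (- a k)\<close> and \<open>j\<close> is a small fixed proportion of \<open>k\<close>, then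
  \<open>D f^k\<close> is still a contraction at \<open>y\<close>, and \<open>f^k y\<close> is still exponentially close to \<open>y\<close>. In
  charts, a Gronwall estimate along the orbit of \<open>y\<close> shows that \<open>f^k\<close> maps the ball of radius
  \<open>exp (- a k / 4)\<close> around \<open>y\<close> into itself and contracts it by \<open>1 / 2\<close>. Its fixed point is a sink,
  and it lies in \<open>\<Lambda>\<close> because it attracts \<open>y\<close>.
\<close>

section \<open>Products of matrices along an orbit\<close>

text \<open>At \<open>c\<close> itself nothing forces a contraction: only the direction
  \<open>v\<close> is controlled, and the other directions may stay large. Starting \<open>j\<close>
  steps earlier repairs this, since what arrives at \<open>c\<close> is then nearly aligned with
  \<open>v\<close>. The price is that the closeness of \<open>f^k c\<close> to \<open>c\<close> has
  to be carried back by \<open>f^(-j)\<close>, which may expand by some factor \<open>L\<close> at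
  each step. The order of the choices settles this competition. Recurrence gives \<open>a\<close>;
  compactness gives \<open>L\<close> and a uniform rate of dissipation. Next comes the proportion
  \<open>j / k\<close>, so small that \<open>L^j\<close> stays below \<open>exp (a k / 2)\<close>.
  Only then is \<epsilon> chosen, so small that the growth \<open>exp (\<epsilon> k)\<close> is
  beaten by the contraction over \<open>j\<close> steps and, in the second-order errors, by the
  radius of the ball. The constant in front of \<open>exp (\<epsilon> n)\<close> depends on
  \<epsilon>, so it may enter only in the last choice, that of \<open>k\<close>.\<close>

lemma norm_mult_critical_le:
  fixes M N Mi :: "real^2^2" and v x :: "real^2"
  assumes inv: "M ** Mi = mat 1" and v: "norm v = 1"
    and M: "\<And>x. norm (M *v x) \<le> m * norm x" and N: "\<And>x. norm (N *v x) \<le> n * norm x"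
    and crit_fwd: "(norm (N *v v))\<^sup>2 \<le> \<bar>det N\<bar>" and crit_bwd: "(norm (Mi *v v))\<^sup>2 \<le> \<bar>det Mi\<bar>"
  shows "norm ((N ** M) *v x) \<le> (m * sqrt \<bar>det N\<bar> + n * sqrt \<bar>det M\<bar>) * norm x"
proof -
  \<comment> \<open>\<open>w\<close> is \<open>v\<close> turned by a right angle, so
    \<open>x \<bullet> w\<close> is the determinant of the pair \<open>v\<close>,
    \<open>x\<close>.\<close>
  define w :: "real^2" where "w = (\<chi> i. if i = 1 then - (v$2) else v$1)"
  have v2: "(v$1)\<^sup>2 + (v$2)\<^sup>2 = 1"
    using v by (simp add: norm_vec_def L2_set_def sum_2)
  have w: "norm w = 1"
    using v2 by (simp add: norm_vec_def L2_set_def sum_2 w_def add.commute)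
  have decomp: "y = (y \<bullet> v) *\<^sub>R v + (y \<bullet> w) *\<^sub>R w" for y :: "real^2"
  proof -
    have "y$1 = y$1 * ((v$1)\<^sup>2 + (v$2)\<^sup>2)" "y$2 = y$2 * ((v$1)\<^sup>2 + (v$2)\<^sup>2)"
      by (simp_all add: v2)
    then show ?thesis
      by (simp add: vec_eq_iff forall_2 inner_vec_def sum_2 w_def power2_eq_square algebra_simps)
  qed
  have dets: "det M * det Mi = 1"
    using inv by (metis det_mul det_I)
  define u where "u = Mi *v v"
  have Mu: "M *v u = v"
    by (simp add: u_def matrix_vector_mul_assoc inv)
  \<comment> \<open>The component of \<open>M x\<close> across \<open>v\<close> is an area: as
    \<open>v = M u\<close>, it is \<open>det M\<close> times the area spanned by \<open>u\<close>
    and \<open>x\<close>. Backward criticality bounds \<open>norm u\<close>.\<close>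
  have cross: "(M *v x) \<bullet> w = det M * (u$1 * x$2 - u$2 * x$1)"
    unfolding Mu[symmetric] w_def
    by (simp add: inner_vec_def sum_2 matrix_vector_mult_def det_2 algebra_simps)
  have "\<bar>u$1 * x$2 - u$2 * x$1\<bar> \<le> norm u * norm x"
  proof -
    \<comment> \<open>Lagrange's identity: the two sides differ by the square of
      \<open>u \<bullet> x\<close>.\<close>
    have "(u$1 * x$2 - u$2 * x$1)\<^sup>2 \<le> ((u$1)\<^sup>2 + (u$2)\<^sup>2) * ((x$1)\<^sup>2 + (x$2)\<^sup>2)"
      using zero_le_power2[of "u$1 * x$1 + u$2 * x$2"]
      by (simp add: power2_eq_square algebra_simps)
    also have "\<dots> = (norm u * norm x)\<^sup>2"
      by (simp add: norm_vec_def L2_set_def sum_2 power_mult_distrib)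
    finally show ?thesis
      by (metis abs_le_square_iff abs_mult abs_norm_cancel)
  qed
  moreover have "norm u \<le> sqrt \<bar>det Mi\<bar>"
    using crit_bwd by (simp add: real_le_rsqrt u_def)
  ultimately have "\<bar>(M *v x) \<bullet> w\<bar> \<le> \<bar>det M\<bar> * (sqrt \<bar>det Mi\<bar> * norm x)"
    unfolding cross abs_mult
    by (meson abs_ge_zero mult_left_mono mult_right_mono norm_ge_zero order_trans)
  also have "\<bar>det M\<bar> * (sqrt \<bar>det Mi\<bar> * norm x) = sqrt \<bar>det M\<bar> * norm x"
  proof -
    have "sqrt \<bar>det M\<bar> * sqrt \<bar>det Mi\<bar> = 1"
      using dets by (simp flip: real_sqrt_mult abs_mult)
    then have "\<bar>det M\<bar> * sqrt \<bar>det Mi\<bar> = sqrt \<bar>det M\<bar>"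
      by (metis abs_abs mult.assoc mult.right_neutral real_sqrt_abs2 real_sqrt_mult)
    then show ?thesis by (metis mult.assoc)
  qed
  finally have b: "\<bar>(M *v x) \<bullet> w\<bar> \<le> sqrt \<bar>det M\<bar> * norm x" .
  have a: "\<bar>(M *v x) \<bullet> v\<bar> \<le> m * norm x"
    using Cauchy_Schwarz_ineq2[of "M *v x" v] M[of x] v by simp
  have "(N ** M) *v x = ((M *v x) \<bullet> v) *\<^sub>R (N *v v) + ((M *v x) \<bullet> w) *\<^sub>R (N *v w)"
    by (subst matrix_vector_mul_assoc[symmetric], subst decomp[of "M *v x"])
      (simp add: matrix_vector_right_distrib matrix_vector_mult_scaleR)
  then have "norm ((N ** M) *v x) \<le>
      \<bar>(M *v x) \<bullet> v\<bar> * norm (N *v v) + \<bar>(M *v x) \<bullet> w\<bar> * norm (N *v w)"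
    by (metis norm_scaleR norm_triangle_ineq)
  also have "\<dots> \<le> (m * norm x) * sqrt \<bar>det N\<bar> + (sqrt \<bar>det M\<bar> * norm x) * n"
  proof (intro add_mono mult_mono)
    show "norm (N *v v) \<le> sqrt \<bar>det N\<bar>"
      using crit_fwd by (rule real_le_rsqrt)
    show "norm (N *v w) \<le> n"
      using N[of w] w by simp
    show "0 \<le> m * norm x"
      using a abs_ge_zero order_trans by blast
  qed (use a b in auto)
  finally show ?thesis by (simp add: algebra_simps)
qed

section \<open>Gronwall estimates for perturbed linear recursions\<close>

lemma discrete_gronwall:
  fixes u :: "nat \<Rightarrow> real"
  assumes "\<And>m. m \<le> n \<Longrightarrow> u m \<le> a + \<kappa> * (\<Sum>i<m. u i)" and "0 \<le> \<kappa>"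
  shows "u n \<le> a * (1 + \<kappa>) ^ n"
  using assms(1)
proof (induction n rule: less_induct)
  case (less n)
  have "u n \<le> a + \<kappa> * (\<Sum>i<n. u i)"
    using less.prems by simp
  also have "\<dots> \<le> a + \<kappa> * (\<Sum>i<n. a * (1 + \<kappa>) ^ i)"
    using less assms(2) by (intro add_left_mono mult_left_mono sum_mono) auto
  also have "\<dots> = a * (1 + \<kappa>) ^ n"
    by (induction n) (auto simp: algebra_simps)
  finally show ?case .
qed

text \<open>\<open>e\<close> is the difference of two orbits; \<open>S i m\<close> is the product of the linear parts \<open>T\<close>
  over the times from \<open>i\<close> to \<open>m\<close>.\<close>

lemma perturbed_linear_recursion:
  fixes e :: "nat \<Rightarrow> 'a::real_normed_vector" and S :: "nat \<Rightarrow> nat \<Rightarrow> 'a \<Rightarrow> 'a"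
    and k :: nat and C q \<kappa> :: real
  assumes T: "\<And>n. linear (T n)"
    and S0: "\<And>i x. S i i x = x" and SS: "\<And>i m x. i \<le> m \<Longrightarrow> S i (Suc m) x = T m (S i m x)"
    and bound: "\<And>i m x. i \<le> m \<Longrightarrow> m \<le> k \<Longrightarrow> norm (S i m x) \<le> C * q ^ (m - i) * norm x"
    and step: "\<And>i. i < m \<Longrightarrow> norm (e (Suc i) - T i (e i)) \<le> \<kappa> * norm (e i)"
    and "m \<le> k" "1 \<le> C" "1 \<le> q" "0 \<le> \<kappa>" "k * C * \<kappa> \<le> 1"
  shows "norm (e m) \<le> 3 * C * q ^ m * norm (e 0)"
    and "norm (e m) \<le> norm (S 0 m (e 0)) + 3 * C\<^sup>2 * \<kappa> * k * q ^ k * norm (e 0)"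
proof -
  define r where "r i = e (Suc i) - T i (e i)" for i
  have r: "norm (r i) \<le> \<kappa> * norm (e i)" if "i < m" for i
    using step[OF that] by (simp add: r_def)
  \<comment> \<open>Discrete variation of constants: the error made at time \<open>i\<close> is
    transported by the linear parts from time \<open>Suc i\<close> on.\<close>
  have expand: "e n = S 0 n (e 0) + (\<Sum>i<n. S (Suc i) n (r i))" for n
  proof (induction n)
    case 0
    then show ?case by (simp add: S0)
  next
    case (Suc n)
    have "e (Suc n) = T n (e n) + r n"
      by (simp add: r_def)
    also have "T n (e n) = T n (S 0 n (e 0)) + (\<Sum>i<n. T n (S (Suc i) n (r i)))"
      by (subst Suc.IH) (simp add: linear_add[OF T] linear_sum[OF T])
    also have "\<dots> = S 0 (Suc n) (e 0) + (\<Sum>i<n. S (Suc i) (Suc n) (r i))"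
      by (simp add: SS)
    finally show ?case by (simp add: S0)
  qed
  have C0: "0 \<le> C" and q0: "0 < q" using assms by auto
  have sumb: "norm (\<Sum>i<n. S (Suc i) n (r i)) \<le> (\<Sum>i<n. C * q ^ (n - Suc i) * (\<kappa> * norm (e i)))"
    if "n \<le> m" for n
    using that r \<open>m \<le> k\<close> C0 q0
    by (intro sum_norm_le order_trans[OF bound] mult_left_mono) auto
  \<comment> \<open>Division by \<open>q ^ n\<close> turns the bound on the homogeneous part into a
    constant, so that Gronwall applies with rate \<open>C * \<kappa>\<close>.\<close>
  define u where "u n = norm (e n) / q ^ n" for n
  have u: "u n \<le> C * norm (e 0) + C * \<kappa> * (\<Sum>i<n. u i)" if "n \<le> m" for n
  proof -
    have "norm (e n) \<le> norm (S 0 n (e 0)) + norm (\<Sum>i<n. S (Suc i) n (r i))"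
      by (subst expand) (rule norm_triangle_ineq)
    also have "\<dots> \<le> C * q ^ n * norm (e 0) + (\<Sum>i<n. C * q ^ (n - Suc i) * (\<kappa> * norm (e i)))"
      using bound[of 0 n "e 0"] sumb that \<open>m \<le> k\<close> by (intro add_mono) auto
    also have "\<dots> \<le> C * q ^ n * norm (e 0) + (\<Sum>i<n. C * \<kappa> * (q ^ n * u i))"
    proof (intro add_left_mono sum_mono)
      fix i assume "i \<in> {..<n}"
      then have "q ^ n = q ^ ((n - Suc i) + Suc i)"
        by simp
      also have "\<dots> = q ^ (n - Suc i) * q * q ^ i"
        by (simp only: power_add power_Suc mult.assoc)
      finally have "q ^ n = q ^ (n - Suc i) * q * q ^ i" .
      moreover have "q ^ i * u i = norm (e i)"
        using q0 by (simp add: u_def)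
      ultimately have "q ^ n * u i = q ^ (n - Suc i) * q * norm (e i)"
        by (metis mult.assoc)
      moreover have "q ^ (n - Suc i) * 1 * norm (e i) \<le> q ^ (n - Suc i) * q * norm (e i)"
        using q0 \<open>1 \<le> q\<close> by (intro mult_mono) auto
      ultimately have "q ^ (n - Suc i) * norm (e i) \<le> q ^ n * u i" by simp
      from mult_left_mono[OF this, of "C * \<kappa>"]
      show "C * q ^ (n - Suc i) * (\<kappa> * norm (e i)) \<le> C * \<kappa> * (q ^ n * u i)"
        using C0 \<open>0 \<le> \<kappa>\<close> by (simp add: mult_ac)
    qed
    also have "\<dots> = q ^ n * (C * norm (e 0) + C * \<kappa> * (\<Sum>i<n. u i))"
      by (simp add: algebra_simps sum_distrib_left)
    finally show ?thesis
      using q0 by (simp add: u_def divide_le_eq mult.commute)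
  qed
  have main: "norm (e n) \<le> 3 * C * q ^ n * norm (e 0)" if "n \<le> m" for n
  proof -
    have "u n \<le> C * norm (e 0) * (1 + C * \<kappa>) ^ n"
      using u that C0 \<open>0 \<le> \<kappa>\<close> by (intro discrete_gronwall) auto
    \<comment> \<open>The hypothesis \<open>k * C * \<kappa> \<le> 1\<close> bounds this by
      \<open>exp 1\<close>; here the factor \<open>3\<close> of the statement arises.\<close>
    also have "(1 + C * \<kappa>) ^ n \<le> 3"
    proof -
      have "(1 + C * \<kappa>) ^ n \<le> exp (C * \<kappa>) ^ n"
        using C0 \<open>0 \<le> \<kappa>\<close> by (intro power_mono) auto
      also have "\<dots> = exp (n * (C * \<kappa>))"
        by (simp add: exp_of_nat_mult)
      also have "\<dots> \<le> exp 1"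
      proof -
        have "n * (C * \<kappa>) \<le> k * (C * \<kappa>)"
          using that \<open>m \<le> k\<close> C0 \<open>0 \<le> \<kappa>\<close> by (intro mult_right_mono) auto
        then show ?thesis using \<open>k * C * \<kappa> \<le> 1\<close> by (simp add: mult.assoc)
      qed
      also have "\<dots> \<le> 3" using exp_le by simp
      finally show ?thesis .
    qed
    finally have "u n \<le> C * norm (e 0) * 3"
      using C0 by (simp add: mult_left_mono)
    then show ?thesis
      using q0 by (simp add: u_def divide_le_eq mult_ac)
  qed
  show "norm (e m) \<le> 3 * C * q ^ m * norm (e 0)"
    using main by simp
  \<comment> \<open>The second bound feeds the first one back into the sum, which has at most
    \<open>k\<close> terms; the main term keeps the exact product \<open>S 0 m\<close>.\<close>
  have "norm (\<Sum>i<m. S (Suc i) m (r i)) \<le> (\<Sum>i<m. C * q ^ (m - Suc i) * (\<kappa> * norm (e i)))"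
    using sumb by simp
  also have "\<dots> \<le> (\<Sum>i<m. 3 * C\<^sup>2 * \<kappa> * q ^ k * norm (e 0))"
  proof (intro sum_mono)
    fix i assume i: "i \<in> {..<m}"
    have "C * q ^ (m - Suc i) * (\<kappa> * norm (e i)) \<le> C * q ^ (m - Suc i) * (\<kappa> * (3 * C * q ^ i * norm (e 0)))"
      using main[of i] i C0 q0 \<open>0 \<le> \<kappa>\<close> by (intro mult_left_mono) auto
    also have "\<dots> = 3 * C\<^sup>2 * \<kappa> * q ^ (m - Suc i + i) * norm (e 0)"
      by (simp add: power_add power2_eq_square)
    also have "\<dots> \<le> 3 * C\<^sup>2 * \<kappa> * q ^ k * norm (e 0)"
      using i \<open>m \<le> k\<close> C0 q0 \<open>0 \<le> \<kappa>\<close> \<open>1 \<le> q\<close>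
      by (intro mult_right_mono mult_left_mono power_increasing) auto
    finally show "C * q ^ (m - Suc i) * (\<kappa> * norm (e i)) \<le> 3 * C\<^sup>2 * \<kappa> * q ^ k * norm (e 0)" .
  qed
  also have "\<dots> = m * (3 * C\<^sup>2 * \<kappa> * q ^ k * norm (e 0))" by simp
  also have "\<dots> \<le> k * (3 * C\<^sup>2 * \<kappa> * q ^ k * norm (e 0))"
    using \<open>m \<le> k\<close> C0 q0 \<open>0 \<le> \<kappa>\<close> by (intro mult_right_mono) auto
  finally have "norm (\<Sum>i<m. S (Suc i) m (r i)) \<le> 3 * C\<^sup>2 * \<kappa> * k * q ^ k * norm (e 0)"
    by (simp add: mult_ac)
  then show "norm (e m) \<le> norm (S 0 m (e 0)) + 3 * C\<^sup>2 * \<kappa> * k * q ^ k * norm (e 0)"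
    by (subst expand) (rule norm_triangle_mono, auto)
qed

section \<open>Tangent spaces and orthonormal frames\<close>

text \<open>For \<open>h = id\<close> this is the derivative of a change of coordinates, so a single
  chain rule covers both composition of maps and change of chart.\<close>

definition chart_deriv :: "('a \<Rightarrow> 'a) \<Rightarrow> 'a chart \<Rightarrow> 'a chart \<Rightarrow> 'a \<Rightarrow> real^2 \<Rightarrow> real^2" where
  "chart_deriv h c d x = frechet_derivative (snd d \<circ> h \<circ> chart_inv c) (at (snd c x))"

text \<open>Differentiability in charts passes to compositions and iterates, and it suffices for the
  calculus of differentials; the second derivative of an iterate never has to be considered.\<close>

definition diff_map :: "'a::topological_space chart set \<Rightarrow> ('a \<Rightarrow> 'a) \<Rightarrow> bool" where
  "diff_map A h \<longleftrightarrow> continuous_on UNIV h \<and>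
     (\<forall>c\<in>A. \<forall>d\<in>A. \<forall>x. x \<in> fst c \<longrightarrow> h x \<in> fst d \<longrightarrow>
        (snd d \<circ> h \<circ> chart_inv c) differentiable (at (snd c x)))"

context compact_riemannian_surface
begin

lemma chart_inv_left: "c \<in> A \<Longrightarrow> x \<in> fst c \<Longrightarrow> chart_inv c (snd c x) = x"
  using charts[of c] by (auto simp: is_chart_def homeomorphism_def)

lemma chart_inv_right: "c \<in> A \<Longrightarrow> u \<in> snd c ` fst c \<Longrightarrow> snd c (chart_inv c u) = u"
  using charts[of c] by (auto simp: is_chart_def homeomorphism_def)

lemma chart_inv_in: "c \<in> A \<Longrightarrow> u \<in> snd c ` fst c \<Longrightarrow> chart_inv c u \<in> fst c"
  using charts[of c] by (auto simp: is_chart_def homeomorphism_def)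

lemma open_chart: "c \<in> A \<Longrightarrow> open (fst c)"
  using charts[of c] by (auto simp: is_chart_def)

lemma open_chart_image: "c \<in> A \<Longrightarrow> open (snd c ` fst c)"
  using charts[of c] by (auto simp: is_chart_def)

lemma continuous_on_chart: "c \<in> A \<Longrightarrow> continuous_on (fst c) (snd c)"
  using charts[of c] by (auto simp: is_chart_def homeomorphism_def)

lemma continuous_on_chart_inv: "c \<in> A \<Longrightarrow> continuous_on (snd c ` fst c) (chart_inv c)"
  using charts[of c] by (auto simp: is_chart_def homeomorphism_def)

lemma chart_image_eq_vimage:
  assumes "c \<in> A" "S \<subseteq> fst c"
  shows "snd c ` S = snd c ` fst c \<inter> chart_inv c -` S"
  using assms by (force simp: chart_inv_left chart_inv_right image_iff)

lemma open_chart_image_subset: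
  assumes "c \<in> A" "open S" "S \<subseteq> fst c"
  shows "open (snd c ` S)"
  unfolding chart_image_eq_vimage[OF assms(1,3)]
  using continuous_on_chart_inv[OF assms(1)] open_chart_image[OF assms(1)] assms(2)
  by (simp add: continuous_on_open_vimage Int_commute)

lemma obtain_chart: obtains c where "c \<in> A" "x \<in> fst c"
  using charts_cover by blast

lemma open_domain:
  assumes "continuous_on UNIV h" "c \<in> A" "d \<in> A"
  shows "open (fst c \<inter> h -` fst d)" "open (snd c ` (fst c \<inter> h -` fst d))"
proof -
  show *: "open (fst c \<inter> h -` fst d)"
    using assms by (intro open_Int open_vimage open_chart)
  show "open (snd c ` (fst c \<inter> h -` fst d))"
    using assms * by (intro open_chart_image_subset) auto
qed

lemma diff_mapD:
  assumes "diff_map A h" "c \<in> A" "d \<in> A" "x \<in> fst c" "h x \<in> fst d"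
  shows "((snd d \<circ> h \<circ> chart_inv c) has_derivative chart_deriv h c d x) (at (snd c x))"
  using assms unfolding diff_map_def chart_deriv_def frechet_derivative_works by blast

lemma linear_chart_deriv:
  assumes "diff_map A h" "c \<in> A" "d \<in> A" "x \<in> fst c" "h x \<in> fst d"
  shows "linear (chart_deriv h c d x)"
  using diff_mapD[OF assms] has_derivative_linear by blast

lemma has_derivative_chart_comp:
  assumes h: "diff_map A h" and k: "diff_map A k" and cde: "c \<in> A" "d \<in> A" "e \<in> A"
    and x: "x \<in> fst c" "h x \<in> fst d" "k (h x) \<in> fst e"
  shows "((snd e \<circ> (k \<circ> h) \<circ> chart_inv c) has_derivative
      (chart_deriv k d e (h x) \<circ> chart_deriv h c d x)) (at (snd c x))"
proof -
  have h': "continuous_on UNIV h" using h by (simp add: diff_map_def)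
  have *: "(snd d \<circ> h \<circ> chart_inv c) (snd c x) = snd d (h x)"
    by (simp add: cde x chart_inv_left)
  have "((snd e \<circ> k \<circ> chart_inv d) \<circ> (snd d \<circ> h \<circ> chart_inv c) has_derivative
      (chart_deriv k d e (h x) \<circ> chart_deriv h c d x)) (at (snd c x))"
    using diff_mapD[OF h] diff_mapD[OF k] cde x * by (intro diff_chain_at) auto
  \<comment> \<open>Inserting the chart \<open>d\<close> is legitimate only where \<open>h\<close>
    takes values in its domain, which is an open neighbourhood of the point.\<close>
  then show ?thesis
  proof (rule has_derivative_transform_within_open)
    show "open (snd c ` (fst c \<inter> h -` fst d))"
      using open_domain(2)[OF h'] cde by blast
  qed (use cde x in \<open>auto simp: chart_inv_left\<close>)
qed

lemma diff_map_comp: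
  assumes "diff_map A h" "diff_map A k"
  shows "diff_map A (k \<circ> h)"
  unfolding diff_map_def
proof (intro conjI ballI allI impI)
  show "continuous_on UNIV (k \<circ> h)"
    using assms unfolding diff_map_def by (intro continuous_on_compose) (auto intro: continuous_on_subset)
next
  fix c e x assume *: "c \<in> A" "e \<in> A" "x \<in> fst c" "(k \<circ> h) x \<in> fst e"
  obtain d where "d \<in> A" "h x \<in> fst d" using obtain_chart .
  then show "(snd e \<circ> (k \<circ> h) \<circ> chart_inv c) differentiable at (snd c x)"
    using has_derivative_chart_comp[OF assms] * unfolding differentiable_def by fastforce
qed

lemma chart_deriv_comp:
  assumes "diff_map A h" "diff_map A k" "c \<in> A" "d \<in> A" "e \<in> A"
    and "x \<in> fst c" "h x \<in> fst d" "k (h x) \<in> fst e"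
  shows "chart_deriv (k \<circ> h) c e x v = chart_deriv k d e (h x) (chart_deriv h c d x v)"
  using frechet_derivative_at[OF has_derivative_chart_comp[OF assms]]
  by (metis chart_deriv_def comp_apply)

lemma diff_map_id: "diff_map A id"
  unfolding diff_map_def
proof (intro conjI ballI allI impI)
  fix c d x assume *: "c \<in> A" "d \<in> A" "x \<in> fst c" "id x \<in> fst d"
  then have "ck_on (Suc 0) (snd d \<circ> chart_inv c) (snd c ` (fst c \<inter> fst d))"
    using smooth_coordinate_change unfolding smooth_on_def by blast
  then show "(snd d \<circ> id \<circ> chart_inv c) differentiable at (snd c x)"
    using * by (simp add: comp_id)
qed (auto intro: continuous_on_id)

lemma diff_map_funpow: "diff_map A h \<Longrightarrow> diff_map A (h ^^ n)"
  by (induction n) (auto intro: diff_map_id diff_map_comp)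

lemma ck_map_imp_diff_map:
  assumes "ck_map (Suc k) A h"
  shows "diff_map A h"
  using assms unfolding ck_map_def diff_map_def by (simp add: image_iff)

lemma chart_deriv_id_same:
  assumes "c \<in> A" "x \<in> fst c"
  shows "chart_deriv id c c x v = v"
proof -
  have "((snd c \<circ> id \<circ> chart_inv c) has_derivative (\<lambda>v. v)) (at (snd c x))"
  proof (rule has_derivative_transform_within_open[OF has_derivative_ident])
    show "open (snd c ` fst c)" using assms open_chart_image by blast
  qed (use assms in \<open>auto simp: chart_inv_left\<close>)
  from frechet_derivative_at[OF this] show ?thesis
    by (metis chart_deriv_def)
qed

section \<open>Tangent vectors and tangent maps in coordinates\<close>

lemma tangent_of_eq:
  "tangent_of A x c e = (\<lambda>d. if d \<in> A \<and> x \<in> fst d then chart_deriv id c d x e else 0)"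
  by (simp add: tangent_of_def chart_deriv_def cong: if_cong)

lemma tangent_of_same: "c \<in> A \<Longrightarrow> x \<in> fst c \<Longrightarrow> tangent_of A x c e c = e"
  by (simp add: tangent_of_eq chart_deriv_id_same)

lemma tangent_of_in: 
  assumes "c \<in> A" "x \<in> fst c"
  shows "tangent_of A x c e \<in> tangent_space A x"
  unfolding tangent_space_def mem_Collect_eq
proof (intro ballI impI ext)
  fix c' d assume "c' \<in> A" "x \<in> fst c'"
  then show "tangent_of A x c e d = tangent_of A x c' (tangent_of A x c e c') d"
    using assms chart_deriv_comp[OF diff_map_id diff_map_id, of c c' d x e]
    by (simp add: tangent_of_eq)
qed

lemma tangent_spaceD:
  "v \<in> tangent_space A x \<Longrightarrow> c \<in> A \<Longrightarrow> x \<in> fst c \<Longrightarrow> tangent_of A x c (v c) = v"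
  by (simp add: tangent_space_def)

text \<open>Composing with \<open>id\<close> on either side and using the chain rule makes the chart
  picked by \<open>SOME\<close> in \<open>tangent_map\<close> disappear.\<close>

lemma tangent_map_tangent_of:
  assumes h: "diff_map A h" and cd: "c \<in> A" "x \<in> fst c" "d \<in> A" "h x \<in> fst d"
  shows "tangent_map A h x (tangent_of A x c e) = tangent_of A (h x) d (chart_deriv h c d x e)"
proof -
  define c' where "c' = (SOME c. c \<in> A \<and> x \<in> fst c)"
  have c': "c' \<in> A" "x \<in> fst c'"
    using someI[of "\<lambda>c. c \<in> A \<and> x \<in> fst c" c] cd by (auto simp: c'_def)
  have "chart_deriv h c' d' x (chart_deriv id c c' x e) = chart_deriv id d d' (h x) (chart_deriv h c d x e)"
    if "d' \<in> A" "h x \<in> fst d'" for d'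
    using chart_deriv_comp[OF diff_map_id h, of c c' d' x e] chart_deriv_comp[OF h diff_map_id, of c d d' x e]
      that cd c' by simp
  then show ?thesis
    using c' unfolding tangent_map_def c'_def[symmetric] Let_def
    by (auto simp: fun_eq_iff tangent_of_eq chart_deriv_def)
qed

lemma tangent_of_eq_0_iff:
  assumes "c \<in> A" "x \<in> fst c"
  shows "tangent_of A x c e = (\<lambda>_. 0) \<longleftrightarrow> e = 0"
proof
  assume "tangent_of A x c e = (\<lambda>_. 0)"
  then show "e = 0" by (metis tangent_of_same[OF assms])
next
  assume "e = 0"
  then show "tangent_of A x c e = (\<lambda>_. 0)"
    using assms linear_0[OF linear_chart_deriv[OF diff_map_id, of c _ x]]
    by (auto simp: fun_eq_iff tangent_of_eq)
qed

section \<open>The metric in charts and orthonormal bases\<close>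

abbreviation chart_metric :: "'a chart \<Rightarrow> 'a \<Rightarrow> real^2 \<Rightarrow> real^2 \<Rightarrow> real" where
  "chart_metric c x e e' \<equiv> g x (tangent_of A x c e) (tangent_of A x c e')"

lemma chart_metric_pos: "c \<in> A \<Longrightarrow> x \<in> fst c \<Longrightarrow> e \<noteq> 0 \<Longrightarrow> chart_metric c x e e > 0"
  by (simp add: metric_pos tangent_of_in tangent_of_eq_0_iff)

lemma chart_metric_sym: "c \<in> A \<Longrightarrow> x \<in> fst c \<Longrightarrow> chart_metric c x e e' = chart_metric c x e' e"
  by (simp add: metric_sym tangent_of_in)

text \<open>Gram-Schmidt applied to the coordinate axes of a chart.\<close>

lemma onb_exists:
  "\<exists>b :: 2 \<Rightarrow> 'a tangent. (\<forall>i. b i \<in> tangent_space A x) \<and>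
     (\<forall>i j. g x (b i) (b j) = (if i = j then 1 else 0))"
proof -
  obtain c where c: "c \<in> A" "x \<in> fst c" using obtain_chart .
  let ?B = "chart_metric c x"
  have bl: "bilinear ?B" using metric_bilinear[OF c] .
  note bs = bilinear_lmul[OF bl] bilinear_rmul[OF bl] bilinear_lsub[OF bl] bilinear_rsub[OF bl]
  note pos = chart_metric_pos[OF c]
  have nrm: "?B ((1 / sqrt (?B e e)) *\<^sub>R e) ((1 / sqrt (?B e e)) *\<^sub>R e) = 1" if "e \<noteq> 0" for e
    using pos[OF that] by (simp add: bs)
  define e where "e = (1 / sqrt (?B (axis 1 1) (axis 1 1))) *\<^sub>R (axis 1 1 :: real^2)"
  define w where "w = axis 2 1 - ?B e (axis 2 1) *\<^sub>R e"
  have ee: "?B e e = 1" unfolding e_def by (rule nrm) (simp add: axis_eq_0_iff)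
  \<comment> \<open>The second vector cannot vanish: only a multiple of the first axis has been
    subtracted from the second one.\<close>
  have "w $ 2 = 1" by (simp add: w_def e_def axis_def)
  then have w0: "w \<noteq> 0" by auto
  have ew: "?B e w = 0" by (simp add: w_def bs ee)
  define f where "f = (1 / sqrt (?B w w)) *\<^sub>R w"
  have "?B f f = 1" unfolding f_def by (rule nrm[OF w0])
  moreover have "?B e f = 0" by (simp add: f_def bs ew)
  moreover from this have "?B f e = 0" using chart_metric_sym[OF c] by metis
  ultimately show ?thesis
    using ee c
    by (intro exI[of _ "\<lambda>i. if i = 1 then tangent_of A x c e else tangent_of A x c f"])
      (auto simp: forall_2 tangent_of_in)
qed

lemma onb_in: "onb A g x i \<in> tangent_space A x"
  and onb_orthonormal: "g x (onb A g x i) (onb A g x j) = (if i = j then 1 else 0)"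
  using someI_ex[OF onb_exists[of x]] unfolding onb_def by auto

text \<open>The matrix taking coordinates in the chart \<open>c\<close> to coordinates in the orthonormal basis.\<close>

definition frame :: "'a chart \<Rightarrow> 'a \<Rightarrow> real^2^2" where
  "frame c x = (\<chi> i j. g x (tangent_of A x c (axis j 1)) (onb A g x i))"

lemma linear_metric_left:
  assumes c: "c \<in> A" "x \<in> fst c" and v: "v \<in> tangent_space A x"
  shows "linear (\<lambda>e. g x (tangent_of A x c e) v)"
  using metric_bilinear[OF c] tangent_spaceD[OF v c] unfolding bilinear_def by metis

lemma frame_mult:
  assumes c: "c \<in> A" "x \<in> fst c"
  shows "(frame c x *v e) $ i = g x (tangent_of A x c e) (onb A g x i)"
proof -
  note l = linear_metric_left[OF c onb_in[of x i]]
  have "e = (\<Sum>j\<in>UNIV. e $ j *\<^sub>R axis j 1)"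
    using basis_expansion[of e] by (simp add: scalar_mult_eq_scaleR)
  then have "g x (tangent_of A x c e) (onb A g x i)
      = (\<Sum>j\<in>UNIV. e $ j * g x (tangent_of A x c (axis j 1)) (onb A g x i))"
    using linear_sum[OF l, of "\<lambda>j. e $ j *\<^sub>R axis j 1" UNIV] by (simp add: linear_cmul[OF l])
  then show ?thesis
    by (simp add: frame_def matrix_vector_mult_def mult.commute)
qed

text \<open>Orthonormality makes \<open>T\<close> a right inverse of the frame matrix. It is
  therefore injective, hence onto in finite dimension, so every \<open>e\<close> has the form
  \<open>T a\<close>.\<close>

lemma frame_expansion:
  assumes c: "c \<in> A" "x \<in> fst c"
  shows "e = (\<Sum>i\<in>UNIV. (frame c x *v e) $ i *\<^sub>R (onb A g x i c))"
proof -
  let ?b = "\<lambda>i. onb A g x i c"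
  have b: "tangent_of A x c (?b i) = onb A g x i" for i
    using tangent_spaceD[OF onb_in c] .
  have fb: "(frame c x *v ?b j) $ i = (if i = j then 1 else 0)" for i j
    by (simp add: frame_mult[OF c] b onb_orthonormal)
  define T where "T a = (\<Sum>i\<in>UNIV. a $ i *\<^sub>R ?b i)" for a :: "real^2"
  have lT: "linear T"
    unfolding T_def by (intro linearI) (simp_all add: sum.distrib algebra_simps scaleR_right.sum)
  have FT: "frame c x *v T a = a" for a
    by (simp add: T_def vec_eq_iff linear_sum[OF matrix_vector_mul_linear] sum_2 matrix_vector_right_distrib
        matrix_vector_mult_scaleR fb forall_2)
  then have "inj T" by (metis injI)
  then have "surj T" using lT linear_injective_imp_surjective by blast
  then obtain a where "e = T a" by blast
  then show ?thesis using FT by (metis T_def)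
qed

text \<open>The frame matrix is an isometry onto the Euclidean plane; all Riemannian estimates
  become estimates on real matrices.\<close>

lemma frame_inner:
  assumes c: "c \<in> A" "x \<in> fst c"
  shows "chart_metric c x e e' = (frame c x *v e) \<bullet> (frame c x *v e')"
proof -
  have b: "tangent_of A x c (onb A g x i c) = onb A g x i" for i
    using tangent_spaceD[OF onb_in c] .
  note l = linear_metric_left[OF c tangent_of_in[OF c, of e']]
  have "chart_metric c x e e' = (\<Sum>i\<in>UNIV. (frame c x *v e) $ i * g x (onb A g x i) (tangent_of A x c e'))"
    by (subst frame_expansion[OF c, of e]) (simp add: linear_sum[OF l] linear_cmul[OF l] b)
  also have "\<dots> = (frame c x *v e) \<bullet> (frame c x *v e')"
    unfolding inner_vec_def
    by (intro sum.cong) (simp_all add: frame_mult[OF c] metric_sym[OF onb_in tangent_of_in[OF c]])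
  finally show ?thesis .
qed

lemma tangent_norm_frame:
  assumes "c \<in> A" "x \<in> fst c"
  shows "tangent_norm g x (tangent_of A x c e) = norm (frame c x *v e)"
  by (simp add: tangent_norm_def frame_inner[OF assms] norm_eq_sqrt_inner)

lemma invertible_frame:
  assumes c: "c \<in> A" "x \<in> fst c"
  shows "invertible (frame c x)"
proof -
  have "e = 0" if "frame c x *v e = 0" for e
    using frame_inner[OF c, of e e] chart_metric_pos[OF c, of e] that by fastforce
  then show ?thesis
    by (metis invertible_left_inverse matrix_left_invertible_ker)
qed

lemma frame_surj:
  assumes "c \<in> A" "x \<in> fst c"
  obtains e where "w = frame c x *v e"
proof -
  obtain B where "frame c x ** B = mat 1"
    using invertible_frame[OF assms] unfolding invertible_def by blast
  then have "w = frame c x *v (B *v w)"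
    by (simp add: matrix_vector_mul_assoc)
  then show ?thesis using that by blast
qed

text \<open>The link between the two descriptions of a differential: charts, where Taylor estimates
  are made, and orthonormal bases, where norms and determinants have their Riemannian
  meaning.\<close>

lemma tangent_matrix_frame:
  assumes h: "diff_map A h" and c: "c \<in> A" "x \<in> fst c" and d: "d \<in> A" "h x \<in> fst d"
  shows "tangent_matrix A g h x *v (frame c x *v e) = frame d (h x) *v chart_deriv h c d x e"
proof -
  have b: "tangent_of A x c (onb A g x i c) = onb A g x i" for i
    using tangent_spaceD[OF onb_in c] .
  have "(tangent_matrix A g h x *v (frame c x *v e)) $ i = (frame d (h x) *v chart_deriv h c d x e) $ i" for i
  proof -
    define l where "l e = g (h x) (tangent_of A (h x) d (chart_deriv h c d x e)) (onb A g (h x) i)" for e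
    have l: "linear l"
      using linear_compose[OF linear_chart_deriv[OF h c(1) d(1) c(2) d(2)] linear_metric_left[OF d onb_in[of "h x" i]]]
      by (simp add: l_def[abs_def] o_def)
    have le: "g (h x) (tangent_map A h x (tangent_of A x c e)) (onb A g (h x) i) = l e" for e
      by (simp add: l_def tangent_map_tangent_of[OF h c d])
    have "(tangent_matrix A g h x *v (frame c x *v e)) $ i
        = (\<Sum>j\<in>UNIV. (frame c x *v e) $ j * l (onb A g x j c))"
      by (simp add: tangent_matrix_def matrix_vector_mult_def[of "\<chi> i j. m i j" for m] le[symmetric] b mult.commute)
    also have "\<dots> = l e"
      by (subst (2) frame_expansion[OF c, of e]) (simp add: linear_sum[OF l] linear_cmul[OF l])
    finally show ?thesis by (simp add: l_def frame_mult[OF d])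
  qed
  then show ?thesis by (simp add: vec_eq_iff)
qed

lemma tangent_norm_tangent_map:
  assumes h: "diff_map A h" and c: "c \<in> A" "x \<in> fst c"
  shows "tangent_norm g (h x) (tangent_map A h x (tangent_of A x c e))
    = norm (tangent_matrix A g h x *v (frame c x *v e))"
proof -
  obtain d where d: "d \<in> A" "h x \<in> fst d" using obtain_chart .
  show ?thesis
    by (simp add: tangent_map_tangent_of[OF h c d] tangent_norm_frame[OF d] tangent_matrix_frame[OF h c d])
qed

text \<open>The basis chosen by \<open>onb\<close> depends on the point alone, so the two uses at
  \<open>h x\<close> match and the matrices form a cocycle.\<close>

lemma tangent_matrix_comp:
  assumes h: "diff_map A h" and k: "diff_map A k"
  shows "tangent_matrix A g (k \<circ> h) x = tangent_matrix A g k (h x) ** tangent_matrix A g h x"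
proof -
  obtain c where c: "c \<in> A" "x \<in> fst c" using obtain_chart .
  obtain d where d: "d \<in> A" "h x \<in> fst d" using obtain_chart .
  obtain e where e: "e \<in> A" "k (h x) \<in> fst e" using obtain_chart .
  have "tangent_matrix A g (k \<circ> h) x *v w = (tangent_matrix A g k (h x) ** tangent_matrix A g h x) *v w" for w
  proof -
    obtain u where u: "w = frame c x *v u" using frame_surj[OF c] .
    show ?thesis
      using tangent_matrix_frame[OF diff_map_comp[OF h k] c, of e u] e
        tangent_matrix_frame[OF h c d, of u] tangent_matrix_frame[OF k d e, of "chart_deriv h c d x u"]
        chart_deriv_comp[OF h k c(1) d(1) e(1) c(2) d(2) e(2)]
      by (simp add: u matrix_vector_mul_assoc[symmetric])
  qed
  then show ?thesis by (simp add: matrix_eq)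
qed

lemma tangent_matrix_id: "tangent_matrix A g id x = mat 1"
proof -
  obtain c where c: "c \<in> A" "x \<in> fst c" using obtain_chart .
  have "tangent_matrix A g id x *v w = mat 1 *v w" for w
  proof -
    obtain u where u: "w = frame c x *v u" using frame_surj[OF c] .
    show ?thesis
      using tangent_matrix_frame[OF diff_map_id c, of c u] c by (simp add: u chart_deriv_id_same[OF c])
  qed
  then show ?thesis by (simp add: matrix_eq)
qed

end

section \<open>Uniform bounds in charts\<close>

text \<open>Neither \<open>p'\<close> nor \<open>w\<close> comes with integrability. The component
  of \<open>p'\<close> along the total displacement is gauge integrable by the fundamental theorem,
  and its positive part \<open>Q\<close> is measurable and dominated by \<open>w\<close>.\<close>

lemma norm_diff_le_nn_integral:
  fixes p :: "real \<Rightarrow> 'b::euclidean_space" and w :: "real \<Rightarrow> real"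
  assumes "a \<le> b" "continuous_on {a..b} p" "finite S"
    and deriv: "\<And>t. t \<in> {a<..<b} - S \<Longrightarrow> (p has_vector_derivative p' t) (at t)"
    and le: "\<And>t. t \<in> {a<..<b} - S \<Longrightarrow> norm (p' t) \<le> w t"
  shows "ennreal (norm (p b - p a)) \<le> (\<integral>\<^sup>+t\<in>{a..b}. ennreal (w t) \<partial>lborel)"
proof -
  define u where "u = sgn (p b - p a)"
  have u: "norm u \<le> 1" by (simp add: u_def norm_sgn)
  define q where "q t = (if t \<in> {a<..<b} - S then u \<bullet> p' t else 0)" for t
  have "(q has_integral u \<bullet> p b - u \<bullet> p a) {a..b}"
  proof (rule fundamental_theorem_of_calculus_interior_strong[OF \<open>finite S\<close> \<open>a \<le> b\<close>])
    fix t assume t: "t \<in> {a<..<b} - S"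
    show "((\<lambda>t. u \<bullet> p t) has_vector_derivative q t) (at t)"
      using bounded_linear.has_vector_derivative[OF bounded_linear_inner_right deriv[OF t], of u] t
      by (simp add: q_def)
  qed (use assms in \<open>auto intro!: continuous_intros\<close>)
  moreover have "u \<bullet> p b - u \<bullet> p a = norm (p b - p a)"
    unfolding inner_diff_right[symmetric]
    by (cases "p b = p a") (simp_all add: u_def sgn_div_norm dot_square_norm power2_eq_square)
  ultimately have q: "(q has_integral norm (p b - p a)) {a..b}" by simp
  define Q where "Q t = indicator {a..b} t * max 0 (q t)" for t
  have ind: "(\<lambda>t. indicator {a..b} t *\<^sub>R q t) \<in> borel_measurable lebesgue"
    using has_integral_implies_lebesgue_measurable[OF q] .
  have Q_eq: "Q = (\<lambda>t. max 0 (indicator {a..b} t *\<^sub>R q t))"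
    by (auto simp: Q_def fun_eq_iff indicator_def)
  have Q: "Q \<in> borel_measurable lebesgue"
    unfolding Q_eq using ind by measurable
  have Q0: "0 \<le> Q t" for t by (simp add: Q_def)
  have "(\<integral>\<^sup>+t. ennreal (Q t) \<partial>lborel) \<le> (\<integral>\<^sup>+t\<in>{a..b}. ennreal (w t) \<partial>lborel)"
  proof (intro nn_integral_mono)
    fix t
    have "u \<bullet> p' t \<le> w t" "0 \<le> w t" if "t \<in> {a<..<b} - S"
    proof -
      have "u \<bullet> p' t \<le> norm u * norm (p' t)" by (rule norm_cauchy_schwarz)
      also have "\<dots> \<le> 1 * norm (p' t)" using u by (intro mult_right_mono) auto
      finally show "u \<bullet> p' t \<le> w t" using le[OF that] by simp
      show "0 \<le> w t" using le[OF that] norm_ge_zero order_trans by blast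
    qed
    then show "ennreal (Q t) \<le> ennreal (w t) * indicator {a..b} t"
      by (auto simp: Q_def q_def indicator_def intro!: ennreal_leI)
  qed
  moreover have "ennreal (norm (p b - p a)) \<le> (\<integral>\<^sup>+t. ennreal (Q t) \<partial>lborel)"
  \<comment> \<open>If \<open>Q\<close> has infinite integral there is nothing to prove; otherwise
    it is Lebesgue integrable and can be compared with the gauge integral.\<close>
  proof (cases "(\<integral>\<^sup>+t. ennreal (Q t) \<partial>lborel) < \<infinity>")
    case False
    then show ?thesis by (simp add: less_top[symmetric])
  next
    case True
    then have int: "integrable lebesgue Q"
      using Q Q0 by (intro integrableI_nonneg) (auto simp: nn_integral_completion)
    have hasQ: "(Q has_integral integral\<^sup>L lebesgue Q) UNIV"
      by (rule has_integral_integral_lebesgue[OF int])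
    have "((\<lambda>t. if t \<in> {a..b} then q t else 0) has_integral norm (p b - p a)) UNIV"
      using q by (simp only: has_integral_restrict_UNIV)
    then have "norm (p b - p a) \<le> integral\<^sup>L lebesgue Q"
      using hasQ by (rule has_integral_le) (auto simp: Q_def)
    then have "ennreal (norm (p b - p a)) \<le> ennreal (integral\<^sup>L lebesgue Q)"
      by (rule ennreal_leI)
    also have "\<dots> = (\<integral>\<^sup>+t. ennreal (Q t) \<partial>lebesgue)"
      using int Q0 by (simp add: nn_integral_eq_integral)
    finally show ?thesis by (simp add: nn_integral_completion)
  qed
  ultimately show ?thesis by (rule order_trans[rotated])
qed

section \<open>Second-order Taylor bounds on compact sets\<close>

lemma ck_on_continuous: "ck_on k f S \<Longrightarrow> continuous_on S f"
  by (cases k) (auto intro!: continuous_at_imp_continuous_on differentiable_imp_continuous_within)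

text \<open>The derivatives are bounded on a compact neighbourhood of \<open>S\<close>, and the mean
  value inequality is used twice: for \<open>D\<close> in the direction of each basis vector, then
  for \<open>F - D a\<close>. The linear part is frozen at the centre \<open>a\<close> so that only
  derivatives along a reference orbit will have to be multiplied.\<close>

lemma ck2_uniform_bounds:
  fixes F :: "'b::euclidean_space \<Rightarrow> 'c::real_normed_vector"
  assumes F: "ck_on 2 F \<Omega>" and "open \<Omega>" "compact S" "S \<subseteq> \<Omega>"
  defines "D \<equiv> \<lambda>a. frechet_derivative F (at a)"
  shows "\<exists>r>0. \<exists>B\<ge>0. \<forall>a\<in>S. cball a r \<subseteq> \<Omega> \<and> (\<forall>e. norm (D a e) \<le> B * norm e) \<and>
    (\<forall>R\<le>r. \<forall>z\<in>cball a R. \<forall>z'\<in>cball a R. norm (F z - F z' - D a (z - z')) \<le> B * R * norm (z - z'))"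
proof -
  obtain r where r: "r > 0" "(\<Union>x\<in>S. cball x r) \<subseteq> \<Omega>"
    using compact_subset_open_imp_cball_epsilon_subset[OF \<open>compact S\<close> \<open>open \<Omega>\<close> \<open>S \<subseteq> \<Omega>\<close>] .
  define T where "T = (\<Union>x\<in>S. cball x r)"
  have T: "compact T" "T \<subseteq> \<Omega>"
    using r compact_minkowski_sum_cball[OF \<open>compact S\<close>] by (auto simp: T_def)
  have ck: "\<forall>x\<in>\<Omega>. F differentiable at x" "\<And>v. ck_on (Suc 0) (\<lambda>x. D x v) \<Omega>"
    using F by (auto simp: D_def numeral_2_eq_2)
  have dF: "(F has_derivative D x) (at x)" if "x \<in> \<Omega>" for x
    using ck(1) that by (simp add: D_def frechet_derivative_works)
  have linD: "linear (D x)" if "x \<in> \<Omega>" for x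
    using dF[OF that] has_derivative_linear by blast
  define H where "H x v = frechet_derivative (\<lambda>x. D x v) (at x)" for x v
  have dD: "((\<lambda>x. D x v) has_derivative H x v) (at x)" if "x \<in> \<Omega>" for x v
    using ck(2)[of v] that by (simp add: H_def frechet_derivative_works)
  have "\<exists>B. \<forall>x\<in>T. norm (H x i j) \<le> B" for i j
  proof -
    have "continuous_on T (\<lambda>x. H x i j)"
      using ck(2)[of i] T(2) by (auto simp: H_def intro: continuous_on_subset)
    then have "compact ((\<lambda>x. H x i j) ` T)"
      using T(1) compact_continuous_image by blast
    then show ?thesis using compact_imp_bounded bounded_iff by (metis imageI)
  qed
  then obtain B2 where B2: "\<And>i j x. x \<in> T \<Longrightarrow> norm (H x i j) \<le> B2 i j" by metis
  have "\<exists>B. \<forall>x\<in>T. norm (D x i) \<le> B" for i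
  proof -
    have "continuous_on T (\<lambda>x. D x i)"
      using ck_on_continuous[OF ck(2)[of i]] T(2) by (rule continuous_on_subset)
    then have "compact ((\<lambda>x. D x i) ` T)"
      using T(1) compact_continuous_image by blast
    then show ?thesis using compact_imp_bounded bounded_iff by (metis imageI)
  qed
  then obtain B1 where B1: "\<And>i x. x \<in> T \<Longrightarrow> norm (D x i) \<le> B1 i" by metis
  \<comment> \<open>\<open>ck_on\<close> controls each direction separately; operator bounds are
    assembled from the basis vectors.\<close>
  have lin_bound: "norm (l e) \<le> (\<Sum>i\<in>Basis. b i) * norm e"
    if l: "linear l" and b: "\<And>i. i \<in> Basis \<Longrightarrow> norm (l i) \<le> b i" for l :: "'b \<Rightarrow> 'c" and b e
  proof -
    have "l e = (\<Sum>i\<in>Basis. (e \<bullet> i) *\<^sub>R l i)"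
      by (subst euclidean_representation[of e, symmetric]) (simp add: linear_sum[OF l] linear_cmul[OF l])
    also have "norm \<dots> \<le> (\<Sum>i\<in>Basis. norm e * b i)"
      using b by (intro sum_norm_le) (auto intro!: mult_mono simp: Basis_le_norm)
    finally show ?thesis by (simp add: sum_distrib_left mult.commute)
  qed
  define K where "K = (\<Sum>i\<in>(Basis::'b set). \<Sum>j\<in>(Basis::'b set). \<bar>B2 i j\<bar>)"
  define B where "B = K + (\<Sum>i\<in>(Basis::'b set). \<bar>B1 i\<bar>)"
  have K0: "0 \<le> K" by (simp add: K_def sum_nonneg)
  have KB: "K \<le> B" by (simp add: B_def sum_nonneg)
  have "cball a r \<subseteq> \<Omega> \<and> (\<forall>e. norm (D a e) \<le> B * norm e) \<and>
    (\<forall>R\<le>r. \<forall>z\<in>cball a R. \<forall>z'\<in>cball a R. norm (F z - F z' - D a (z - z')) \<le> B * R * norm (z - z'))"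
    if a: "a \<in> S" for a
  proof (intro conjI allI impI ballI)
    have aT: "cball a r \<subseteq> T" using a by (auto simp: T_def)
    then show "cball a r \<subseteq> \<Omega>" using T by blast
    have aT': "a \<in> T" using aT r(1) by auto
    then have a\<Omega>: "a \<in> \<Omega>" using T by blast
    fix e
    have "norm (D a e) \<le> (\<Sum>i\<in>Basis. \<bar>B1 i\<bar>) * norm e"
      using B1[OF aT'] by (intro lin_bound linD a\<Omega>) (auto intro: order_trans[OF _ abs_ge_self])
    also have "\<dots> \<le> B * norm e" by (intro mult_right_mono) (simp_all add: B_def K0)
    finally show "norm (D a e) \<le> B * norm e" .
    fix R z z' assume R: "R \<le> r" "z \<in> cball a R" "z' \<in> cball a R"
    have sub: "x \<in> T" "x \<in> \<Omega>" if "x \<in> cball a R" for x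
      using that aT T R(1) by (auto simp: subset_iff)
    have R0: "0 \<le> R" using R(2) order_trans[OF zero_le_dist] by auto
    have HD: "norm (D x i - D a i) \<le> (\<Sum>j\<in>(Basis::'b set). \<bar>B2 i j\<bar>) * R" if x: "x \<in> cball a R" for x i
    proof -
      have "norm (D x i - D a i) \<le> (\<Sum>j\<in>(Basis::'b set). \<bar>B2 i j\<bar>) * norm (x - a)"
      proof (rule differentiable_bound[of "cball a R" _ "\<lambda>x. H x i"])
        fix y assume y: "y \<in> cball a R"
        show "((\<lambda>x. D x i) has_derivative H y i) (at y within cball a R)"
          using dD[OF sub(2)[OF y]] has_derivative_at_withinI by blast
        show "onorm (H y i) \<le> (\<Sum>j\<in>(Basis::'b set). \<bar>B2 i j\<bar>)"
          using B2[OF sub(1)[OF y]] has_derivative_linear[OF dD[OF sub(2)[OF y]]]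
          by (intro onorm_le lin_bound) (auto intro: order_trans[OF _ abs_ge_self])
      qed (use x R0 in auto)
      also have "\<dots> \<le> (\<Sum>j\<in>(Basis::'b set). \<bar>B2 i j\<bar>) * R"
        using x by (intro mult_left_mono sum_nonneg) (auto simp: dist_norm norm_minus_commute)
      finally show ?thesis .
    qed
    have "norm ((F z - D a z) - (F z' - D a z')) \<le> K * R * norm (z - z')"
    proof (rule differentiable_bound[of "cball a R" _ "\<lambda>x e. D x e - D a e"])
      fix y assume y: "y \<in> cball a R"
      show "((\<lambda>x. F x - D a x) has_derivative (\<lambda>e. D y e - D a e)) (at y within cball a R)"
        using linear_imp_has_derivative[OF linD[OF a\<Omega>]]
        by (intro has_derivative_diff has_derivative_at_withinI[OF dF[OF sub(2)[OF y]]])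
      have "norm (D y e - D a e) \<le> (\<Sum>i\<in>Basis. (\<Sum>j\<in>(Basis::'b set). \<bar>B2 i j\<bar>) * R) * norm e" for e
        using HD[OF y] linD[OF sub(2)[OF y]] linD[OF a\<Omega>]
        by (intro lin_bound linear_compose_sub) auto
      then show "onorm (\<lambda>e. D y e - D a e) \<le> K * R"
        by (intro onorm_le) (simp add: K_def sum_distrib_right)
    qed (use R in auto)
    also have "K * R * norm (z - z') \<le> B * R * norm (z - z')"
      using KB R0 by (intro mult_right_mono) auto
    finally show "norm (F z - F z' - D a (z - z')) \<le> B * R * norm (z - z')"
      by (simp add: linear_diff[OF linD[OF a\<Omega>]] algebra_simps)
  qed
  moreover have "0 \<le> B" using K0 KB by simp
  ultimately show ?thesis using r(1) by blast
qed

context compact_riemannian_surface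
begin

text \<open>The points of \<open>K\<close> that \<open>h\<close> sends into \<open>K'\<close> form a
  compact set within the domain of the coordinate expression, even where that domain is smaller than
  the chart.\<close>

lemma ck2_chart_bounds:
  assumes h: "ck_map 2 A h" and cd: "c \<in> A" "d \<in> A"
    and K: "compact K" "K \<subseteq> fst c" and K': "closed K'" "K' \<subseteq> fst d"
  shows "\<exists>r>0. \<exists>B\<ge>0. \<forall>x\<in>K. h x \<in> K' \<longrightarrow>
    cball (snd c x) r \<subseteq> snd c ` (fst c \<inter> h -` fst d) \<and>
    (\<forall>e. norm (chart_deriv h c d x e) \<le> B * norm e) \<and>
    (\<forall>R\<le>r. \<forall>z\<in>cball (snd c x) R. \<forall>z'\<in>cball (snd c x) R.
       norm ((snd d \<circ> h \<circ> chart_inv c) z - (snd d \<circ> h \<circ> chart_inv c) z'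
         - chart_deriv h c d x (z - z')) \<le> B * R * norm (z - z'))"
    (is "\<exists>r>0. \<exists>B\<ge>0. \<forall>x\<in>K. h x \<in> K' \<longrightarrow> ?P r B x")
proof -
  have hc: "continuous_on UNIV h" using h by (simp add: ck_map_def)
  have "compact (K \<inter> h -` K')"
    using K K' hc by (intro compact_Int_closed closed_vimage) auto
  then have cpt: "compact (snd c ` (K \<inter> h -` K'))"
    using continuous_on_chart[OF cd(1)] K
    by (intro compact_continuous_image) (auto intro: continuous_on_subset)
  have ck: "ck_on 2 (snd d \<circ> h \<circ> chart_inv c) (snd c ` (fst c \<inter> h -` fst d))"
    using h cd by (simp add: ck_map_def)
  have sub: "snd c ` (K \<inter> h -` K') \<subseteq> snd c ` (fst c \<inter> h -` fst d)"
    using K K' by auto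
  obtain r B where rB: "0 < r" "0 \<le> B" "\<forall>a\<in>snd c ` (K \<inter> h -` K').
      cball a r \<subseteq> snd c ` (fst c \<inter> h -` fst d) \<and>
      (\<forall>e. norm (frechet_derivative (snd d \<circ> h \<circ> chart_inv c) (at a) e) \<le> B * norm e) \<and>
      (\<forall>R\<le>r. \<forall>z\<in>cball a R. \<forall>z'\<in>cball a R.
         norm ((snd d \<circ> h \<circ> chart_inv c) z - (snd d \<circ> h \<circ> chart_inv c) z'
           - frechet_derivative (snd d \<circ> h \<circ> chart_inv c) (at a) (z - z')) \<le> B * R * norm (z - z'))"
    using ck2_uniform_bounds[OF ck open_domain(2)[OF hc cd] cpt sub]
    by (elim exE conjE) (rule that; assumption)
  show ?thesis
  proof (rule exI[of _ r], rule conjI[OF rB(1)], rule exI[of _ B], rule conjI[OF rB(2)], intro ballI impI)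
    fix x assume "x \<in> K" "h x \<in> K'"
    then have "snd c x \<in> snd c ` (K \<inter> h -` K')" by simp
    from bspec[OF rB(3) this] show "?P r B x"
      unfolding chart_deriv_def .
  qed
qed

section \<open>Comparison of Riemannian and coordinate norms\<close>

lemma continuous_on_chart_metric:
  assumes c: "c \<in> A"
  shows "continuous_on (snd c ` fst c) (\<lambda>u. chart_metric c (chart_inv c u) e e')"
proof -
  have "ck_on 0 (\<lambda>u. chart_metric c (chart_inv c u) e e') (snd c ` fst c)"
    using metric_smooth[OF c, of e e'] unfolding smooth_on_def by blast
  then show ?thesis by simp
qed

lemma chart_metric_expand:
  assumes c: "c \<in> A" "x \<in> fst c"
  shows "chart_metric c x e e = (\<Sum>i\<in>UNIV. \<Sum>j\<in>UNIV. e $ i * e $ j * chart_metric c x (axis i 1) (axis j 1))"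
proof -
  have col: "(frame c x *v e) = (\<Sum>i\<in>UNIV. e $ i *\<^sub>R (frame c x *v axis i 1))" for e
    unfolding matrix_vector_mult_basis by (simp add: matrix_mult_sum scalar_mult_eq_scaleR)
  show ?thesis
    by (simp add: frame_inner[OF c] col[of e] inner_add_left inner_add_right sum_2 inner_commute algebra_simps)
qed

text \<open>On the compact set of coordinate unit vectors over \<open>K\<close>, the squared
  Riemannian norm \<Phi> is continuous and positive, so it has a positive minimum and a finite
  maximum; homogeneity does the rest.\<close>

lemma frame_bounds:
  assumes c: "c \<in> A" and K: "compact K" "K \<subseteq> fst c"
  shows "\<exists>C\<ge>1. \<forall>x\<in>K. \<forall>e. norm (frame c x *v e) \<le> C * norm e \<and> norm e \<le> C * norm (frame c x *v e)"
proof (cases "K = {}")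
  case False
  define \<Phi> where "\<Phi> p = chart_metric c (chart_inv c (fst p)) (snd p) (snd p)" for p :: "(real^2) \<times> (real^2)"
  define X where "X = snd c ` K \<times> sphere (0 :: real^2) 1"
  have "compact X" unfolding X_def
    using K continuous_on_chart[OF c] continuous_on_subset
    by (intro compact_Times compact_continuous_image) auto
  have "continuous_on X (\<lambda>p. chart_metric c (chart_inv c (fst p)) (axis i 1) (axis j 1))" for i j
  proof (rule continuous_on_compose2[OF continuous_on_chart_metric[OF c] continuous_on_fst[OF continuous_on_id]])
    show "fst ` X \<subseteq> snd c ` fst c" using K by (auto simp: X_def)
  qed
  then have "continuous_on X (\<lambda>p. \<Sum>i\<in>UNIV. \<Sum>j\<in>UNIV. snd p $ i * snd p $ j *
      chart_metric c (chart_inv c (fst p)) (axis i 1) (axis j 1))"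
    by (intro continuous_intros)
  then have cont: "continuous_on X \<Phi>"
    by (rule continuous_on_eq) (use K c in \<open>auto simp: X_def \<Phi>_def chart_inv_left chart_metric_expand\<close>)
  have ne: "X \<noteq> {}"
    using False by (simp add: X_def)
  obtain p where p: "p \<in> X" "\<And>q. q \<in> X \<Longrightarrow> \<Phi> p \<le> \<Phi> q"
    using continuous_attains_inf[OF \<open>compact X\<close> ne cont] by blast
  obtain P where P: "P \<in> X" "\<And>q. q \<in> X \<Longrightarrow> \<Phi> q \<le> \<Phi> P"
    using continuous_attains_sup[OF \<open>compact X\<close> ne cont] by blast
  have pos: "\<Phi> q > 0" if "q \<in> X" for q
  proof -
    have "snd q \<noteq> 0" using that by (auto simp: X_def)
    then show ?thesis
      using that K c by (auto simp: X_def \<Phi>_def chart_inv_left intro!: chart_metric_pos)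
  qed
  define C where "C = max 1 (max (sqrt (\<Phi> P)) (1 / sqrt (\<Phi> p)))"
  have "norm (frame c x *v e) \<le> C * norm e \<and> norm e \<le> C * norm (frame c x *v e)"
    if x: "x \<in> K" for x e
  proof (cases "e = 0")
    case e: False
    define u where "u = e /\<^sub>R norm e"
    have u: "norm u = 1" "e = norm e *\<^sub>R u" using e by (auto simp: u_def)
    have "(snd c x, u) \<in> X" using x u by (auto simp: X_def)
    moreover have "\<Phi> (snd c x, u) = (norm (frame c x *v u))\<^sup>2"
      using x K c by (auto simp: \<Phi>_def chart_inv_left subset_iff frame_inner dot_square_norm)
    ultimately have b: "\<Phi> p \<le> (norm (frame c x *v u))\<^sup>2" "(norm (frame c x *v u))\<^sup>2 \<le> \<Phi> P"
      using p P by metis+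
    have "norm (frame c x *v u) \<le> sqrt (\<Phi> P)"
      using b(2) by (simp add: real_le_rsqrt)
    then have 1: "norm (frame c x *v u) \<le> C" by (simp add: C_def)
    have s: "sqrt (\<Phi> p) \<le> norm (frame c x *v u)" "0 < sqrt (\<Phi> p)"
      using b(1) pos[OF p(1)] by (auto simp: real_le_lsqrt)
    have "1 = 1 / sqrt (\<Phi> p) * sqrt (\<Phi> p)" using s(2) by simp
    also have "\<dots> \<le> C * norm (frame c x *v u)"
      using s by (intro mult_mono) (auto simp: C_def)
    finally have 2: "1 \<le> C * norm (frame c x *v u)" .
    have "norm (frame c x *v e) = norm e * norm (frame c x *v u)"
      by (subst u(2)) (simp add: matrix_vector_mult_scaleR)
    then show ?thesis
      using mult_left_mono[OF 1, of "norm e"] mult_left_mono[OF 2, of "norm e"]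
      by (simp add: mult_ac)
  qed auto
  moreover have "1 \<le> C" by (simp add: C_def)
  ultimately show ?thesis by blast
qed auto

section \<open>Continuity of the Jacobian\<close>

lemma abs_det_eq:
  assumes h: "diff_map A h" and c: "c \<in> A" "x \<in> fst c" and d: "d \<in> A" "h x \<in> fst d"
  shows "abs_det A g h x = \<bar>det (matrix (chart_deriv h c d x))\<bar> * \<bar>det (frame d (h x))\<bar> / \<bar>det (frame c x)\<bar>"
proof -
  have "tangent_matrix A g h x ** frame c x = frame d (h x) ** matrix (chart_deriv h c d x)"
    using linear_chart_deriv[OF h c(1) d(1) c(2) d(2)]
    by (simp add: matrix_eq matrix_vector_mul_assoc[symmetric] tangent_matrix_frame[OF h c d] matrix_works)
  then have "det (tangent_matrix A g h x) * det (frame c x) = det (frame d (h x)) * det (matrix (chart_deriv h c d x))"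
    by (metis det_mul)
  moreover have "det (frame c x) \<noteq> 0"
    using invertible_frame[OF c] invertible_det_nz by blast
  ultimately have "det (tangent_matrix A g h x) = det (frame d (h x)) * det (matrix (chart_deriv h c d x)) / det (frame c x)"
    by (simp add: nonzero_eq_divide_eq)
  then show ?thesis by (simp add: abs_det_def abs_mult mult.commute)
qed

text \<open>As \<open>onb\<close> is an arbitrary choice at each point, \<open>frame\<close> itself
  may be discontinuous. The absolute value of its determinant is the square root of the Gram
  determinant of the metric, which does not see the choice.\<close>

lemma continuous_on_det_frame:
  assumes c: "c \<in> A"
  shows "continuous_on (fst c) (\<lambda>x. \<bar>det (frame c x)\<bar>)"
proof -
  define G where "G i j x = chart_metric c x (axis i 1) (axis j 1)" for i j :: 2 and x
  have G: "continuous_on (fst c) (G i j)" for i j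
  proof -
    have "continuous_on (fst c) (\<lambda>x. chart_metric c (chart_inv c (snd c x)) (axis i 1) (axis j 1))"
      by (rule continuous_on_compose2[OF continuous_on_chart_metric[OF c] continuous_on_chart[OF c]]) auto
    then show ?thesis
      by (rule continuous_on_eq) (use c in \<open>auto simp: chart_inv_left G_def\<close>)
  qed
  have "\<bar>det (frame c x)\<bar> = sqrt (G 1 1 x * G 2 2 x - G 1 2 x * G 2 1 x)" if x: "x \<in> fst c" for x
  proof -
    have "G 1 1 x * G 2 2 x - G 1 2 x * G 2 1 x = (det (frame c x))\<^sup>2"
      unfolding G_def frame_inner[OF c x]
      by (simp add: matrix_vector_mult_basis column_def inner_vec_def sum_2 det_2 power2_eq_square algebra_simps)
    then show ?thesis by simp
  qed
  moreover have "continuous_on (fst c) (\<lambda>x. sqrt (G 1 1 x * G 2 2 x - G 1 2 x * G 2 1 x))"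
    using G by (intro continuous_intros)
  ultimately show ?thesis by (simp cong: continuous_on_cong)
qed

text \<open>By compactness this upgrades pointwise dissipation to a uniform bound below
  \<open>1\<close>.\<close>

lemma continuous_on_abs_det:
  assumes h: "ck_map (Suc k) A h"
  shows "continuous_on UNIV (abs_det A g h)"
proof (intro continuous_at_imp_continuous_on ballI)
  fix x :: 'a
  note dh = ck_map_imp_diff_map[OF h]
  have hc: "continuous_on UNIV h" using h by (simp add: ck_map_def)
  obtain c where c: "c \<in> A" "x \<in> fst c" using obtain_chart .
  obtain d where d: "d \<in> A" "h x \<in> fst d" using obtain_chart .
  define N where "N = fst c \<inter> h -` fst d"
  have N: "open N" "x \<in> N" "N \<subseteq> fst c" "h ` N \<subseteq> fst d"
    using open_domain(1)[OF hc c(1) d(1)] c d by (auto simp: N_def)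
  have "continuous_on N (\<lambda>y. chart_deriv h c d y v)" for v
  proof -
    have "continuous_on (snd c ` N) (\<lambda>u. frechet_derivative (snd d \<circ> h \<circ> chart_inv c) (at u) v)"
      using h c d unfolding ck_map_def N_def by (auto intro!: ck_on_continuous[of k])
    from continuous_on_compose[OF continuous_on_subset[OF continuous_on_chart[OF c(1)] N(3)] this]
    show ?thesis by (simp add: chart_deriv_def o_def)
  qed
  then have D: "continuous_on N (\<lambda>y. \<bar>det (matrix (chart_deriv h c d y))\<bar>)"
    unfolding det_2 matrix_def by (simp add: continuous_intros)
  have 1: "continuous_on N (\<lambda>y. \<bar>det (frame c y)\<bar>)"
    using continuous_on_det_frame[OF c(1)] N(3) continuous_on_subset by blast
  have 2: "continuous_on N (\<lambda>y. \<bar>det (frame d (h y))\<bar>)"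
    using continuous_on_compose2[OF continuous_on_det_frame[OF d(1)] continuous_on_subset[OF hc] N(4)] by blast
  have nz: "\<bar>det (frame c y)\<bar> \<noteq> 0" if "y \<in> N" for y
    using that N(3) invertible_frame[OF c(1)] invertible_det_nz by auto
  have "continuous_on N (\<lambda>y. \<bar>det (matrix (chart_deriv h c d y))\<bar> * \<bar>det (frame d (h y))\<bar> / \<bar>det (frame c y)\<bar>)"
    using D 1 2 nz by (intro continuous_on_divide continuous_on_mult) auto
  then have "continuous_on N (abs_det A g h)"
    by (rule continuous_on_eq) (use c(1) d(1) in \<open>auto simp: N_def abs_det_eq[OF dh]\<close>)
  then show "isCont (abs_det A g h) x"
    using N by (simp add: continuous_on_eq_continuous_at)
qed

section \<open>Riemannian distance in charts\<close>

text \<open>Where the curve is differentiable in all charts, \<open>velocity\<close> is a genuine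
  tangent vector, so its Riemannian norm may be computed in any one chart.\<close>

lemma velocity_eq:
  assumes c: "c \<in> A" "\<gamma> t \<in> fst c" and cont: "isCont \<gamma> t"
    and deriv: "\<And>d. d \<in> A \<Longrightarrow> \<gamma> t \<in> fst d \<Longrightarrow> (snd d \<circ> \<gamma>) differentiable at t"
  shows "velocity A \<gamma> t = tangent_of A (\<gamma> t) c (vector_derivative (snd c \<circ> \<gamma>) (at t))"
proof
  fix d
  show "velocity A \<gamma> t d = tangent_of A (\<gamma> t) c (vector_derivative (snd c \<circ> \<gamma>) (at t)) d"
  proof (cases "d \<in> A \<and> \<gamma> t \<in> fst d")
    case True
    let ?v = "vector_derivative (snd c \<circ> \<gamma>) (at t)"
    have v: "((snd c \<circ> \<gamma>) has_derivative (\<lambda>h. h *\<^sub>R ?v)) (at t)"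
      using deriv[OF c] by (simp add: vector_derivative_works has_vector_derivative_def)
    have lin: "linear (chart_deriv id c d (\<gamma> t))"
      using True c by (intro linear_chart_deriv[OF diff_map_id]) auto
    have "((snd d \<circ> id \<circ> chart_inv c) has_derivative chart_deriv id c d (\<gamma> t)) (at ((snd c \<circ> \<gamma>) t))"
      using diff_mapD[OF diff_map_id, of c d "\<gamma> t"] True c by simp
    from diff_chain_at[OF v this]
    have *: "((snd d \<circ> id \<circ> chart_inv c) \<circ> (snd c \<circ> \<gamma>) has_derivative
        (\<lambda>h. h *\<^sub>R chart_deriv id c d (\<gamma> t) ?v)) (at t)"
      using linear_cmul[OF lin] by (simp add: o_def)
    have "\<forall>\<^sub>F s in at t. \<gamma> s \<in> fst c"
      using cont c open_chart[OF c(1)] unfolding isCont_def by (metis topological_tendstoD)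
    then have "\<forall>\<^sub>F s in at t. ((snd d \<circ> id \<circ> chart_inv c) \<circ> (snd c \<circ> \<gamma>)) s = (snd d \<circ> \<gamma>) s"
      by eventually_elim (use c in \<open>simp add: chart_inv_left\<close>)
    then have "((snd d \<circ> \<gamma>) has_derivative (\<lambda>h. h *\<^sub>R chart_deriv id c d (\<gamma> t) ?v)) (at t)"
      using has_derivative_transform_eventually[OF *] c by (simp add: chart_inv_left)
    then have "vector_derivative (snd d \<circ> \<gamma>) (at t) = chart_deriv id c d (\<gamma> t) ?v"
      by (simp add: vector_derivative_at has_vector_derivative_def)
    then show ?thesis using True by (simp add: velocity_def tangent_of_eq)
  qed (auto simp: velocity_def tangent_of_eq)
qed

lemma curve_chart_length:
  assumes c: "c \<in> A" and \<gamma>: "piecewise_c1_curve A \<gamma>" and ab: "0 \<le> a" "a \<le> b" "b \<le> 1"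
    and sub: "\<gamma> ` {a..b} \<subseteq> K" "K \<subseteq> fst c"
    and C: "C > 0" "\<And>x e. x \<in> K \<Longrightarrow> norm e \<le> C * norm (frame c x *v e)"
  shows "ennreal (norm (snd c (\<gamma> b) - snd c (\<gamma> a)) / C) \<le> curve_length A g \<gamma>"
proof -
  obtain S where S: "finite S" and piece: "\<And>a b. 0 \<le> a \<Longrightarrow> a < b \<Longrightarrow> b \<le> 1 \<Longrightarrow> {a<..<b} \<inter> S = {}
      \<Longrightarrow> c1_curve_on A \<gamma> {a..b}" and cont: "continuous_on {0..1} \<gamma>"
    using \<gamma> unfolding piecewise_c1_curve_def by auto
  have diff: "(snd d \<circ> \<gamma>) differentiable at t"
    if t: "t \<in> {a<..<b} - S" and d: "d \<in> A" "\<gamma> t \<in> fst d" for t d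
  proof -
    \<comment> \<open>A small interval around \<open>t\<close> avoids the break points; as
      \<open>t\<close> is interior to it, the derivative within the interval is a two-sided
      one.\<close>
    have "open ({a<..<b} - S)" using S by (simp add: finite_imp_closed open_Diff)
    then obtain e where e: "e > 0" "cball t e \<subseteq> {a<..<b} - S"
      using t open_contains_cball by blast
    have I: "{t - e..t + e} \<subseteq> {a<..<b} - S" using e(2) by (simp add: cball_eq_atLeastAtMost)
    have te: "t - e \<in> {t - e..t + e}" "t + e \<in> {t - e..t + e}" using e(1) by auto
    have ends: "t - e \<in> {a<..<b}" "t + e \<in> {a<..<b}"
      using subsetD[OF I te(1)] subsetD[OF I te(2)] by auto
    have "c1_curve_on A \<gamma> {t - e..t + e}"
    proof (rule piece)
      show "{t - e<..<t + e} \<inter> S = {}"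
        using I greaterThanLessThan_subseteq_atLeastAtMost_iff[of "t - e" "t + e" "t - e" "t + e"] by blast
    qed (use ends ab e(1) in auto)
    then obtain D where "((snd d \<circ> \<gamma>) has_vector_derivative D t) (at t within {t - e..t + e})"
      using d e(1) unfolding c1_curve_on_def by fastforce
    moreover have "at t within {t - e..t + e} = at t"
      using e(1) by (intro at_within_Icc_at) auto
    ultimately show ?thesis
      by (metis differentiableI_vector)
  qed
  define p where "p t = (1 / C) *\<^sub>R snd c (\<gamma> t)" for t
  define p' where "p' t = (1 / C) *\<^sub>R vector_derivative (snd c \<circ> \<gamma>) (at t)" for t
  have in_c: "\<gamma> t \<in> K" "\<gamma> t \<in> fst c" if "t \<in> {a<..<b}" for t
    using sub that by (auto simp: image_subset_iff subset_iff)
  have "ennreal (norm (p b - p a)) \<le>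
      (\<integral>\<^sup>+t\<in>{a..b}. ennreal (tangent_norm g (\<gamma> t) (velocity A \<gamma> t)) \<partial>lborel)"
  proof (rule norm_diff_le_nn_integral[OF ab(2) _ S])
    show "continuous_on {a..b} p"
      unfolding p_def
    proof (intro continuous_intros continuous_on_compose2[OF continuous_on_chart[OF c]])
      show "continuous_on {a..b} \<gamma>" using cont by (rule continuous_on_subset) (use ab in auto)
    qed (use sub in auto)
  next
    fix t assume t: "t \<in> {a<..<b} - S"
    have v: "((snd c \<circ> \<gamma>) has_vector_derivative vector_derivative (snd c \<circ> \<gamma>) (at t)) (at t)"
      using diff[OF t c] in_c t by (simp add: vector_derivative_works)
    show "(p has_vector_derivative p' t) (at t)"
      using bounded_linear.has_vector_derivative[OF bounded_linear_scaleR_right v, of "1 / C"]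
      by (simp add: p_def[abs_def] p'_def)
    have cont_t: "isCont \<gamma> t"
      using continuous_on_subset[OF cont, of "{a<..<b}"] t ab
      by (intro continuous_on_interior[OF cont]) auto
    have "tangent_norm g (\<gamma> t) (velocity A \<gamma> t)
        = norm (frame c (\<gamma> t) *v vector_derivative (snd c \<circ> \<gamma>) (at t))"
      using in_c[of t] t c
      by (simp add: velocity_eq[OF c _ cont_t diff[OF t]] tangent_norm_frame)
    then show "norm (p' t) \<le> tangent_norm g (\<gamma> t) (velocity A \<gamma> t)"
      using C(2)[OF in_c(1), of t] t C(1) by (simp add: p'_def divide_le_eq mult.commute)
  qed
  also have "\<dots> \<le> curve_length A g \<gamma>"
    unfolding curve_length_def using ab by (intro nn_integral_mono) (auto simp: indicator_def)
  also have "norm (p b - p a) = norm (snd c (\<gamma> b) - snd c (\<gamma> a)) / C"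
    using C(1) by (simp add: p_def scaleR_diff_right[symmetric])
  finally show ?thesis .
qed

text \<open>The coordinate displacement bounds the length only while the curve stays in the chart. A
  curve ending at \<open>p\<close> that comes from outside the coordinate ball of radius
  \<open>s\<close> already has length at least \<open>s / C\<close>, so shorter curves never leave
  it.\<close>

lemma chart_dist_le_rdist:
  assumes c: "c \<in> A" "p \<in> fst c"
  shows "\<exists>\<delta>>0. \<exists>C>0. \<forall>x. rdist A g x p < ennreal \<delta> \<longrightarrow>
    x \<in> fst c \<and> ennreal (norm (snd c x - snd c p) / C) \<le> rdist A g x p"
proof -
  let ?\<phi> = "snd c" and ?\<psi> = "chart_inv c"
  obtain s where s: "s > 0" "cball (?\<phi> p) s \<subseteq> ?\<phi> ` fst c"
    using open_chart_image[OF c(1)] c open_contains_cball by (metis imageI)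
  have cpt: "compact (?\<psi> ` cball (?\<phi> p) r)" and in_c: "?\<psi> ` cball (?\<phi> p) r \<subseteq> fst c" if "r \<le> s" for r
  proof -
    have sub: "cball (?\<phi> p) r \<subseteq> ?\<phi> ` fst c" using s that by (meson order_trans subset_cball)
    show "compact (?\<psi> ` cball (?\<phi> p) r)"
      using continuous_on_subset[OF continuous_on_chart_inv[OF c(1)] sub]
      by (intro compact_continuous_image) auto
    show "?\<psi> ` cball (?\<phi> p) r \<subseteq> fst c"
      using sub chart_inv_in[OF c(1)] by blast
  qed
  define K where "K = ?\<psi> ` cball (?\<phi> p) s"
  have K: "compact K" "K \<subseteq> fst c" using cpt in_c by (auto simp: K_def)
  obtain C where C: "C \<ge> 1" "\<And>x e. x \<in> K \<Longrightarrow> norm e \<le> C * norm (frame c x *v e)"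
    using frame_bounds[OF c(1) K] by auto
  define V where "V = ?\<phi> -` ball (?\<phi> p) s \<inter> fst c"
  have V: "open V" "V \<subseteq> K" "p \<in> V"
  proof -
    show "open V" unfolding V_def
      using continuous_on_chart[OF c(1)] open_chart[OF c(1)] by (auto simp: continuous_on_open_vimage)
    show "V \<subseteq> K"
    proof
      fix x assume "x \<in> V"
      then show "x \<in> K"
        using chart_inv_left[OF c(1)] by (auto simp: V_def K_def intro!: image_eqI[of _ _ "?\<phi> x"])
    qed
    show "p \<in> V" using c s by (simp add: V_def)
  qed
  have main: "x \<in> fst c \<and> ennreal (norm (?\<phi> x - ?\<phi> p) / C) \<le> curve_length A g \<gamma>"
    if \<gamma>: "piecewise_c1_curve A \<gamma>" "\<gamma> 0 = x" "\<gamma> 1 = p" and len: "curve_length A g \<gamma> < ennreal (s / C)" for x \<gamma>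
  proof -
    have cont: "continuous_on {0..1} \<gamma>" using \<gamma> by (simp add: piecewise_c1_curve_def)
    have est: "ennreal (norm (?\<phi> (\<gamma> a) - ?\<phi> p) / C) \<le> curve_length A g \<gamma>"
      if "0 \<le> a" "a \<le> 1" "\<gamma> ` {a..1} \<subseteq> V" for a
      using curve_chart_length[OF c(1) \<gamma>(1), of a 1 K C] that V K C \<gamma>(3)
      by (auto simp: norm_minus_commute)
    obtain l where l: "curve_length A g \<gamma> = ennreal l" "0 \<le> l"
      using len by (cases "curve_length A g \<gamma>") auto
    have ls: "C * l < s"
      using len l C(1) by (simp add: ennreal_less_iff pos_less_divide_eq mult.commute)
    have "\<gamma> ` {0..1} \<subseteq> V"
    proof (rule ccontr)
      assume not: "\<not> \<gamma> ` {0..1} \<subseteq> V"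
      define Z where "Z = \<gamma> -` (- V) \<inter> {0..1}"
      have Z: "closed Z" "Z \<noteq> {}" "bdd_above Z"
        using not V(1) cont by (auto simp: Z_def continuous_on_closed_vimage closed_Compl)
      \<comment> \<open>The last time outside \<open>V\<close>. It exists because \<open>Z\<close>
        is closed, and it is before \<open>1\<close> because the curve ends at
        \<open>p\<close>.\<close>
      define t where "t = Sup Z"
      have t: "t \<in> Z" unfolding t_def using Z by (intro closed_contains_Sup) auto
      have t1: "0 \<le> t" "t < 1" "\<gamma> t \<notin> V"
        using t \<gamma>(3) V(3) by (auto simp: Z_def less_le)
      have after: "\<gamma> s \<in> V" if "t < s" "s \<le> 1" for s
        using cSup_upper[of s Z] Z(3) that t1 unfolding t_def[symmetric] by (force simp: Z_def)
      \<comment> \<open>After \<open>t\<close> the curve lies in the closed ball of radius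
        \<open>C * l\<close>, strictly smaller than \<open>s\<close>; being closed, that ball also
        contains the point at time \<open>t\<close>, against the choice of \<open>t\<close>.\<close>
      define W where "W = \<gamma> -` (?\<psi> ` cball (?\<phi> p) (C * l)) \<inter> {0..1}"
      have "closed W" unfolding W_def
        using compact_imp_closed[OF cpt[of "C * l"]] ls cont by (auto simp: continuous_on_closed_vimage)
      moreover have "{t<..1} \<subseteq> W"
      proof
        fix a assume a: "a \<in> {t<..1}"
        then have "\<gamma> ` {a..1} \<subseteq> V" using after by auto
        from est[OF _ _ this] a t1 l have "norm (?\<phi> (\<gamma> a) - ?\<phi> p) \<le> C * l"
          using C(1) by (simp add: divide_le_eq mult.commute)
        moreover have "\<gamma> a \<in> fst c" using after[of a] a V(2) K(2) by auto
        ultimately have "\<gamma> a \<in> ?\<psi> ` cball (?\<phi> p) (C * l)"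
          using chart_inv_left[OF c(1), of "\<gamma> a"]
          by (intro image_eqI[of _ _ "?\<phi> (\<gamma> a)"]) (auto simp: dist_norm norm_minus_commute)
        then show "a \<in> W" using a t1 by (simp add: W_def)
      qed
      ultimately have "closure {t<..1} \<subseteq> W" by (rule closure_minimal[rotated])
      then have "t \<in> W" using t1 by (simp add: closure_greaterThanAtMost subset_iff)
      then obtain u where u: "u \<in> cball (?\<phi> p) (C * l)" "\<gamma> t = ?\<psi> u" by (auto simp: W_def)
      have "u \<in> ?\<phi> ` fst c" using u(1) ls s(2) by (auto simp: subset_iff)
      then have "\<gamma> t \<in> V"
        using u ls by (simp add: V_def chart_inv_right[OF c(1)] chart_inv_in[OF c(1)])
      then show False using t1(3) by contradiction
    qed
    moreover from this have "x \<in> V" using \<gamma>(2) by force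
    ultimately show ?thesis
      using est[of 0] \<gamma>(2) V(2) K(2) by auto
  qed
  have "x \<in> fst c \<and> ennreal (norm (?\<phi> x - ?\<phi> p) / C) \<le> rdist A g x p"
    if less: "rdist A g x p < ennreal (s / C)" for x
  proof -
    obtain \<gamma>0 where \<gamma>0: "piecewise_c1_curve A \<gamma>0" "\<gamma>0 0 = x" "\<gamma>0 1 = p" "curve_length A g \<gamma>0 < ennreal (s / C)"
      using less unfolding rdist_def INF_less_iff by auto
    note m0 = main[OF \<gamma>0]
    show ?thesis
    proof
      show "x \<in> fst c" using m0 by simp
      show "ennreal (norm (?\<phi> x - ?\<phi> p) / C) \<le> rdist A g x p"
        unfolding rdist_def
      proof (rule INF_greatest)
        fix \<gamma> assume "\<gamma> \<in> {\<gamma>. piecewise_c1_curve A \<gamma> \<and> \<gamma> 0 = x \<and> \<gamma> 1 = p}"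
        then have \<gamma>: "piecewise_c1_curve A \<gamma>" "\<gamma> 0 = x" "\<gamma> 1 = p" by auto
        show "ennreal (norm (?\<phi> x - ?\<phi> p) / C) \<le> curve_length A g \<gamma>"
        proof (cases "curve_length A g \<gamma> < ennreal (s / C)")
          case True
          then show ?thesis using main[OF \<gamma>] by simp
        next
          case False
          \<comment> \<open>A long curve needs no estimate of its own: the short curve
            \<open>\<gamma>0\<close> already bounds the left side by less than
            \<open>s / C\<close>.\<close>
          then show ?thesis using m0 \<gamma>0(4) by (meson le_less_trans linear not_less order_less_imp_le order_trans)
        qed
      qed
    qed
  qed
  moreover have "0 < s / C" "0 < C" using s C by auto
  ultimately show ?thesis by blast
qed

end

section \<open>Contracting returns\<close>

text \<open>In charts the iterates of \<open>f\<close> become compositions of varying maps, one for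
  each pair of consecutive charts.\<close>

primrec orbit :: "(nat \<Rightarrow> 'b \<Rightarrow> 'b) \<Rightarrow> 'b \<Rightarrow> nat \<Rightarrow> 'b" where
  "orbit F z 0 = z"
| "orbit F z (Suc n) = F n (orbit F z n)"

text \<open>The Taylor error has rate \<open>B * R\<close> only while the orbit stays within
  \<open>R\<close> of the reference orbit \<open>a\<close>. The value
  \<open>R = 3 * C * q ^ k * \<rho>\<close> is the a priori bound for an initial error \<rho>, so an
  induction closes the loop. The difference of two such orbits is then again a perturbed linear
  recursion, to which the linear part contributes only \<eta> at time \<open>k\<close>.\<close>

lemma nonautonomous_contraction:
  fixes F :: "nat \<Rightarrow> 'b::real_normed_vector \<Rightarrow> 'b" and S :: "nat \<Rightarrow> nat \<Rightarrow> 'b \<Rightarrow> 'b"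
    and k :: nat and B C q r R \<rho> \<eta> \<mu> :: real
  assumes T: "\<And>n. linear (T n)"
    and S0: "\<And>i x. S i i x = x" and SS: "\<And>i m x. i \<le> m \<Longrightarrow> S i (Suc m) x = T m (S i m x)"
    and bound: "\<And>i m x. i \<le> m \<Longrightarrow> m \<le> k \<Longrightarrow> norm (S i m x) \<le> C * q ^ (m - i) * norm x"
    and Fa: "\<And>n. n < k \<Longrightarrow> F n (a n) = a (Suc n)"
    and taylor: "\<And>n R z z'. n < k \<Longrightarrow> R \<le> r \<Longrightarrow> z \<in> cball (a n) R \<Longrightarrow> z' \<in> cball (a n) R
      \<Longrightarrow> norm (F n z - F n z' - T n (z - z')) \<le> B * R * norm (z - z')"
    and "1 \<le> C" "1 \<le> q" "0 \<le> B" "0 \<le> \<rho>"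
    and R: "R = 3 * C * q ^ k * \<rho>" "R \<le> r" "k * C * (B * R) \<le> 1"
    and contr: "\<And>x. norm (S 0 k x) \<le> \<eta> * norm x" "\<eta> + 3 * C\<^sup>2 * (B * R) * k * q ^ k \<le> \<mu>"
    and z: "z \<in> cball (a 0) \<rho>"
  shows "n \<le> k \<Longrightarrow> orbit F z n \<in> cball (a n) R"
    and "z' \<in> cball (a 0) \<rho> \<Longrightarrow> norm (orbit F z k - orbit F z' k) \<le> \<mu> * norm (z - z')"
proof -
  have R0: "0 \<le> R" using R(1) assms(7-10) by simp
  have \<kappa>0: "0 \<le> B * R" using R0 \<open>0 \<le> B\<close> by simp
  have stay: "orbit F z n \<in> cball (a n) R" if "z \<in> cball (a 0) \<rho>" "n \<le> k" for z n
    using that(2)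
  proof (induction n rule: less_induct)
    case (less n)
    let ?e = "\<lambda>i. orbit F z i - a i"
    have "norm (?e n) \<le> 3 * C * q ^ n * norm (?e 0)"
    proof (rule perturbed_linear_recursion(1)[OF T S0 SS bound _ less.prems \<open>1 \<le> C\<close> \<open>1 \<le> q\<close> \<kappa>0 R(3)])
      fix i assume i: "i < n"
      then have "orbit F z i \<in> cball (a i) R" using less by simp
      from taylor[OF _ R(2) this, of "a i"] i less.prems R0
      show "norm (?e (Suc i) - T i (?e i)) \<le> B * R * norm (?e i)"
        by (simp add: Fa)
    qed
    also have "\<dots> \<le> 3 * C * q ^ k * \<rho>"
      using that(1) less.prems assms(7-10)
      by (intro mult_mono power_increasing) (auto simp: dist_norm norm_minus_commute)
    finally show ?case by (simp add: dist_norm norm_minus_commute R(1))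
  qed
  show "n \<le> k \<Longrightarrow> orbit F z n \<in> cball (a n) R" by (rule stay[OF z])
  assume z': "z' \<in> cball (a 0) \<rho>"
  let ?e = "\<lambda>i. orbit F z i - orbit F z' i"
  have "norm (?e k) \<le> norm (S 0 k (?e 0)) + 3 * C\<^sup>2 * (B * R) * k * q ^ k * norm (?e 0)"
  proof (rule perturbed_linear_recursion(2)[OF T S0 SS bound _ order_refl \<open>1 \<le> C\<close> \<open>1 \<le> q\<close> \<kappa>0 R(3)])
    fix i assume i: "i < k"
    show "norm (?e (Suc i) - T i (?e i)) \<le> B * R * norm (?e i)"
      using taylor[OF i R(2) stay[OF z] stay[OF z']] i by simp
  qed
  also have "\<dots> \<le> \<eta> * norm (z - z') + 3 * C\<^sup>2 * (B * R) * k * q ^ k * norm (z - z')"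
    using contr(1) by simp
  also have "\<dots> \<le> \<mu> * norm (z - z')"
    using mult_right_mono[OF contr(2), of "norm (z - z')"] by (simp add: algebra_simps)
  finally show "norm (orbit F z k - orbit F z' k) \<le> \<mu> * norm (z - z')" .
qed

section \<open>From contraction to the eigenvalues of the derivative\<close>

lemma has_derivative_norm_le:
  fixes G :: "'b::real_normed_vector \<Rightarrow> 'c::real_normed_vector"
  assumes D: "(G has_derivative D) (at u)" and "\<rho> > 0"
    and lip: "\<And>z. z \<in> ball u \<rho> \<Longrightarrow> norm (G z - G u) \<le> \<mu> * norm (z - u)"
  shows "norm (D e) \<le> \<mu> * norm e"
proof (cases "e = 0")
  case True
  then show ?thesis using linear_0[OF has_derivative_linear[OF D]] by simp
next
  case False
  have lin: "linear D" using D has_derivative_linear by blast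
  have "norm (D e) \<le> \<mu> * norm e + \<epsilon> * norm e" if "\<epsilon> > 0" for \<epsilon>
  proof -
    obtain \<delta> where \<delta>: "\<delta> > 0" "\<And>z. norm (z - u) < \<delta> \<Longrightarrow> norm (G z - G u - D (z - u)) \<le> \<epsilon> * norm (z - u)"
      using D \<open>\<epsilon> > 0\<close> unfolding has_derivative_at_alt by metis
    define t where "t = min \<delta> \<rho> / (2 * norm e)"
    have t: "t > 0" using \<delta> \<open>\<rho> > 0\<close> False by (simp add: t_def)
    have nt: "norm (t *\<^sub>R e) = min \<delta> \<rho> / 2"
      using False \<delta>(1) \<open>\<rho> > 0\<close> by (simp add: t_def)
    then have small: "norm (t *\<^sub>R e) < \<delta>" "norm (t *\<^sub>R e) < \<rho>" using \<delta>(1) \<open>\<rho> > 0\<close> by auto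
    have "t * norm (D e) = norm (D (t *\<^sub>R e))"
      using t by (simp add: linear_cmul[OF lin])
    also have "\<dots> \<le> norm (G (u + t *\<^sub>R e) - G u) + norm (G (u + t *\<^sub>R e) - G u - D (t *\<^sub>R e))"
      using norm_triangle_ineq4[of "G (u + t *\<^sub>R e) - G u" "G (u + t *\<^sub>R e) - G u - D (t *\<^sub>R e)"] by simp
    also have "\<dots> \<le> \<mu> * norm (t *\<^sub>R e) + \<epsilon> * norm (t *\<^sub>R e)"
      using lip[of "u + t *\<^sub>R e"] \<delta>(2)[of "u + t *\<^sub>R e"] small by (intro add_mono) (simp_all add: dist_norm)
    also have "\<dots> = t * (\<mu> * norm e + \<epsilon> * norm e)"
      using t by (simp add: algebra_simps)
    finally show ?thesis using t by simp
  qed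
  note eps = this
  show ?thesis
  proof (rule field_le_epsilon)
    fix \<epsilon> :: real assume "0 < \<epsilon>"
    then show "norm (D e) \<le> \<mu> * norm e + \<epsilon>"
      using eps[of "\<epsilon> / norm e"] False by simp
  qed
qed

text \<open>A complex eigenvector is split into real and imaginary parts; \<open>D\<close> acts on
  their images under the inverse of \<open>Q\<close> by a rotation and a scaling, so the sum of the
  squared norms is multiplied by exactly the square of \<open>cmod z\<close>. The conjugation by
  \<open>Q\<close> allows the contraction to be measured in chart norms while \<open>M\<close>
  refers to orthonormal bases.\<close>

lemma cmod_eigenvalue_le:
  fixes M Q :: "real^2^2" and D :: "real^2 \<Rightarrow> real^2"
  assumes z: "is_eigenvalue M z" and Q: "invertible Q"
    and conj: "\<And>e. M *v (Q *v e) = Q *v D e" and D: "\<And>e. norm (D e) \<le> \<mu> * norm e" and "0 \<le> \<mu>"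
  shows "cmod z \<le> \<mu>"
proof -
  obtain w where w: "w \<noteq> 0" "map_matrix complex_of_real M *v w = z *s w"
    using z by (auto simp: is_eigenvalue_def)
  obtain P where P: "P ** Q = mat 1" "Q ** P = mat 1" using Q by (auto simp: invertible_def)
  have Pinj: "x = y" if "P *v x = P *v y" for x y
    using that P(2) by (metis matrix_vector_mul_assoc matrix_vector_mul_lid)
  have PM: "P *v (M *v x) = D (P *v x)" for x
  proof -
    have "x = Q *v (P *v x)" using P(2) by (simp add: matrix_vector_mul_assoc)
    then have "P *v (M *v x) = P *v (Q *v D (P *v x))" using conj by metis
    then show ?thesis using P(1) by (simp add: matrix_vector_mul_assoc)
  qed
  define a b where "a = (\<chi> i. Re (w $ i))" and "b = (\<chi> i. Im (w $ i))"
  have comp: "(\<Sum>j\<in>UNIV. complex_of_real (M $ i $ j) * w $ j) = z * w $ i" for i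
    using w(2) by (simp add: vec_eq_iff matrix_vector_mult_def map_matrix_def vector_scalar_mult_def)
  have "M *v a = Re z *\<^sub>R a - Im z *\<^sub>R b"
  proof (simp add: vec_eq_iff matrix_vector_mult_def a_def b_def, intro allI)
    fix i show "(\<Sum>j\<in>UNIV. M $ i $ j * Re (w $ j)) = Re z * Re (w $ i) - Im z * Im (w $ i)"
      using arg_cong[OF comp[of i], of Re] by simp
  qed
  then have a: "D (P *v a) = Re z *\<^sub>R (P *v a) - Im z *\<^sub>R (P *v b)"
    by (metis PM matrix_vector_mult_diff_distrib matrix_vector_mult_scaleR)
  have "M *v b = Im z *\<^sub>R a + Re z *\<^sub>R b"
  proof (simp add: vec_eq_iff matrix_vector_mult_def a_def b_def, intro allI)
    fix i show "(\<Sum>j\<in>UNIV. M $ i $ j * Im (w $ j)) = Im z * Re (w $ i) + Re z * Im (w $ i)"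
      using arg_cong[OF comp[of i], of Im] by simp
  qed
  then have b: "D (P *v b) = Im z *\<^sub>R (P *v a) + Re z *\<^sub>R (P *v b)"
    by (metis PM matrix_vector_right_distrib matrix_vector_mult_scaleR)
  define s where "s = (norm (P *v a))\<^sup>2 + (norm (P *v b))\<^sup>2"
  have "(cmod z)\<^sup>2 * s = (norm (D (P *v a)))\<^sup>2 + (norm (D (P *v b)))\<^sup>2"
    unfolding a b s_def cmod_power2 power2_norm_eq_inner
    by (simp add: inner_diff_left inner_diff_right inner_add_left inner_add_right inner_commute
        power2_eq_square algebra_simps)
  also have "\<dots> \<le> (\<mu> * norm (P *v a))\<^sup>2 + (\<mu> * norm (P *v b))\<^sup>2"
    using D by (intro add_mono power_mono) auto
  also have "\<dots> = \<mu>\<^sup>2 * s" by (simp add: s_def power_mult_distrib algebra_simps)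
  finally have "(cmod z)\<^sup>2 * s \<le> \<mu>\<^sup>2 * s" .
  moreover have "s > 0"
  proof -
    have "a \<noteq> 0 \<or> b \<noteq> 0"
      using w(1) by (auto simp: vec_eq_iff a_def b_def complex_eq_iff)
    then have "P *v a \<noteq> 0 \<or> P *v b \<noteq> 0"
      using Pinj by (metis matrix_vector_mult_0_right)
    then show ?thesis by (auto simp: s_def intro: add_pos_nonneg add_nonneg_pos)
  qed
  ultimately have "(cmod z)\<^sup>2 \<le> \<mu>\<^sup>2" by simp
  then show ?thesis using \<open>0 \<le> \<mu>\<close> by (rule power2_le_imp_le)
qed

context compact_riemannian_surface
begin

text \<open>The error is taken relative to the derivative at the centre \<open>x\<close> and shrinks
  with \<open>R\<close>, so all orbits near that of \<open>x\<close> share the same linear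
  parts.\<close>

definition chart_bound :: "('a \<Rightarrow> 'a) \<Rightarrow> 'a chart \<Rightarrow> 'a chart \<Rightarrow> 'a \<Rightarrow> real \<Rightarrow> real \<Rightarrow> bool" where
  "chart_bound h c d x r B \<longleftrightarrow>
    cball (snd c x) r \<subseteq> snd c ` (fst c \<inter> h -` fst d) \<and>
    (\<forall>e. norm (chart_deriv h c d x e) \<le> B * norm e) \<and>
    (\<forall>R\<le>r. \<forall>z\<in>cball (snd c x) R. \<forall>z'\<in>cball (snd c x) R.
       norm ((snd d \<circ> h \<circ> chart_inv c) z - (snd d \<circ> h \<circ> chart_inv c) z'
         - chart_deriv h c d x (z - z')) \<le> B * R * norm (z - z'))"

text \<open>The condition \<open>ch k = ch 0\<close> makes the return a self-map of one chart.
  Contraction by \<open>1 / 2\<close>, with a centre that moves by less than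
  \<open>\<rho> / 2\<close>, sends the ball into itself. As that inequality is strict, the fixed
  point is interior, and the derivative there inherits the bound \<open>1 / 2\<close>.\<close>

lemma sink_of_contracting_return:
  fixes ch :: "nat \<Rightarrow> 'a chart" and k :: nat and r B C0 C1 C q \<eta> \<rho> R :: real
  assumes f: "diff_map A f" and \<Lambda>: "closed \<Lambda>" "f ` \<Lambda> \<subseteq> \<Lambda>" "y \<in> \<Lambda>" and "k > 0"
    and ch: "\<And>n. ch n \<in> A" "\<And>n. (f ^^ n) y \<in> fst (ch n)" "ch k = ch 0"
    and cb: "\<And>n. n < k \<Longrightarrow> chart_bound f (ch n) (ch (Suc n)) ((f ^^ n) y) r B"
    and fb: "\<And>n e. n \<le> k \<Longrightarrow> norm (frame (ch n) ((f ^^ n) y) *v e) \<le> C0 * norm e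
        \<and> norm e \<le> C0 * norm (frame (ch n) ((f ^^ n) y) *v e)"
    and sub: "\<And>x n w. x \<in> \<Lambda> \<Longrightarrow> norm (tangent_matrix A g (f ^^ n) x *v w) \<le> C1 * q ^ n * norm w"
    and \<eta>: "\<And>w. norm (tangent_matrix A g (f ^^ k) y *v w) \<le> \<eta> * norm w"
    and ret: "norm (snd (ch 0) ((f ^^ k) y) - snd (ch 0) y) < \<rho> / 2"
    and cst: "1 \<le> C0" "1 \<le> C1" "1 \<le> q" "0 \<le> B" "0 \<le> \<eta>"
    and C: "C = C0\<^sup>2 * C1"
    and R: "R = 3 * C * q ^ k * \<rho>" "R \<le> r" "k * C * (B * R) \<le> 1"
    and contr: "C0\<^sup>2 * \<eta> + 3 * C\<^sup>2 * (B * R) * k * q ^ k \<le> 1 / 2"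
  shows "\<exists>p\<in>\<Lambda>. is_sink A g f p"
proof -
  define y' where "y' n = (f ^^ n) y" for n
  have y'\<Lambda>: "y' n \<in> \<Lambda>" for n using \<Lambda> by (induction n) (auto simp: y'_def)
  have y'Suc: "f (y' n) = y' (Suc n)" for n by (simp add: y'_def)
  have chy: "y' n \<in> fst (ch n)" for n using ch by (simp add: y'_def)
  define a where "a n = snd (ch n) (y' n)" for n
  define F where "F n = snd (ch (Suc n)) \<circ> f \<circ> chart_inv (ch n)" for n
  define T where "T n = chart_deriv f (ch n) (ch (Suc n)) (y' n)" for n
  define Q where "Q n = frame (ch n) (y' n)" for n
  have invQ: "invertible (Q n)" for n unfolding Q_def by (rule invertible_frame[OF ch(1) chy])
  then have "\<forall>n. \<exists>P. P ** Q n = mat 1 \<and> Q n ** P = mat 1" by (auto simp: invertible_def)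
  then obtain P where P: "\<And>n. P n ** Q n = mat 1" "\<And>n. Q n ** P n = mat 1" by metis
  have PQ: "P n *v (Q n *v x) = x" "Q n *v (P n *v x) = x" for n x
    by (simp_all add: matrix_vector_mul_assoc P)
  \<comment> \<open>The product of the linear parts, written through Riemannian matrices:
    intermediate frames cancel, so the passage to chart norms costs \<open>C0\<^sup>2\<close> once
    and not once per step.\<close>
  define S where "S i m x = P m *v (tangent_matrix A g (f ^^ (m - i)) (y' i) *v (Q i *v x))" for i m x
  have linT: "linear (T n)" for n
    unfolding T_def using ch(1) chy y'Suc by (intro linear_chart_deriv[OF f]) auto
  have TQ: "T n x = P (Suc n) *v (tangent_matrix A g f (y' n) *v (Q n *v x))" for n x
    using tangent_matrix_frame[OF f ch(1) chy ch(1), of n "Suc n" x] chy[of "Suc n"] y'Suc[of n]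
    by (simp add: T_def Q_def[symmetric] PQ)
  have S0: "S i i x = x" for i x
    by (simp add: S_def PQ tangent_matrix_id id_def[symmetric])
  have SS: "S i (Suc m) x = T m (S i m x)" if "i \<le> m" for i m x
  proof -
    have "(f ^^ (m - i)) (y' i) = y' m"
      using that by (simp add: y'_def flip: funpow_add comp_apply[of "f ^^ (m - i)"])
    then have "tangent_matrix A g (f ^^ Suc (m - i)) (y' i)
        = tangent_matrix A g f (y' m) ** tangent_matrix A g (f ^^ (m - i)) (y' i)"
      using tangent_matrix_comp[OF diff_map_funpow[OF f] f, of "m - i" "y' i"] by simp
    then show ?thesis
      using that by (simp add: S_def TQ PQ Suc_diff_le matrix_vector_mul_assoc[symmetric])
  qed
  have fbP: "norm (P n *v x) \<le> C0 * norm x" if "n \<le> k" for n x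
    using fb[OF that, of "P n *v x"] by (simp add: y'_def[symmetric] Q_def[symmetric] PQ)
  have fbQ: "norm (Q n *v x) \<le> C0 * norm x" if "n \<le> k" for n x
    using fb[OF that, of x] by (simp add: y'_def[symmetric] Q_def[symmetric])
  have conj_bound: "norm (S i m x) \<le> C0\<^sup>2 * N * norm x"
    if "i \<le> m" "m \<le> k" "0 \<le> N" and N: "\<And>w. norm (tangent_matrix A g (f ^^ (m - i)) (y' i) *v w) \<le> N * norm w" for i m x and N :: real
  proof -
    have "norm (S i m x) \<le> C0 * norm (tangent_matrix A g (f ^^ (m - i)) (y' i) *v (Q i *v x))"
      unfolding S_def by (rule fbP[OF that(2)])
    also have "\<dots> \<le> C0 * (N * norm (Q i *v x))"
      using N cst by (intro mult_left_mono) auto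
    also have "\<dots> \<le> C0 * (N * (C0 * norm x))"
      using fbQ[of i x] that cst by (intro mult_left_mono) auto
    finally show ?thesis by (simp add: power2_eq_square mult_ac)
  qed
  have bound: "norm (S i m x) \<le> C * q ^ (m - i) * norm x" if "i \<le> m" "m \<le> k" for i m x
    using conj_bound[OF that _ sub[OF y'\<Lambda>], of x] cst by (simp add: C mult_ac)
  have contr1: "norm (S 0 k x) \<le> C0\<^sup>2 * \<eta> * norm x" for x
    using conj_bound[of 0 k \<eta> x] \<eta> cst by (simp add: y'_def)
  have chart_a: "chart_inv (ch n) (a n) = y' n" for n
    by (simp add: a_def chart_inv_left ch(1) chy)
  have Fa: "F n (a n) = a (Suc n)" for n
    by (simp add: F_def chart_a y'Suc) (simp add: a_def)
  have taylor: "norm (F n z - F n z' - T n (z - z')) \<le> B * R * norm (z - z')"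
    if "n < k" "R \<le> r" "z \<in> cball (a n) R" "z' \<in> cball (a n) R" for n R z z'
  proof -
    have "\<forall>R\<le>r. \<forall>z\<in>cball (a n) R. \<forall>z'\<in>cball (a n) R. norm (F n z - F n z' - T n (z - z')) \<le> B * R * norm (z - z')"
      using cb[OF that(1)] unfolding chart_bound_def F_def T_def a_def y'_def by (elim conjE)
    then show ?thesis using that by blast
  qed
  have dom: "cball (a n) R \<subseteq> snd (ch n) ` (fst (ch n) \<inter> f -` fst (ch (Suc n)))" if "n < k" for n
  proof -
    have "cball (a n) r \<subseteq> snd (ch n) ` (fst (ch n) \<inter> f -` fst (ch (Suc n)))"
      using cb[OF that] unfolding chart_bound_def a_def y'_def by (elim conjE)
    then show ?thesis using subset_cball[OF R(2), of "a n"] by (rule order_trans[rotated])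
  qed
  have \<rho>: "0 < \<rho>" using ret norm_ge_zero[of "snd (ch 0) ((f ^^ k) y) - snd (ch 0) y"] by linarith
  have C1: "1 \<le> C" using cst mult_mono[of 1 "C0\<^sup>2" 1 C1] one_le_power[of C0 2] by (simp add: C)
  have \<rho>R: "\<rho> \<le> R"
  proof -
    have "1 * \<rho> \<le> (3 * (C * q ^ k)) * \<rho>"
      using \<rho> C1 one_le_power[OF \<open>1 \<le> q\<close>, of k] mult_mono[of 1 C 1 "q ^ k"]
      by (intro mult_right_mono) auto
    then show ?thesis by (simp add: R(1) mult_ac)
  qed
  define G where "G z = orbit F z k" for z
  note na = nonautonomous_contraction[OF linT S0 SS bound Fa taylor C1 \<open>1 \<le> q\<close> \<open>0 \<le> B\<close>
      less_imp_le[OF \<rho>] R contr1 contr]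
  have stay: "orbit F z n \<in> cball (a n) R" if "z \<in> cball (a 0) \<rho>" "n \<le> k" for z n
    using na(1) that by blast
  have lip: "norm (G z - G z') \<le> 1 / 2 * norm (z - z')" if "z \<in> cball (a 0) \<rho>" "z' \<in> cball (a 0) \<rho>" for z z'
    unfolding G_def using na(2) that by blast
  let ?\<phi> = "snd (ch 0)" and ?\<psi> = "chart_inv (ch 0)"
  have U: "cball (a 0) \<rho> \<subseteq> ?\<phi> ` fst (ch 0)"
    using dom[OF \<open>k > 0\<close>] subset_cball[OF \<rho>R, of "a 0"] by blast
  \<comment> \<open>The abstract orbit is an orbit of \<open>f\<close> seen in charts: staying
    within \<open>R\<close> keeps it in the domain of the next chart, and injectivity of the chart
    identifies the underlying point.\<close>
  have track: "(f ^^ n) (?\<psi> z) \<in> fst (ch n) \<and> orbit F z n = snd (ch n) ((f ^^ n) (?\<psi> z))"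
    if z: "z \<in> cball (a 0) \<rho>" "n \<le> k" for z n
    using that(2)
  proof (induction n)
    case 0
    then show ?case
      using U z(1) chart_inv_in[OF ch(1), of z 0] chart_inv_right[OF ch(1), of z 0] by auto
  next
    case (Suc n)
    then have IH: "(f ^^ n) (?\<psi> z) \<in> fst (ch n)" "orbit F z n = snd (ch n) ((f ^^ n) (?\<psi> z))" by auto
    have "orbit F z n \<in> snd (ch n) ` (fst (ch n) \<inter> f -` fst (ch (Suc n)))"
      using stay[OF z(1), of n] dom[of n] Suc.prems by auto
    then obtain x where x: "x \<in> fst (ch n)" "f x \<in> fst (ch (Suc n))" "orbit F z n = snd (ch n) x" by auto
    then have "x = (f ^^ n) (?\<psi> z)"
      using IH chart_inv_left[OF ch(1)] by metis
    moreover have "F n v = snd (ch (Suc n)) (f (chart_inv (ch n) v))" for v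
      by (simp add: F_def)
    ultimately show ?case using x IH(1) by (simp add: chart_inv_left[OF ch(1)])
  qed
  have G: "(f ^^ k) (?\<psi> z) \<in> fst (ch 0)" "G z = ?\<phi> ((f ^^ k) (?\<psi> z))" if "z \<in> cball (a 0) \<rho>" for z
    using track[OF that order_refl] by (simp_all add: G_def ch(3))
  have a0: "a 0 \<in> cball (a 0) \<rho>" using \<rho> by simp
  have Ga0: "norm (G (a 0) - a 0) < \<rho> / 2"
    using ret G(2)[OF a0] by (simp add: chart_a) (simp add: a_def y'_def)
  have maps: "G ` cball (a 0) \<rho> \<subseteq> cball (a 0) \<rho>"
  proof (rule image_subsetI)
    fix z assume z: "z \<in> cball (a 0) \<rho>"
    have "norm (G z - a 0) \<le> norm (G z - G (a 0)) + norm (G (a 0) - a 0)"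
      using norm_triangle_ineq[of "G z - G (a 0)" "G (a 0) - a 0"] by simp
    also have "\<dots> \<le> 1 / 2 * norm (z - a 0) + \<rho> / 2" using lip[OF z a0] Ga0 by simp
    also have "\<dots> \<le> \<rho>" using z by (simp add: dist_norm norm_minus_commute)
    finally show "G z \<in> cball (a 0) \<rho>" by (simp add: dist_norm norm_minus_commute)
  qed
  have "\<exists>!u\<in>cball (a 0) \<rho>. G u = u"
  proof (rule Banach_fix[of _ "1 / 2"])
    show "cball (a 0) \<rho> \<noteq> {}" using a0 by blast
    show "dist (G x) (G z) \<le> 1 / 2 * dist x z" if "x \<in> cball (a 0) \<rho>" "z \<in> cball (a 0) \<rho>" for x z
      using lip[OF that] by (simp add: dist_norm)
  qed (use maps in \<open>simp_all add: complete_eq_closed\<close>)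
  then obtain u where u: "u \<in> cball (a 0) \<rho>" "G u = u" by blast
  define p where "p = ?\<psi> u"
  have pU: "p \<in> fst (ch 0)" "?\<phi> p = u"
    using U u(1) chart_inv_in[OF ch(1), of u 0] chart_inv_right[OF ch(1), of u 0] by (auto simp: p_def)
  have fp: "(f ^^ k) p = p"
    using G[OF u(1)] u(2) chart_inv_left[OF ch(1)] pU(1) unfolding p_def[symmetric] by (metis pU(2))
  have iter: "(G ^^ n) (a 0) \<in> cball (a 0) \<rho> \<and> norm ((G ^^ n) (a 0) - u) \<le> (1 / 2) ^ n * norm (a 0 - u)
      \<and> ?\<psi> ((G ^^ n) (a 0)) = ((f ^^ k) ^^ n) y" for n
  proof (induction n)
    case 0
    then show ?case using a0 chart_a[of 0] by (simp add: y'_def)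
  next
    case (Suc n)
    let ?z = "(G ^^ n) (a 0)"
    have z: "?z \<in> cball (a 0) \<rho>" using Suc by simp
    have "norm (G ?z - u) \<le> 1 / 2 * norm (?z - u)" using lip[OF z u(1)] u(2) by simp
    also have "\<dots> \<le> 1 / 2 * ((1 / 2) ^ n * norm (a 0 - u))" using Suc by (intro mult_left_mono) auto
    finally have "norm (G ?z - u) \<le> (1 / 2) ^ Suc n * norm (a 0 - u)" by simp
    moreover have "G ?z \<in> cball (a 0) \<rho>" using maps z by blast
    moreover have "?\<psi> (G ?z) = (f ^^ k) (((f ^^ k) ^^ n) y)"
      using G[OF z] Suc by (simp add: chart_inv_left[OF ch(1)])
    ultimately show ?case by simp
  qed
  have lim: "(\<lambda>n. (G ^^ n) (a 0)) \<longlonglongrightarrow> u"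
  proof (rule LIM_zero_cancel, rule Lim_null_comparison)
    show "\<forall>\<^sub>F n in sequentially. norm ((G ^^ n) (a 0) - u) \<le> (1 / 2) ^ n * norm (a 0 - u)"
      using iter by simp
    show "(\<lambda>n. (1 / 2 :: real) ^ n * norm (a 0 - u)) \<longlonglongrightarrow> 0"
      by (intro tendsto_mult_left_zero LIMSEQ_power_zero) simp
  qed
  have "isCont ?\<psi> u"
    using continuous_on_chart_inv[OF ch(1)] open_chart_image[OF ch(1)] u(1) U
    by (auto simp: continuous_on_eq_continuous_at)
  then have "(\<lambda>n. ?\<psi> ((G ^^ n) (a 0))) \<longlonglongrightarrow> p"
    unfolding p_def using lim isCont_tendsto_compose by blast
  moreover have "((f ^^ k) ^^ n) y \<in> \<Lambda>" for n
  proof -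
    have "(f ^^ m) x \<in> \<Lambda>" if "x \<in> \<Lambda>" for m x using that \<Lambda>(2) by (induction m) auto
    then show ?thesis using \<Lambda>(3) by (induction n) auto
  qed
  ultimately have p\<Lambda>: "p \<in> \<Lambda>"
    using iter by (intro Lim_in_closed_set[OF \<Lambda>(1) _ sequentially_bot]) auto
  have "norm (u - a 0) < \<rho>"
  proof -
    have "norm (u - a 0) \<le> norm (G u - G (a 0)) + norm (G (a 0) - a 0)"
      using norm_triangle_ineq[of "G u - G (a 0)" "G (a 0) - a 0"] u(2) by simp
    also have "\<dots> < 1 / 2 * norm (u - a 0) + \<rho> / 2" using lip[OF u(1) a0] Ga0 by simp
    finally show ?thesis by simp
  qed
  then have "u \<in> ball (a 0) \<rho>" by (simp add: dist_norm norm_minus_commute)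
  then obtain \<rho>' where \<rho>': "\<rho>' > 0" "ball u \<rho>' \<subseteq> ball (a 0) \<rho>"
    using openE[OF open_ball] by blast
  note fk = diff_map_funpow[OF f, of k]
  let ?D = "chart_deriv (f ^^ k) (ch 0) (ch 0) p"
  have "norm (?D e) \<le> 1 / 2 * norm e" for e
  proof (rule has_derivative_norm_le[OF _ \<rho>'(1)])
    show "((?\<phi> \<circ> f ^^ k \<circ> ?\<psi>) has_derivative ?D) (at u)"
      using diff_mapD[OF fk ch(1) ch(1) pU(1), of 0] fp pU by simp
    fix z assume "z \<in> ball u \<rho>'"
    then have "z \<in> cball (a 0) \<rho>" using \<rho>'(2) by auto
    then show "norm ((?\<phi> \<circ> f ^^ k \<circ> ?\<psi>) z - (?\<phi> \<circ> f ^^ k \<circ> ?\<psi>) u) \<le> 1 / 2 * norm (z - u)"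
      using lip[OF _ u(1)] G(2) u(1) by (metis comp_apply)
  qed
  then have "cmod ev \<le> 1 / 2" if "is_eigenvalue (tangent_matrix A g (f ^^ k) p) ev" for ev
    using cmod_eigenvalue_le[OF that invertible_frame[OF ch(1) pU(1)], of ?D "1 / 2"]
      tangent_matrix_frame[OF fk ch(1) pU(1) ch(1)[of 0]] fp pU(1) by simp
  then have "is_sink A g f p"
    unfolding is_sink_def using \<open>k > 0\<close> fp by (intro exI[of _ k]) force
  then show ?thesis using p\<Lambda> by blast
qed

section \<open>Uniform constants\<close>

text \<open>Finiteness of \<open>J\<close> makes all constants uniform. The function \<sigma>
  assigns to each point a chart and a compact piece containing it with coordinate margin
  \<open>r\<close>; owing to the margin, a point that returns close to \<open>x\<close> is still in
  the piece of \<open>x\<close>.\<close>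

definition chart_system :: "('a chart \<times> 'a set) set \<Rightarrow> ('a \<Rightarrow> 'a chart \<times> 'a set) \<Rightarrow> real \<Rightarrow> bool" where
  "chart_system J \<sigma> r \<longleftrightarrow> finite J \<and> r > 0 \<and>
     (\<forall>(c, K)\<in>J. c \<in> A \<and> compact K \<and> K \<subseteq> fst c) \<and>
     (\<forall>x. \<sigma> x \<in> J \<and> x \<in> snd (\<sigma> x) \<and>
        cball (snd (fst (\<sigma> x)) x) r \<subseteq> snd (fst (\<sigma> x)) ` snd (\<sigma> x))"

text \<open>Two radii are used: the sets \<open>V\<close> of radius \<open>s\<close> cover the
  surface, while the pieces \<open>K\<close> have radius \<open>2 * s\<close>, so every point of
  \<open>V\<close> has margin \<open>s\<close>. Finitely many \<open>V\<close> suffice, and the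
  least \<open>s\<close> serves for all.\<close>

lemma chart_system_exists: "\<exists>J \<sigma> r. chart_system J \<sigma> r"
proof -
  have "\<exists>c s. c \<in> A \<and> x \<in> fst c \<and> s > 0 \<and> cball (snd c x) (2 * s) \<subseteq> snd c ` fst c" for x
  proof -
    obtain c where c: "c \<in> A" "x \<in> fst c" using obtain_chart .
    then obtain s where "s > 0" "cball (snd c x) s \<subseteq> snd c ` fst c"
      using open_chart_image open_contains_cball by (metis imageI)
    then show ?thesis using c by (intro exI[of _ c] exI[of _ "s / 2"]) auto
  qed
  then obtain ch s where ch: "\<And>x. ch x \<in> A" "\<And>x. x \<in> fst (ch x)" "\<And>x. s x > 0"
      "\<And>x. cball (snd (ch x) x) (2 * s x) \<subseteq> snd (ch x) ` fst (ch x)"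
    by metis
  define V where "V x = snd (ch x) -` ball (snd (ch x) x) (s x) \<inter> fst (ch x)" for x
  define K where "K x = chart_inv (ch x) ` cball (snd (ch x) x) (2 * s x)" for x
  have oV: "open (V x)" for x
    using continuous_on_chart[OF ch(1)] open_chart[OF ch(1)] by (auto simp: V_def continuous_on_open_vimage)
  have xV: "x \<in> V x" for x using ch by (simp add: V_def)
  obtain I where I: "finite I" "(UNIV :: 'a set) \<subseteq> (\<Union>x\<in>I. V x)"
  proof (rule compactE_image[OF compact_surface, of UNIV V])
    show "(UNIV :: 'a set) \<subseteq> \<Union> (range V)" using xV by blast
  qed (use oV in auto)
  have "\<exists>i. i \<in> I \<and> x \<in> V i" for x using I(2) by blast
  then obtain i where i: "\<And>x. i x \<in> I" "\<And>x. x \<in> V (i x)" by metis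
  define r where "r = Min (s ` I)"
  have "I \<noteq> {}" using i(1) by blast
  then have r: "r > 0" "\<And>x. x \<in> I \<Longrightarrow> r \<le> s x"
    using I(1) ch(3) by (auto simp: r_def)
  have K: "compact (K x)" "K x \<subseteq> fst (ch x)" "snd (ch x) ` K x = cball (snd (ch x) x) (2 * s x)" for x
  proof -
    show "compact (K x)"
      unfolding K_def using continuous_on_subset[OF continuous_on_chart_inv[OF ch(1)] ch(4)]
      by (intro compact_continuous_image) auto
    show "K x \<subseteq> fst (ch x)" unfolding K_def using ch(4)[of x] chart_inv_in[OF ch(1), of _ x] by blast
    have "snd (ch x) (chart_inv (ch x) u) = u" if "u \<in> cball (snd (ch x) x) (2 * s x)" for u
      using that ch(4)[of x] chart_inv_right[OF ch(1)] by blast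
    then show "snd (ch x) ` K x = cball (snd (ch x) x) (2 * s x)"
      unfolding K_def image_image by simp
  qed
  have VK: "x \<in> K y" "cball (snd (ch y) x) (s y) \<subseteq> snd (ch y) ` K y" if "x \<in> V y" for x y
  proof -
    have x: "x \<in> fst (ch y)" "dist (snd (ch y) y) (snd (ch y) x) < s y" using that by (auto simp: V_def)
    show "cball (snd (ch y) x) (s y) \<subseteq> snd (ch y) ` K y"
    proof
      fix u assume "u \<in> cball (snd (ch y) x) (s y)"
      then show "u \<in> snd (ch y) ` K y"
        using x(2) dist_triangle[of "snd (ch y) y" u "snd (ch y) x"] unfolding K(3) by simp
    qed
    show "x \<in> K y"
      using x ch(3)[of y] chart_inv_left[OF ch(1) x(1)] unfolding K_def
      by (intro image_eqI[of _ _ "snd (ch y) x"]) auto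
  qed
  have "chart_system ((\<lambda>x. (ch x, K x)) ` I) (\<lambda>x. (ch (i x), K (i x))) r"
    unfolding chart_system_def
  proof (intro conjI allI)
    fix x
    show "cball (snd (fst (ch (i x), K (i x))) x) r \<subseteq> snd (fst (ch (i x), K (i x))) ` snd (ch (i x), K (i x))"
      using VK(2)[OF i(2), of x] subset_cball[OF r(2)[OF i(1)[of x]], of "snd (ch (i x)) x"] by auto
  qed (use I r K ch i VK(1) in auto)
  then show ?thesis by blast
qed

lemma chart_bound_mono:
  assumes "chart_bound h c d x r B" "r' \<le> r" "B \<le> B'"
  shows "chart_bound h c d x r' B'"
  unfolding chart_bound_def
proof (intro conjI allI impI ballI)
  show "cball (snd c x) r' \<subseteq> snd c ` (fst c \<inter> h -` fst d)"
    using assms subset_cball[OF assms(2), of "snd c x"] unfolding chart_bound_def by blast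
  fix e
  have "norm (chart_deriv h c d x e) \<le> B * norm e" using assms(1) unfolding chart_bound_def by blast
  also have "\<dots> \<le> B' * norm e" using assms(3) by (intro mult_right_mono) auto
  finally show "norm (chart_deriv h c d x e) \<le> B' * norm e" .
next
  fix R z z' assume R: "R \<le> r'" "z \<in> cball (snd c x) R" "z' \<in> cball (snd c x) R"
  have "\<forall>R\<le>r. \<forall>z\<in>cball (snd c x) R. \<forall>z'\<in>cball (snd c x) R.
       norm ((snd d \<circ> h \<circ> chart_inv c) z - (snd d \<circ> h \<circ> chart_inv c) z'
         - chart_deriv h c d x (z - z')) \<le> B * R * norm (z - z')"
    using assms(1) unfolding chart_bound_def by (elim conjE)
  then have "norm ((snd d \<circ> h \<circ> chart_inv c) z - (snd d \<circ> h \<circ> chart_inv c) z'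
         - chart_deriv h c d x (z - z')) \<le> B * R * norm (z - z')"
    using R assms(2) order_trans[of R r' r] by blast
  also have "\<dots> \<le> B' * R * norm (z - z')"
    using assms(3) R(2) order_trans[OF zero_le_dist] by (intro mult_right_mono) auto
  finally show "norm ((snd d \<circ> h \<circ> chart_inv c) z - (snd d \<circ> h \<circ> chart_inv c) z'
         - chart_deriv h c d x (z - z')) \<le> B' * R * norm (z - z')" .
qed

lemma uniform_chart_bound:
  assumes h: "ck_map 2 A h" and J: "chart_system J \<sigma> r0"
  shows "\<exists>r>0. \<exists>B\<ge>1. \<forall>c K d K' x. (c, K) \<in> J \<longrightarrow> (d, K') \<in> J \<longrightarrow> x \<in> K \<longrightarrow> h x \<in> K' \<longrightarrow>
    chart_bound h c d x r B"
proof -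
  have J': "finite J" "J \<noteq> {}" "\<And>c K. (c, K) \<in> J \<Longrightarrow> c \<in> A \<and> compact K \<and> K \<subseteq> fst c"
    using J by (auto simp: chart_system_def)
  have "\<exists>r B. r > 0 \<and> (\<forall>x\<in>snd i. h x \<in> snd j \<longrightarrow> chart_bound h (fst i) (fst j) x r B)"
    if "i \<in> J" "j \<in> J" for i j
    using ck2_chart_bounds[OF h, of "fst i" "fst j" "snd i" "snd j"] J'(3)[of "fst i" "snd i"]
      J'(3)[of "fst j" "snd j"] that compact_imp_closed[of "snd j"]
    unfolding chart_bound_def[symmetric] by auto
  then obtain r B where rB: "\<And>i j. i \<in> J \<Longrightarrow> j \<in> J \<Longrightarrow> r i j > 0"
      "\<And>i j x. i \<in> J \<Longrightarrow> j \<in> J \<Longrightarrow> x \<in> snd i \<Longrightarrow> h x \<in> snd j \<Longrightarrow> chart_bound h (fst i) (fst j) x (r i j) (B i j)"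
    by metis
  define r' where "r' = Min ((\<lambda>(i, j). r i j) ` (J \<times> J))"
  define B' where "B' = Max (insert 1 ((\<lambda>(i, j). B i j) ` (J \<times> J)))"
  have "r' > 0" unfolding r'_def using J' rB(1) by (subst Min_gr_iff) auto
  moreover have "1 \<le> B'" using J' by (simp add: B'_def)
  moreover have "chart_bound h c d x r' B'"
    if "(c, K) \<in> J" "(d, K') \<in> J" "x \<in> K" "h x \<in> K'" for c K d K' x
  proof (rule chart_bound_mono)
    show "chart_bound h c d x (r (c, K) (d, K')) (B (c, K) (d, K'))"
      using rB(2)[OF that(1,2)] that by simp
    show "r' \<le> r (c, K) (d, K')"
      unfolding r'_def using that J' by (intro Min_le) (auto intro!: image_eqI[of _ _ "((c, K), (d, K'))"])
    show "B (c, K) (d, K') \<le> B'"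
      unfolding B'_def using that J' by (intro Max_ge) (auto intro!: image_eqI[of _ _ "((c, K), (d, K'))"])
  qed
  ultimately show ?thesis by blast
qed

lemma uniform_frame_bound:
  assumes J: "chart_system J \<sigma> r0"
  shows "\<exists>C\<ge>1. \<forall>c K x e. (c, K) \<in> J \<longrightarrow> x \<in> K \<longrightarrow>
    norm (frame c x *v e) \<le> C * norm e \<and> norm e \<le> C * norm (frame c x *v e)"
proof -
  have J': "finite J" "\<And>c K. (c, K) \<in> J \<Longrightarrow> c \<in> A \<and> compact K \<and> K \<subseteq> fst c"
    using J by (auto simp: chart_system_def)
  have "\<exists>C. \<forall>x\<in>snd i. \<forall>e. norm (frame (fst i) x *v e) \<le> C * norm e \<and> norm e \<le> C * norm (frame (fst i) x *v e)"
    if "i \<in> J" for i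
    using frame_bounds[of "fst i" "snd i"] J'(2)[of "fst i" "snd i"] that by auto
  then obtain C where C: "\<And>i x e. i \<in> J \<Longrightarrow> x \<in> snd i \<Longrightarrow>
      norm (frame (fst i) x *v e) \<le> C i * norm e \<and> norm e \<le> C i * norm (frame (fst i) x *v e)"
    by metis
  define C' where "C' = Max (insert 1 (C ` J))"
  have C': "C i \<le> C'" if "i \<in> J" for i using that J'(1) by (simp add: C'_def)
  have "norm (frame c x *v e) \<le> C' * norm e \<and> norm e \<le> C' * norm (frame c x *v e)"
    if "(c, K) \<in> J" "x \<in> K" for c K x e
    using C[OF that(1), of x e] that(2) mult_right_mono[OF C'[OF that(1)] norm_ge_zero[of e]]
      mult_right_mono[OF C'[OF that(1)] norm_ge_zero[of "frame c x *v e"]] by auto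
  moreover have "1 \<le> C'" using J'(1) by (simp add: C'_def)
  ultimately show ?thesis by blast
qed

text \<open>This crude bound covers the early iterates, and it makes the suprema that define
  \<open>tangent_map_norm_on\<close> suprema of bounded sets.\<close>

lemma tangent_matrix_bounded:
  assumes h: "ck_map 2 A h"
  shows "\<exists>L\<ge>1. \<forall>x w. norm (tangent_matrix A g h x *v w) \<le> L * norm w"
proof -
  have dh: "diff_map A h" using h ck_map_imp_diff_map[of 1 h] by (simp add: numeral_2_eq_2)
  obtain J \<sigma> r0 where J: "chart_system J \<sigma> r0" using chart_system_exists by blast
  obtain r B where B: "B \<ge> 1" "\<And>c K d K' x. (c, K) \<in> J \<Longrightarrow> (d, K') \<in> J \<Longrightarrow> x \<in> K \<Longrightarrow> h x \<in> K' \<Longrightarrow>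
      chart_bound h c d x r B"
    using uniform_chart_bound[OF h J] by blast
  obtain C where C: "C \<ge> 1" "\<And>c K x e. (c, K) \<in> J \<Longrightarrow> x \<in> K \<Longrightarrow>
      norm (frame c x *v e) \<le> C * norm e \<and> norm e \<le> C * norm (frame c x *v e)"
    using uniform_frame_bound[OF J] by blast
  have "norm (tangent_matrix A g h x *v w) \<le> C * B * C * norm w" for x w
  proof -
    obtain c K where c: "\<sigma> x = (c, K)" by fastforce
    obtain d K' where d: "\<sigma> (h x) = (d, K')" by fastforce
    have cK: "(c, K) \<in> J" "x \<in> K" "c \<in> A" "x \<in> fst c"
      using J c unfolding chart_system_def by (auto 4 3 simp: case_prod_beta dest: spec[of _ x])
    have dK: "(d, K') \<in> J" "h x \<in> K'" "d \<in> A" "h x \<in> fst d"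
      using J d unfolding chart_system_def by (auto 4 3 simp: case_prod_beta dest: spec[of _ "h x"])
    obtain e where e: "w = frame c x *v e" using frame_surj[OF cK(3,4)] .
    have "norm (tangent_matrix A g h x *v w) = norm (frame d (h x) *v chart_deriv h c d x e)"
      unfolding e by (simp add: tangent_matrix_frame[OF dh cK(3,4) dK(3,4)])
    also have "\<dots> \<le> C * norm (chart_deriv h c d x e)" using C(2)[OF dK(1,2)] by blast
    also have "\<dots> \<le> C * (B * norm e)"
      using B(2)[OF cK(1) dK(1) cK(2) dK(2)] C(1) unfolding chart_bound_def by (intro mult_left_mono) auto
    also have "\<dots> \<le> C * (B * (C * norm w))"
      using C(2)[OF cK(1,2), of e] C(1) B(1) unfolding e by (intro mult_left_mono) auto
    finally show ?thesis by (simp add: mult_ac)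
  qed
  moreover have "1 \<le> C * B * C"
    using B(1) C(1) mult_mono[of 1 C 1 B] mult_mono[of 1 "C * B" 1 C] by simp
  ultimately show ?thesis by blast
qed

section \<open>The derivative cocycle of the iterates\<close>

lemma tangent_matrix_funpow_Suc:
  "diff_map A h \<Longrightarrow> tangent_matrix A g (h ^^ Suc n) x = tangent_matrix A g h ((h ^^ n) x) ** tangent_matrix A g (h ^^ n) x"
  using tangent_matrix_comp[OF diff_map_funpow[of h n], of h x] by simp

lemma tangent_matrix_funpow_add:
  "diff_map A h \<Longrightarrow> tangent_matrix A g (h ^^ (m + n)) x = tangent_matrix A g (h ^^ m) ((h ^^ n) x) ** tangent_matrix A g (h ^^ n) x"
  using tangent_matrix_comp[OF diff_map_funpow[of h n] diff_map_funpow[of h m], of x]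
  by (simp add: funpow_add)

lemma tangent_matrix_funpow_le:
  assumes "diff_map A h" "0 \<le> L" and L: "\<And>x w. norm (tangent_matrix A g h x *v w) \<le> L * norm w"
  shows "norm (tangent_matrix A g (h ^^ n) x *v w) \<le> L ^ n * norm w"
proof (induction n)
  case 0
  then show ?case by (simp add: tangent_matrix_id id_def[symmetric])
next
  case (Suc n)
  have "norm (tangent_matrix A g (h ^^ Suc n) x *v w) \<le> L * norm (tangent_matrix A g (h ^^ n) x *v w)"
    unfolding tangent_matrix_funpow_Suc[OF assms(1)] by (simp add: L flip: matrix_vector_mul_assoc)
  also have "\<dots> \<le> L * (L ^ n * norm w)" using Suc assms(2) by (intro mult_left_mono) auto
  finally show ?case by (simp only: power_Suc mult.assoc)
qed

lemma abs_det_funpow_le: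
  assumes h: "diff_map A h" and \<Lambda>: "h ` \<Lambda> \<subseteq> \<Lambda>" and b: "\<And>x. x \<in> \<Lambda> \<Longrightarrow> abs_det A g h x \<le> b" and x: "x \<in> \<Lambda>"
  shows "\<bar>det (tangent_matrix A g (h ^^ n) x)\<bar> \<le> b ^ n"
proof (induction n)
  case 0
  then show ?case by (simp add: tangent_matrix_id id_def[symmetric])
next
  case (Suc n)
  have "(h ^^ n) x \<in> \<Lambda>" using x \<Lambda> by (induction n) auto
  then show ?case
    unfolding tangent_matrix_funpow_Suc[OF h] det_mul abs_mult power_Suc
    using Suc b[of "(h ^^ n) x"] by (intro mult_mono) (auto simp: abs_det_def intro: order_trans[OF abs_ge_zero])
qed

text \<open>One and the same \<open>w\<close> serves for all maps \<open>k\<close>, so the critical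
  direction can be followed through all iterates, forward and backward.\<close>

lemma tangent_norm_map_unit:
  assumes v: "v \<in> unit_tangent A g x"
  obtains w where "norm w = 1"
    "\<And>k. diff_map A k \<Longrightarrow> tangent_norm g (k x) (tangent_map A k x v) = norm (tangent_matrix A g k x *v w)"
proof -
  obtain c where c: "c \<in> A" "x \<in> fst c" using obtain_chart .
  have vc: "v = tangent_of A x c (v c)" and v1: "tangent_norm g x v = 1"
    using v tangent_spaceD[OF _ c] by (auto simp: unit_tangent_def)
  show ?thesis
    using that[of "frame c x *v v c"] vc v1 tangent_norm_tangent_map[OF _ c, of _ "v c"] tangent_norm_frame[OF c, of "v c"]
    by metis
qed

text \<open>The bound \<open>L\<close> only certifies that both suprema are taken over bounded sets;
  without it a real supremum says nothing about its elements.\<close>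

lemma tangent_matrix_le_norm_on:
  assumes h: "diff_map A h" and L: "\<And>x w. norm (tangent_matrix A g h x *v w) \<le> L * norm w" and x: "x \<in> \<Lambda>"
  shows "norm (tangent_matrix A g h x *v w) \<le> tangent_map_norm_on A g h \<Lambda> * norm w"
proof (cases "w = 0")
  case False
  have le: "tangent_norm g (h x) (tangent_map A h x v) \<le> L" if v: "v \<in> unit_tangent A g x" for v x
  proof -
    obtain u where "norm u = 1"
      "tangent_norm g (h x) (tangent_map A h x v) = norm (tangent_matrix A g h x *v u)"
      using tangent_norm_map_unit[OF v] h by metis
    then show ?thesis using L[of x u] by simp
  qed
  have unit: "\<exists>v\<in>unit_tangent A g x. tangent_norm g (h x) (tangent_map A h x v) = norm (tangent_matrix A g h x *v u)"
    if u: "norm u = 1" for u x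
  proof -
    obtain c where c: "c \<in> A" "x \<in> fst c" using obtain_chart .
    obtain e where e: "u = frame c x *v e" using frame_surj[OF c] .
    show ?thesis
      using u tangent_norm_tangent_map[OF h c, of e] unfolding e
      by (intro bexI[of _ "tangent_of A x c e"])
        (auto simp: unit_tangent_def tangent_of_in[OF c] tangent_norm_frame[OF c])
  qed
  have ne: "unit_tangent A g x \<noteq> {}" for x using unit[of "axis 1 1" x] by auto
  have le': "tangent_map_norm A g h x \<le> L" for x
    unfolding tangent_map_norm_def using ne le by (intro cSUP_least) auto
  define u where "u = w /\<^sub>R norm w"
  have u: "norm u = 1" "w = norm w *\<^sub>R u" using False by (auto simp: u_def)
  obtain v where v: "v \<in> unit_tangent A g x" "tangent_norm g (h x) (tangent_map A h x v) = norm (tangent_matrix A g h x *v u)"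
    using unit[OF u(1)] by blast
  have "norm (tangent_matrix A g h x *v u) \<le> tangent_map_norm A g h x"
    unfolding tangent_map_norm_def v(2)[symmetric]
    by (rule cSUP_upper[OF v(1)]) (use le in \<open>auto intro!: bdd_aboveI2\<close>)
  also have "\<dots> \<le> tangent_map_norm_on A g h \<Lambda>"
    unfolding tangent_map_norm_on_def
    by (rule cSUP_upper[OF x]) (use le' in \<open>auto intro!: bdd_aboveI2\<close>)
  finally have "norm w * norm (tangent_matrix A g h x *v u) \<le> norm w * tangent_map_norm_on A g h \<Lambda>"
    by (intro mult_left_mono) auto
  then show ?thesis
    by (subst u(2)) (simp add: matrix_vector_mult_scaleR mult.commute)
qed auto

end

section \<open>Choice of the parameters\<close>

lemma eventually_linear_exp_less:
  assumes "0 < s" "0 < t"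
  shows "\<forall>\<^sub>F k in sequentially. (1 + real k) * exp (- s * real k) < t"
proof -
  have "norm (exp (- s)) < 1" using assms by simp
  then have "(\<lambda>k. exp (- s) ^ k + real k * exp (- s) ^ k) \<longlonglongrightarrow> 0 + 0"
    by (intro tendsto_add LIMSEQ_power_zero powser_times_n_limit_0)
  moreover have "exp (- s) ^ k + real k * exp (- s) ^ k = (1 + real k) * exp (- s * real k)" for k
    by (simp add: algebra_simps flip: exp_of_nat_mult)
  ultimately have "(\<lambda>k. (1 + real k) * exp (- s * real k)) \<longlonglongrightarrow> 0" by simp
  then show ?thesis using assms(2) by (rule order_tendstoD)
qed

text \<open>With \<open>\<rho> = exp (- a k / 4)\<close>, all the smallness conditions hold for large \<open>k\<close>, with \<open>j\<close> a small
  fixed proportion of \<open>k\<close>, as soon as \<open>\<epsilon>\<close> is small with respect to that proportion.\<close>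

lemma eventually_parameters:
  fixes a \<beta> L :: real
  assumes a: "0 < a" and \<beta>: "0 < \<beta>" "\<beta> < 1" and L: "1 < L"
  shows "\<exists>\<epsilon>>0. \<forall>C0 C1 B Cd t. 1 \<le> C0 \<longrightarrow> 1 \<le> C1 \<longrightarrow> 1 \<le> B \<longrightarrow> 0 < Cd \<longrightarrow> 0 < t \<longrightarrow>
    (\<forall>\<^sub>F k in sequentially. \<exists>j. 2 * j \<le> k \<and>
      3 * (C0\<^sup>2 * C1) * exp \<epsilon> ^ k * exp (- a * real k / 4) \<le> t \<and>
      real k * (C0\<^sup>2 * C1) * (B * (3 * (C0\<^sup>2 * C1) * exp \<epsilon> ^ k * exp (- a * real k / 4))) \<le> 1 \<and>
      C0\<^sup>2 * (2 * C1\<^sup>2 * exp \<epsilon> ^ (k - j) * \<beta> ^ j) + 3 * (C0\<^sup>2 * C1)\<^sup>2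
        * (B * (3 * (C0\<^sup>2 * C1) * exp \<epsilon> ^ k * exp (- a * real k / 4))) * real k * exp \<epsilon> ^ k \<le> 1 / 2 \<and>
      L ^ j * (Cd * exp (- a * real k)) \<le> t \<and>
      L ^ j * (Cd * exp (- a * real k)) < exp (- a * real k / 4) / 2 \<and>
      exp (- a * real k) < t)"
proof -
  \<comment> \<open>For \<open>j\<close> about \<open>\<theta> * k\<close>, the factor
    \<open>L ^ j\<close> is at most \<open>exp (a / 2 * k)\<close>. Of the distance
    \<open>exp (- a * k)\<close> two factors \<open>exp (- a * k / 4)\<close> remain: one is the
    radius of the ball, the other a margin that absorbs constants.\<close>
  define \<theta> where "\<theta> = min (1 / 2) (a / (2 * ln L))"
  have lnL: "0 < ln L" using L by simp
  have \<theta>: "0 < \<theta>" "\<theta> \<le> 1 / 2" using a lnL by (auto simp: \<theta>_def)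
  have \<theta>L: "\<theta> * ln L \<le> a / 2"
  proof -
    have "\<theta> * ln L \<le> a / (2 * ln L) * ln L" using lnL by (intro mult_right_mono) (auto simp: \<theta>_def)
    then show ?thesis using lnL by simp
  qed
  define \<gamma> where "\<gamma> = - \<theta> * ln \<beta>"
  have \<gamma>: "0 < \<gamma>" using \<theta>(1) \<beta> by (simp add: \<gamma>_def mult_pos_neg)
  \<comment> \<open>\<gamma> is the decay rate in \<open>k\<close> of \<open>\<beta> ^ j\<close>.
    Half of it leaves a net contraction; \<open>a / 32\<close> lets the radius absorb
    \<open>exp \<epsilon> ^ k\<close>, which enters the error term twice.\<close>
  define \<epsilon> where "\<epsilon> = min (\<gamma> / 2) (a / 32)"
  have \<epsilon>: "0 < \<epsilon>" "\<epsilon> \<le> \<gamma> / 2" "\<epsilon> \<le> a / 32" using \<gamma> a by (auto simp: \<epsilon>_def)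
  \<comment> \<open>A common lower bound for all decay rates below, so that the single quantity
    \<open>E\<close>, with its factor linear in \<open>k\<close>, dominates every term.\<close>
  define s where "s = min (\<gamma> / 2) (a / 16)"
  have s: "0 < s" "s \<le> \<gamma> / 2" "s \<le> a / 16" using \<gamma> a by (auto simp: s_def)
  have *: "\<exists>j. 2 * j \<le> k \<and>
      3 * (C0\<^sup>2 * C1) * exp \<epsilon> ^ k * exp (- a * real k / 4) \<le> t \<and>
      real k * (C0\<^sup>2 * C1) * (B * (3 * (C0\<^sup>2 * C1) * exp \<epsilon> ^ k * exp (- a * real k / 4))) \<le> 1 \<and>
      C0\<^sup>2 * (2 * C1\<^sup>2 * exp \<epsilon> ^ (k - j) * \<beta> ^ j) + 3 * (C0\<^sup>2 * C1)\<^sup>2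
        * (B * (3 * (C0\<^sup>2 * C1) * exp \<epsilon> ^ k * exp (- a * real k / 4))) * real k * exp \<epsilon> ^ k \<le> 1 / 2 \<and>
      L ^ j * (Cd * exp (- a * real k)) \<le> t \<and>
      L ^ j * (Cd * exp (- a * real k)) < exp (- a * real k / 4) / 2 \<and>
      exp (- a * real k) < t"
    if pos: "1 \<le> C0" "1 \<le> C1" "1 \<le> B" "0 < Cd" "0 < t"
      and E: "E = (1 + real k) * exp (- s * real k)" and C: "C = C0\<^sup>2 * C1"
      and small: "E < t / (3 * C)" "E < 1 / (3 * C\<^sup>2 * B)" "E < \<beta> / (8 * C0\<^sup>2 * C1\<^sup>2)"
        "E < 1 / (36 * C ^ 3 * B)" "E < t / Cd" "E < 1 / (2 * Cd)" "E < t"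
    for C0 C1 B Cd t E C :: real and k
  proof -
    define j where "j = nat \<lfloor>\<theta> * real k\<rfloor>"
    have "0 \<le> \<theta> * real k" using \<theta> by simp
    then have j: "real j \<le> \<theta> * real k" "\<theta> * real k - 1 \<le> real j" unfolding j_def by linarith+
    have "\<theta> * real k \<le> 1 / 2 * real k" using \<theta> by (intro mult_right_mono) auto
    then have jk: "2 * j \<le> k" using j(1) by linarith
    have C1': "1 \<le> C" using pos mult_mono[of 1 "C0\<^sup>2" 1 C1] one_le_power[of C0 2] by (simp add: C)
    have q: "exp \<epsilon> ^ n = exp (\<epsilon> * real n)" for n by (simp add: exp_of_nat2_mult)
    have kE: "exp (- u * real k) \<le> E" "real k * exp (- u * real k) \<le> E" if "s \<le> u" for u
    proof -
      have le: "exp (- u * real k) \<le> exp (- s * real k)"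
        using that by (simp add: mult_right_mono)
      show "exp (- u * real k) \<le> E"
        unfolding E using mult_mono[of 1 "1 + real k" "exp (- u * real k)" "exp (- s * real k)"] le by simp
      show "real k * exp (- u * real k) \<le> E"
        unfolding E using le by (intro mult_mono) auto
    qed
    define X where "X = exp \<epsilon> ^ k * exp (- a * real k / 4)"
    have X: "X = exp (- (a / 4 - \<epsilon>) * real k)"
      unfolding X_def q by (simp add: algebra_simps flip: exp_add)
    have XE: "X \<le> E" "real k * X \<le> E"
      unfolding X using kE[of "a / 4 - \<epsilon>"] s \<epsilon> a by auto
    have Xq: "real k * (X * exp \<epsilon> ^ k) \<le> E"
    proof -
      have "X * exp \<epsilon> ^ k = exp (- (a / 4 - 2 * \<epsilon>) * real k)"
        unfolding X q by (simp add: algebra_simps flip: exp_add)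
      then show ?thesis using kE(2)[of "a / 4 - 2 * \<epsilon>"] s \<epsilon> a by auto
    qed
    have 1: "3 * C * X \<le> t"
    proof -
      have "3 * C * X \<le> 3 * C * E" using XE C1' by (intro mult_left_mono) auto
      also have "\<dots> \<le> t" using small(1) C1' by (simp add: pos_less_divide_eq mult_ac)
      finally show ?thesis .
    qed
    have 2: "real k * C * (B * (3 * C * X)) \<le> 1"
    proof -
      have "real k * C * (B * (3 * C * X)) = 3 * C\<^sup>2 * B * (real k * X)"
        by (simp add: power2_eq_square)
      also have "\<dots> \<le> 3 * C\<^sup>2 * B * E" using XE pos by (intro mult_left_mono) auto
      also have "\<dots> \<le> 1" using small(2) C1' pos by (simp add: pos_less_divide_eq mult_ac)
      finally show ?thesis .
    qed
    have 3: "C0\<^sup>2 * (2 * C1\<^sup>2 * exp \<epsilon> ^ (k - j) * \<beta> ^ j) \<le> 1 / 4"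
    proof -
      have "\<beta> ^ j = exp (real j * ln \<beta>)" using \<beta> by (simp add: exp_of_nat_mult)
      \<comment> \<open>Rounding \<open>j\<close> down loses at most one step, whence the factor
        \<open>1 / \<beta>\<close>; the inequality is reversed as \<open>ln \<beta>\<close> is
        negative.\<close>
      also have "real j * ln \<beta> \<le> (\<theta> * real k - 1) * ln \<beta>"
        using j(2) \<beta> by (intro mult_right_mono_neg) auto
      also have "\<dots> = - \<gamma> * real k - ln \<beta>" by (simp add: \<gamma>_def algebra_simps)
      finally have "\<beta> ^ j \<le> exp (- \<gamma> * real k) / \<beta>" using \<beta> by (simp add: exp_diff)
      moreover have "exp \<epsilon> ^ (k - j) \<le> exp \<epsilon> ^ k" using \<epsilon> by (intro power_increasing) auto
      ultimately have "exp \<epsilon> ^ (k - j) * \<beta> ^ j \<le> exp \<epsilon> ^ k * (exp (- \<gamma> * real k) / \<beta>)"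
        using \<beta> by (intro mult_mono) auto
      also have "\<dots> = exp (- (\<gamma> - \<epsilon>) * real k) / \<beta>"
        unfolding q by (simp add: algebra_simps flip: exp_add)
      also have "\<dots> \<le> E / \<beta>" using kE(1)[of "\<gamma> - \<epsilon>"] s \<epsilon> \<beta> by (intro divide_right_mono) auto
      finally have "C0\<^sup>2 * (2 * C1\<^sup>2 * (exp \<epsilon> ^ (k - j) * \<beta> ^ j)) \<le> C0\<^sup>2 * (2 * C1\<^sup>2 * (E / \<beta>))"
        by (intro mult_left_mono) auto
      also have "\<dots> \<le> 1 / 4" using small(3) \<beta> pos by (simp add: field_simps)
      finally show ?thesis by (simp add: mult.assoc)
    qed
    have 4: "3 * C\<^sup>2 * (B * (3 * C * X)) * real k * exp \<epsilon> ^ k \<le> 1 / 4"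
    proof -
      have "3 * C\<^sup>2 * (B * (3 * C * X)) * real k * exp \<epsilon> ^ k = 9 * C ^ 3 * B * (real k * (X * exp \<epsilon> ^ k))"
        by (simp add: power2_eq_square power3_eq_cube)
      also have "\<dots> \<le> 9 * C ^ 3 * B * E" using Xq pos C1' by (intro mult_left_mono) auto
      also have "\<dots> \<le> 1 / 4" using small(4) C1' pos by (simp add: pos_less_divide_eq mult_ac)
      finally show ?thesis .
    qed
    have Lj: "L ^ j * (Cd * exp (- a * real k)) \<le> Cd * E * exp (- a * real k / 4)"
    proof -
      have "L ^ j = exp (real j * ln L)" using L by (simp add: exp_of_nat_mult)
      also have "real j * ln L \<le> \<theta> * real k * ln L" using j(1) lnL by (intro mult_right_mono) auto
      also have "\<dots> \<le> a / 2 * real k" using mult_right_mono[OF \<theta>L, of "real k"] by (simp add: mult_ac)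
      finally have "L ^ j \<le> exp (a / 2 * real k)" by simp
      then have "L ^ j * (Cd * exp (- a * real k)) \<le> exp (a / 2 * real k) * (Cd * exp (- a * real k))"
        using pos by (intro mult_right_mono) auto
      also have "\<dots> = Cd * exp (- (a / 4) * real k) * exp (- a * real k / 4)"
        by (simp add: mult_ac flip: exp_add)
      also have "\<dots> \<le> Cd * E * exp (- a * real k / 4)"
        using kE(1)[of "a / 4"] s a pos by (intro mult_right_mono mult_left_mono) auto
      finally show ?thesis .
    qed
    have 5: "Cd * E * exp (- a * real k / 4) < exp (- a * real k / 4) / 2"
      using small(6) pos by (simp add: pos_less_divide_eq mult_ac)
    have 6: "Cd * E * exp (- a * real k / 4) \<le> t"
    proof -
      have E0: "0 \<le> E" by (simp add: E)
      have "Cd * E * exp (- a * real k / 4) \<le> Cd * E * 1"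
        using a pos E0 by (intro mult_left_mono) auto
      also have "\<dots> \<le> t" using small(5) pos by (simp add: pos_less_divide_eq mult_ac)
      finally show ?thesis .
    qed
    have 7: "exp (- a * real k) < t" using kE(1)[of a] s a small(7) by auto
    have X_eq: "3 * C * exp \<epsilon> ^ k * exp (- a * real k / 4) = 3 * C * X"
      by (simp add: X_def)
    show ?thesis
      unfolding C[symmetric] X_eq
    proof (intro exI[of _ j] conjI jk 1 2 7)
      show "C0\<^sup>2 * (2 * C1\<^sup>2 * exp \<epsilon> ^ (k - j) * \<beta> ^ j)
          + 3 * C\<^sup>2 * (B * (3 * C * X)) * real k * exp \<epsilon> ^ k \<le> 1 / 2"
        using 3 4 by linarith
      show "L ^ j * (Cd * exp (- a * real k)) \<le> t" using Lj 6 by (rule order_trans)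
      show "L ^ j * (Cd * exp (- a * real k)) < exp (- a * real k / 4) / 2" using Lj 5 by (rule le_less_trans)
    qed
  qed
  show ?thesis
  proof (intro exI[of _ \<epsilon>] conjI \<epsilon>(1) allI impI)
    fix C0 C1 B Cd t :: real
    assume pos: "1 \<le> C0" "1 \<le> C1" "1 \<le> B" "0 < Cd" "0 < t"
    define C where "C = C0\<^sup>2 * C1"
    define E where "E k = (1 + real k) * exp (- s * real k)" for k
    have "0 < C" using pos by (simp add: C_def)
    then have thresholds: "0 < t / (3 * C)" "0 < 1 / (3 * C\<^sup>2 * B)" "0 < \<beta> / (8 * C0\<^sup>2 * C1\<^sup>2)"
        "0 < 1 / (36 * C ^ 3 * B)" "0 < t / Cd" "0 < 1 / (2 * Cd)"
      using pos \<beta> by auto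
    have ev: "\<forall>\<^sub>F k in sequentially. E k < u" if "0 < u" for u
      unfolding E_def using eventually_linear_exp_less[OF s(1) that] .
    show "\<forall>\<^sub>F k in sequentially. \<exists>j. 2 * j \<le> k \<and>
      3 * (C0\<^sup>2 * C1) * exp \<epsilon> ^ k * exp (- a * real k / 4) \<le> t \<and>
      real k * (C0\<^sup>2 * C1) * (B * (3 * (C0\<^sup>2 * C1) * exp \<epsilon> ^ k * exp (- a * real k / 4))) \<le> 1 \<and>
      C0\<^sup>2 * (2 * C1\<^sup>2 * exp \<epsilon> ^ (k - j) * \<beta> ^ j) + 3 * (C0\<^sup>2 * C1)\<^sup>2
        * (B * (3 * (C0\<^sup>2 * C1) * exp \<epsilon> ^ k * exp (- a * real k / 4))) * real k * exp \<epsilon> ^ k \<le> 1 / 2 \<and>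
      L ^ j * (Cd * exp (- a * real k)) \<le> t \<and>
      L ^ j * (Cd * exp (- a * real k)) < exp (- a * real k / 4) / 2 \<and>
      exp (- a * real k) < t"
      using ev[OF thresholds(1)] ev[OF thresholds(2)] ev[OF thresholds(3)] ev[OF thresholds(4)]
        ev[OF thresholds(5)] ev[OF thresholds(6)] ev[OF pos(5)]
    proof eventually_elim
      case (elim k)
      show ?case
        by (rule *[OF pos E_def C_def elim])
    qed
  qed
qed

section \<open>Recurrence and growth rates as explicit bounds\<close>

lemma exp_recurrence:
  fixes d :: "nat \<Rightarrow> ennreal"
  assumes "liminf (\<lambda>k. ereal (1 / real k) * elog (d k)) < 0"
  obtains a where "0 < a" "\<exists>\<^sub>F k in sequentially. 0 < k \<and> d k \<le> ennreal (exp (- a * real k))"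
proof -
  obtain b where b: "liminf (\<lambda>k. ereal (1 / real k) * elog (d k)) < ereal b" "ereal b < 0"
    using assms ereal_dense2 by blast
  have le: "d k \<le> ennreal (exp (- (- b) * real k))"
    if k: "0 < k" "\<not> ereal b \<le> ereal (1 / real k) * elog (d k)" for k
  proof -
    \<comment> \<open>A vanishing distance, as for periodic \<open>c\<close>, satisfies any
      exponential bound; an infinite one contradicts the negative upper bound on its
      logarithm.\<close>
    consider "d k = 0" | "d k = \<infinity>" | "d k \<noteq> 0" "d k \<noteq> \<infinity>" by blast
    then show ?thesis
    proof cases
      case 3
      then obtain x where x: "d k = ennreal x" "0 < x"
        by (cases "d k") (auto simp: le_less)
      then have "ln x / real k < b" using k by (auto simp: elog_def)
      then have "ln x < b * real k" using k(1) by (simp add: divide_less_eq)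
      then have "x < exp (b * real k)" using x(2) by (metis exp_less_mono exp_ln)
      then show ?thesis using x by (simp add: ennreal_leI)
    qed (use k in \<open>auto simp: elog_def\<close>)
  qed
  have "\<exists>\<^sub>F k in sequentially. \<not> ereal b \<le> ereal (1 / real k) * elog (d k)"
    using b(1) Liminf_bounded[of "ereal b" "\<lambda>k. ereal (1 / real k) * elog (d k)" sequentially]
    unfolding frequently_def not_not by (meson not_le)
  then have "\<exists>\<^sub>F k in sequentially. 0 < k \<and> \<not> ereal b \<le> ereal (1 / real k) * elog (d k)"
    using frequently_eventually_conj[OF _ eventually_gt_at_top[of 0]] by blast
  then have "\<exists>\<^sub>F k in sequentially. 0 < k \<and> d k \<le> ennreal (exp (- (- b) * real k))"
    by (rule frequently_elim1) (use le in blast)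
  then show ?thesis using that[of "- b"] b(2) by simp
qed

lemma subexponential_bound:
  fixes N :: "nat \<Rightarrow> real"
  assumes "limsup (\<lambda>k. ereal (1 / real k * ln (N k))) \<le> 0" "0 < \<epsilon>"
  shows "\<forall>\<^sub>F k in sequentially. N k \<le> exp \<epsilon> ^ k"
proof -
  have "limsup (\<lambda>k. ereal (1 / real k * ln (N k))) < ereal \<epsilon>"
    using assms by (meson ereal_less(2) le_less_trans)
  from Limsup_lessD[OF this] eventually_gt_at_top[of 0] show ?thesis
  proof eventually_elim
    case (elim k)
    then have "ln (N k) < \<epsilon> * real k" by (simp add: divide_less_eq)
    show ?case
    \<comment> \<open>The logarithm carries information only for positive \<open>N k\<close>;
      otherwise the bound is trivial.\<close>
    proof (cases "N k > 0")
      case True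
      then have "N k < exp (\<epsilon> * real k)"
        using \<open>ln (N k) < \<epsilon> * real k\<close> by (metis exp_less_mono exp_ln)
      then show ?thesis by (simp add: exp_of_nat2_mult)
    next
      case False
      then show ?thesis by (meson exp_ge_zero le_less_linear order_trans zero_le_power)
    qed
  qed
qed

context compact_riemannian_surface
begin

text \<open>One step multiplies the chart distance by at most \<open>2 * B\<close>: the linear part
  gives \<open>B\<close>, and the second-order error gives at most \<open>B\<close> again since the
  radius is at most \<open>1\<close>. The hypothesis \<open>small\<close> keeps every distance up to
  time \<open>j\<close> within the range of the Taylor bound.\<close>

lemma chart_dist_funpow_le:
  assumes J: "chart_system J \<sigma> r0"
    and cb: "\<And>c K d K' x. (c, K) \<in> J \<Longrightarrow> (d, K') \<in> J \<Longrightarrow> x \<in> K \<Longrightarrow> h x \<in> K' \<Longrightarrow> chart_bound h c d x r B"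
    and rB: "r \<le> 1" "1 \<le> B" and w: "w \<in> fst (fst (\<sigma> x))"
    and small: "(2 * B) ^ j * norm (snd (fst (\<sigma> x)) w - snd (fst (\<sigma> x)) x) \<le> r"
  shows "n \<le> j \<Longrightarrow> (h ^^ n) w \<in> fst (fst (\<sigma> ((h ^^ n) x))) \<and>
    norm (snd (fst (\<sigma> ((h ^^ n) x))) ((h ^^ n) w) - snd (fst (\<sigma> ((h ^^ n) x))) ((h ^^ n) x))
      \<le> (2 * B) ^ n * norm (snd (fst (\<sigma> x)) w - snd (fst (\<sigma> x)) x)"
proof (induction n)
  case 0
  then show ?case using w by simp
next
  case (Suc n)
  let ?\<delta> = "norm (snd (fst (\<sigma> x)) w - snd (fst (\<sigma> x)) x)"
  define x' w' where "x' = (h ^^ n) x" and "w' = (h ^^ n) w"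
  define c d where "c = fst (\<sigma> x')" and "d = fst (\<sigma> (h x'))"
  have c: "(c, snd (\<sigma> x')) \<in> J" "x' \<in> snd (\<sigma> x')" "c \<in> A" "x' \<in> fst c"
    using J unfolding chart_system_def c_def by (auto simp: case_prod_beta)
  have d: "(d, snd (\<sigma> (h x'))) \<in> J" "h x' \<in> snd (\<sigma> (h x'))" "d \<in> A" "h x' \<in> fst d"
    using J unfolding chart_system_def d_def by (auto simp: case_prod_beta)
  have IH: "w' \<in> fst c" "norm (snd c w' - snd c x') \<le> (2 * B) ^ n * ?\<delta>"
    using Suc by (auto simp: c_def x'_def w'_def)
  define R where "R = norm (snd c w' - snd c x')"
  have "(2 * B) ^ n * ?\<delta> \<le> (2 * B) ^ j * ?\<delta>"
    using Suc.prems rB by (intro mult_right_mono power_increasing) auto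
  then have R: "R \<le> r" "0 \<le> R" using IH small by (auto simp: R_def)
  note cb' = cb[OF c(1) d(1) c(2) d(2)]
  have "snd c w' \<in> cball (snd c x') r"
    using R by (simp add: R_def dist_norm norm_minus_commute)
  then have "snd c w' \<in> snd c ` (fst c \<inter> h -` fst d)"
    using cb' unfolding chart_bound_def by blast
  then obtain x where x: "x \<in> fst c" "h x \<in> fst d" "snd c w' = snd c x" by auto
  have "x = w'"
    using x(3) chart_inv_left[OF c(3) x(1)] chart_inv_left[OF c(3) IH(1)] by simp
  then have hw: "h w' \<in> fst d" using x(2) by simp
  let ?F = "snd d \<circ> h \<circ> chart_inv c"
  have "\<forall>R\<le>r. \<forall>z\<in>cball (snd c x') R. \<forall>z'\<in>cball (snd c x') R.
       norm (?F z - ?F z' - chart_deriv h c d x' (z - z')) \<le> B * R * norm (z - z')"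
    using cb' unfolding chart_bound_def by (elim conjE)
  then have "norm (?F (snd c w') - ?F (snd c x') - chart_deriv h c d x' (snd c w' - snd c x')) \<le> B * R * R"
    using R by (auto simp: R_def dist_norm norm_minus_commute)
  moreover have "?F (snd c w') = snd d (h w')" "?F (snd c x') = snd d (h x')"
    using IH(1) c by (simp_all add: chart_inv_left)
  moreover have "norm (chart_deriv h c d x' (snd c w' - snd c x')) \<le> B * R"
    using cb' unfolding chart_bound_def R_def by blast
  ultimately have "norm (snd d (h w') - snd d (h x')) \<le> B * R * R + B * R"
    using norm_triangle_sub[of "snd d (h w') - snd d (h x')" "chart_deriv h c d x' (snd c w' - snd c x')"] by simp
  also have "B * R * R \<le> B * R * 1" using R rB by (intro mult_left_mono) auto
  finally have "norm (snd d (h w') - snd d (h x')) \<le> 2 * B * R" by simp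
  also have "\<dots> \<le> 2 * B * ((2 * B) ^ n * ?\<delta>)" using IH(2) rB by (intro mult_left_mono) (auto simp: R_def)
  finally show ?case using hw by (simp add: d_def x'_def w'_def mult_ac)
qed

section \<open>Sinks\<close>

lemma sink_of_recurrent_critical_point:
  fixes f :: "'a \<Rightarrow> 'a"
  assumes diffeo: "ck_diffeo 2 A f" and \<Lambda>: "compact \<Lambda>" "f ` \<Lambda> = \<Lambda>" and dis: "dissipative A g f \<Lambda>"
    and growth: "limsup (\<lambda>k. ereal (1 / real k * ln (tangent_map_norm_on A g (f ^^ k) \<Lambda>))) \<le> 0"
    and crit: "c \<in> Crit A g f \<Lambda>"
    and rec: "liminf (\<lambda>k. ereal (1 / real k) * elog (rdist A g ((f ^^ k) c) c)) < 0"
  shows "\<exists>p\<in>\<Lambda>. is_sink A g f p"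
proof -
  have f2: "ck_map 2 A f" "ck_map 2 A (inv f)" and bij: "bij f" using diffeo by (auto simp: ck_diffeo_def)
  have f: "diff_map A f" and fi: "diff_map A (inv f)"
    using f2 ck_map_imp_diff_map[of 1] by (auto simp: numeral_2_eq_2)
  have inv: "f (inv f x) = x" "inv f (f x) = x" for x
    using bij by (simp_all add: bij_is_surj surj_f_inv_f bij_is_inj)
  have inv_pow: "(f ^^ n) ((inv f ^^ n) x) = x" for n x
    by (induction n arbitrary: x) (simp_all add: inv funpow_swap1)
  have inv_comm: "(f ^^ m) ((inv f ^^ n) x) = (inv f ^^ n) ((f ^^ m) x)" for m n x
  proof -
    have "f ((inv f ^^ n) x) = (inv f ^^ n) (f x)" for x
    proof (induction n)
      case (Suc n)
      have "(inv f ^^ Suc n) (f x) = inv f (f ((inv f ^^ n) x))" using Suc by simp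
      then show ?case by (simp add: inv)
    qed simp
    then show ?thesis by (induction m) simp_all
  qed
  have pow_\<Lambda>: "(f ^^ n) x \<in> \<Lambda>" if "x \<in> \<Lambda>" for n x using that \<Lambda>(2) by (induction n) auto
  have inv_\<Lambda>: "(inv f ^^ n) x \<in> \<Lambda>" if "x \<in> \<Lambda>" for n x
  proof (induction n)
    case (Suc n)
    then obtain z where "z \<in> \<Lambda>" "(inv f ^^ n) x = f z" using \<Lambda>(2) by blast
    then show ?case by (simp add: inv)
  qed (use that in simp)
  obtain v where c: "c \<in> \<Lambda>" and v: "v \<in> unit_tangent A g c" "\<And>n. proj_deriv A g f n c v \<ge> 1"
    using crit by (auto simp: Crit_def)
  obtain w where w: "norm w = 1" and vw: "\<And>k. diff_map A k \<Longrightarrow>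
      tangent_norm g (k c) (tangent_map A k c v) = norm (tangent_matrix A g k c *v w)"
    using tangent_norm_map_unit[OF v(1)] by metis
  \<comment> \<open>Criticality with the denominator cleared; where the norm vanishes, the
    inequality is trivial.\<close>
  have crit_le: "(norm (tangent_matrix A g (int_iter f n) c *v w))\<^sup>2 \<le> \<bar>det (tangent_matrix A g (int_iter f n) c)\<bar>" for n
  proof -
    have "diff_map A (int_iter f n)" by (simp add: int_iter_def diff_map_funpow f fi)
    then have "1 \<le> \<bar>det (tangent_matrix A g (int_iter f n) c)\<bar> / (norm (tangent_matrix A g (int_iter f n) c *v w))\<^sup>2"
      using v(2)[of n] vw by (simp add: proj_deriv_def abs_det_def)
    then show ?thesis by (cases "norm (tangent_matrix A g (int_iter f n) c *v w) = 0") (simp_all add: le_divide_eq)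
  qed
  have crit_fwd: "(norm (tangent_matrix A g (f ^^ n) c *v w))\<^sup>2 \<le> \<bar>det (tangent_matrix A g (f ^^ n) c)\<bar>" for n
    using crit_le[of "int n"] by (simp add: int_iter_def)
  have crit_bwd: "(norm (tangent_matrix A g (inv f ^^ n) c *v w))\<^sup>2 \<le> \<bar>det (tangent_matrix A g (inv f ^^ n) c)\<bar>" for n
  proof -
    have "int_iter f (- int n) = inv f ^^ n" by (cases "n = 0") (auto simp: int_iter_def)
    then show ?thesis using crit_le[of "- int n"] by simp
  qed

  obtain b where b: "0 < b" "b < 1" "\<And>x. x \<in> \<Lambda> \<Longrightarrow> abs_det A g f x \<le> b"
  proof -
    have "continuous_on \<Lambda> (abs_det A g f)"
      using continuous_on_subset[OF continuous_on_abs_det[of 1 f]] f2 by (simp add: numeral_2_eq_2)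
    then obtain m where m: "m \<in> \<Lambda>" "\<And>x. x \<in> \<Lambda> \<Longrightarrow> abs_det A g f x \<le> abs_det A g f m"
      using continuous_attains_sup[OF \<Lambda>(1)] c by blast
    show ?thesis
    \<comment> \<open>The maximum with \<open>1 / 2\<close> keeps the rate positive, as its
      logarithm is needed later.\<close>
    proof (rule that[of "max (1 / 2) (abs_det A g f m)"])
      show "max (1 / 2) (abs_det A g f m) < 1" using m(1) dis by (simp add: dissipative_def)
      show "abs_det A g f x \<le> max (1 / 2) (abs_det A g f m)" if "x \<in> \<Lambda>" for x
        using m(2)[OF that] by (rule max.coboundedI2)
    qed (simp add: less_max_iff_disj)
  qed
  \<comment> \<open>Criticality contributes square roots of Jacobians, so \<beta> is the contraction
    rate that can be used.\<close>
  define \<beta> where "\<beta> = sqrt b"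
  have \<beta>: "0 < \<beta>" "\<beta> < 1" using b by (auto simp: \<beta>_def)
  have det_le: "sqrt \<bar>det (tangent_matrix A g (f ^^ n) x)\<bar> \<le> \<beta> ^ n" if "x \<in> \<Lambda>" for n x
    using abs_det_funpow_le[OF f _ b(3) that, of n] \<Lambda>(2) by (simp add: \<beta>_def flip: real_sqrt_power)

  obtain J \<sigma> r0 where J: "chart_system J \<sigma> r0" using chart_system_exists by blast
  have \<sigma>: "(fst (\<sigma> x), snd (\<sigma> x)) \<in> J" "x \<in> snd (\<sigma> x)" "fst (\<sigma> x) \<in> A" "snd (\<sigma> x) \<subseteq> fst (fst (\<sigma> x))" "x \<in> fst (fst (\<sigma> x))"
      "cball (snd (fst (\<sigma> x)) x) r0 \<subseteq> snd (fst (\<sigma> x)) ` snd (\<sigma> x)" for x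
    using J unfolding chart_system_def by (auto simp: case_prod_beta)
  have r0: "0 < r0" using J by (simp add: chart_system_def)
  obtain r1 B1 where r1: "0 < r1" "1 \<le> B1" and cb1: "\<And>c K d K' x. (c, K) \<in> J \<Longrightarrow> (d, K') \<in> J \<Longrightarrow> x \<in> K \<Longrightarrow>
      f x \<in> K' \<Longrightarrow> chart_bound f c d x r1 B1"
    using uniform_chart_bound[OF f2(1) J] by blast
  obtain r2 B2 where r2: "0 < r2" "1 \<le> B2" and cb2: "\<And>c K d K' x. (c, K) \<in> J \<Longrightarrow> (d, K') \<in> J \<Longrightarrow> x \<in> K \<Longrightarrow>
      inv f x \<in> K' \<Longrightarrow> chart_bound (inv f) c d x r2 B2"
    using uniform_chart_bound[OF f2(2) J] by blast
  obtain C0 where C0: "1 \<le> C0" "\<And>c K x e. (c, K) \<in> J \<Longrightarrow> x \<in> K \<Longrightarrow>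
      norm (frame c x *v e) \<le> C0 * norm e \<and> norm e \<le> C0 * norm (frame c x *v e)"
    using uniform_frame_bound[OF J] by blast
  obtain \<delta> Cd where \<delta>: "0 < \<delta>" "0 < Cd" "\<And>x. rdist A g x c < ennreal \<delta> \<Longrightarrow> x \<in> fst (fst (\<sigma> c)) \<and>
      ennreal (norm (snd (fst (\<sigma> c)) x - snd (fst (\<sigma> c)) c) / Cd) \<le> rdist A g x c"
    using chart_dist_le_rdist[OF \<sigma>(3) \<sigma>(5), of c] by blast
  obtain a where a: "0 < a" and freq: "\<exists>\<^sub>F k in sequentially. 0 < k \<and> rdist A g ((f ^^ k) c) c \<le> ennreal (exp (- a * real k))"
    using exp_recurrence[OF rec] .

  \<comment> \<open>\<open>2 * B2\<close> bounds the expansion of small chart distances under one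
    step of \<open>inv f\<close>.\<close>
  have "1 < 2 * B2" using r2 by simp
  then obtain \<epsilon> where \<epsilon>: "0 < \<epsilon>" and params: "\<And>C0 C1 B Cd t. 1 \<le> C0 \<Longrightarrow> 1 \<le> C1 \<Longrightarrow> 1 \<le> B \<Longrightarrow> 0 < Cd \<Longrightarrow> 0 < t \<Longrightarrow>
    (\<forall>\<^sub>F k in sequentially. \<exists>j. 2 * j \<le> k \<and>
      3 * (C0\<^sup>2 * C1) * exp \<epsilon> ^ k * exp (- a * real k / 4) \<le> t \<and>
      real k * (C0\<^sup>2 * C1) * (B * (3 * (C0\<^sup>2 * C1) * exp \<epsilon> ^ k * exp (- a * real k / 4))) \<le> 1 \<and>
      C0\<^sup>2 * (2 * C1\<^sup>2 * exp \<epsilon> ^ (k - j) * \<beta> ^ j) + 3 * (C0\<^sup>2 * C1)\<^sup>2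
        * (B * (3 * (C0\<^sup>2 * C1) * exp \<epsilon> ^ k * exp (- a * real k / 4))) * real k * exp \<epsilon> ^ k \<le> 1 / 2 \<and>
      (2 * B2) ^ j * (Cd * exp (- a * real k)) \<le> t \<and>
      (2 * B2) ^ j * (Cd * exp (- a * real k)) < exp (- a * real k / 4) / 2 \<and>
      exp (- a * real k) < t)"
    using eventually_parameters[OF a \<beta>, of "2 * B2"] by blast

  obtain Lf where Lf: "1 \<le> Lf" "\<And>x w. norm (tangent_matrix A g f x *v w) \<le> Lf * norm w"
    using tangent_matrix_bounded[OF f2(1)] by blast
  have Lfn: "norm (tangent_matrix A g (f ^^ n) x *v w) \<le> Lf ^ n * norm w" for n x w
    using Lf by (intro tangent_matrix_funpow_le[OF f]) auto
  obtain N where N: "\<And>n. N \<le> n \<Longrightarrow> tangent_map_norm_on A g (f ^^ n) \<Lambda> \<le> exp \<epsilon> ^ n"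
    using subexponential_bound[OF growth \<epsilon>] by (auto simp: eventually_sequentially)
  \<comment> \<open>Absorbs the times before \<open>N\<close>, when the subexponential bound is not
    yet available.\<close>
  define C1 where "C1 = Lf ^ N"
  have C1: "1 \<le> C1" using Lf by (simp add: C1_def)
  define q where "q = exp \<epsilon>"
  have q: "1 \<le> q" using \<epsilon> by (simp add: q_def)
  have sub: "norm (tangent_matrix A g (f ^^ n) x *v w) \<le> C1 * q ^ n * norm w" if x: "x \<in> \<Lambda>" for n x w
  proof (cases "N \<le> n")
    case True
    have "norm (tangent_matrix A g (f ^^ n) x *v w) \<le> tangent_map_norm_on A g (f ^^ n) \<Lambda> * norm w"
      using tangent_matrix_le_norm_on[OF diff_map_funpow[OF f] Lfn x] .
    also have "\<dots> \<le> 1 * q ^ n * norm w" using N[OF True] by (intro mult_right_mono) (auto simp: q_def)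
    also have "\<dots> \<le> C1 * q ^ n * norm w" using C1 q by (intro mult_right_mono) auto
    finally show ?thesis .
  next
    case False
    have "Lf ^ n * 1 \<le> C1 * q ^ n"
      unfolding C1_def using Lf False q by (intro mult_mono power_increasing) auto
    then show ?thesis
      using Lfn[of n x w] mult_right_mono[of "Lf ^ n" "C1 * q ^ n" "norm w"] by auto
  qed

  define t where "t = Min {r1, r2, r0, \<delta>, 1}"
  have t: "0 < t" "t \<le> r1" "t \<le> r2" "t \<le> r0" "t \<le> \<delta>" "t \<le> 1"
    using r0 r1 r2 \<delta> by (auto simp: t_def)
  \<comment> \<open>Recurrence holds at infinitely many times and the smallness conditions at all
    large ones, so some \<open>k\<close> satisfies both.\<close>
  obtain k j where k: "0 < k" "rdist A g ((f ^^ k) c) c \<le> ennreal (exp (- a * real k))" and jk: "2 * j \<le> k"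
    and R: "3 * (C0\<^sup>2 * C1) * q ^ k * exp (- a * real k / 4) \<le> t"
      "real k * (C0\<^sup>2 * C1) * (B1 * (3 * (C0\<^sup>2 * C1) * q ^ k * exp (- a * real k / 4))) \<le> 1"
    and contr: "C0\<^sup>2 * (2 * C1\<^sup>2 * q ^ (k - j) * \<beta> ^ j) + 3 * (C0\<^sup>2 * C1)\<^sup>2
        * (B1 * (3 * (C0\<^sup>2 * C1) * q ^ k * exp (- a * real k / 4))) * real k * q ^ k \<le> 1 / 2"
    and close: "(2 * B2) ^ j * (Cd * exp (- a * real k)) \<le> t"
      "(2 * B2) ^ j * (Cd * exp (- a * real k)) < exp (- a * real k / 4) / 2"
    and "exp (- a * real k) < t"
    using frequently_eventually_conj[OF freq params[OF C0(1) C1 r1(2) \<delta>(2) t(1)]]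
    unfolding q_def[symmetric] by (auto dest!: frequently_ex)

  define y where "y = (inv f ^^ j) c"
  have y: "y \<in> \<Lambda>" unfolding y_def using c by (rule inv_\<Lambda>)
  have fy: "(f ^^ j) y = c" by (simp add: y_def inv_pow)
  let ?\<phi> = "snd (fst (\<sigma> y))"
  let ?dc = "norm (snd (fst (\<sigma> c)) ((f ^^ k) c) - snd (fst (\<sigma> c)) c)"
  have "rdist A g ((f ^^ k) c) c < ennreal \<delta>"
    using k(2) \<open>exp (- a * real k) < t\<close> t(5) \<delta>(1) by (auto intro: le_less_trans simp: ennreal_less_iff)
  note near = \<delta>(3)[OF this]
  then have in_c: "(f ^^ k) c \<in> fst (fst (\<sigma> c))" by simp
  have "ennreal (?dc / Cd) \<le> ennreal (exp (- a * real k))"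
    using order_trans[OF conjunct2[OF near] k(2)] .
  then have dc: "?dc \<le> Cd * exp (- a * real k)"
    using \<delta>(2) by (simp add: divide_le_eq mult.commute)
  have Bdc: "(2 * B2) ^ j * ?dc \<le> (2 * B2) ^ j * (Cd * exp (- a * real k))"
    using dc r2 by (intro mult_left_mono) auto
  have cb2': "chart_bound (inv f) c d x t B2" if "(c, K) \<in> J" "(d, K') \<in> J" "x \<in> K" "inv f x \<in> K'" for c K d K' x
    using chart_bound_mono[OF cb2[OF that] t(3)] by simp
  \<comment> \<open>The point \<open>f^k y\<close> is the image of \<open>f^k c\<close> under
    \<open>f^(-j)\<close>, so its distance to \<open>y\<close> is the recurrence distance carried
    back \<open>j\<close> steps.\<close>
  have ret: "(f ^^ k) y \<in> fst (fst (\<sigma> y))" "norm (?\<phi> ((f ^^ k) y) - ?\<phi> y) \<le> (2 * B2) ^ j * ?dc"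
  proof -
    have "(inv f ^^ j) ((f ^^ k) c) \<in> fst (fst (\<sigma> ((inv f ^^ j) c))) \<and>
      norm (snd (fst (\<sigma> ((inv f ^^ j) c))) ((inv f ^^ j) ((f ^^ k) c)) - snd (fst (\<sigma> ((inv f ^^ j) c))) ((inv f ^^ j) c))
        \<le> (2 * B2) ^ j * ?dc"
    proof (rule chart_dist_funpow_le[OF J _ t(6) r2(2) in_c _ order_refl])
      show "(2 * B2) ^ j * ?dc \<le> t" using Bdc close(1) by linarith
    qed (rule cb2')
    then show "(f ^^ k) y \<in> fst (fst (\<sigma> y))" "norm (?\<phi> ((f ^^ k) y) - ?\<phi> y) \<le> (2 * B2) ^ j * ?dc"
      unfolding y_def inv_comm by auto
  qed
  \<comment> \<open>The margin \<open>r0\<close> puts the returning point into the compact piece of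
    \<open>y\<close>, where the uniform bounds hold in the chart of \<open>y\<close>.\<close>
  have retK: "(f ^^ k) y \<in> snd (\<sigma> y)"
  proof -
    have "norm (?\<phi> ((f ^^ k) y) - ?\<phi> y) \<le> r0" using ret(2) Bdc close(1) t(4) by linarith
    then have "?\<phi> ((f ^^ k) y) \<in> ?\<phi> ` snd (\<sigma> y)"
      using \<sigma>(6)[of y] by (auto simp: dist_norm norm_minus_commute)
    then obtain x where x: "x \<in> snd (\<sigma> y)" "?\<phi> ((f ^^ k) y) = ?\<phi> x" by blast
    then have "x = (f ^^ k) y"
      using chart_inv_left[OF \<sigma>(3) ret(1)] chart_inv_left[OF \<sigma>(3), of x y] \<sigma>(4)[of y] by auto
    then show ?thesis using x(1) by simp
  qed

  let ?\<eta> = "2 * C1\<^sup>2 * q ^ (k - j) * \<beta> ^ j"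
  have \<eta>: "norm (tangent_matrix A g (f ^^ k) y *v u) \<le> ?\<eta> * norm u" for u
  proof -
    let ?M = "tangent_matrix A g (f ^^ j) y" and ?N = "tangent_matrix A g (f ^^ j) c"
    have MMi: "?M ** tangent_matrix A g (inv f ^^ j) c = mat 1"
    proof -
      have "(f ^^ j) \<circ> (inv f ^^ j) = id" by (auto simp: inv_pow)
      then show ?thesis
        using tangent_matrix_comp[OF diff_map_funpow[OF fi] diff_map_funpow[OF f], of j j c]
        by (simp add: tangent_matrix_id y_def)
    qed
    have "norm ((?N ** ?M) *v u) \<le> (C1 * q ^ j * sqrt \<bar>det ?N\<bar> + C1 * q ^ j * sqrt \<bar>det ?M\<bar>) * norm u"
      by (rule norm_mult_critical_le[OF MMi w sub[OF y] sub[OF c] crit_fwd crit_bwd])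
    also have "\<dots> \<le> (C1 * q ^ j * \<beta> ^ j + C1 * q ^ j * \<beta> ^ j) * norm u"
      using det_le[OF c] det_le[OF y] C1 q by (intro mult_right_mono add_mono mult_left_mono) auto
    finally have two: "norm (tangent_matrix A g (f ^^ (j + j)) y *v u) \<le> 2 * C1 * q ^ j * \<beta> ^ j * norm u"
      by (simp add: tangent_matrix_funpow_add[OF f] fy mult_ac)
    \<comment> \<open>Only the first \<open>2 * j\<close> steps contract; the remaining ones cost a
      factor \<open>C1 * q ^ (k - 2 * j)\<close>. In the product \<open>N M\<close>, each summand
      pairs one growth factor \<open>C1 * q ^ j\<close> with one critical factor
      \<open>\<beta> ^ j\<close>, which gives the total power \<open>q ^ (k - j)\<close>.\<close>
    have k_eq: "k = (k - (j + j)) + (j + j)" using jk by simp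
    have "norm (tangent_matrix A g (f ^^ k) y *v u)
        = norm (tangent_matrix A g (f ^^ (k - (j + j))) ((f ^^ (j + j)) y) *v (tangent_matrix A g (f ^^ (j + j)) y *v u))"
      by (subst k_eq, subst tangent_matrix_funpow_add[OF f]) (simp only: matrix_vector_mul_assoc)
    also have "\<dots> \<le> C1 * q ^ (k - (j + j)) * norm (tangent_matrix A g (f ^^ (j + j)) y *v u)"
      by (rule sub[OF pow_\<Lambda>[OF y]])
    also have "\<dots> \<le> C1 * q ^ (k - (j + j)) * (2 * C1 * q ^ j * \<beta> ^ j * norm u)"
      using two C1 q by (intro mult_left_mono) auto
    also have "\<dots> = 2 * C1\<^sup>2 * q ^ (k - (j + j) + j) * \<beta> ^ j * norm u"
      by (simp add: power_add power2_eq_square)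
    also have "k - (j + j) + j = k - j" using jk by simp
    finally show ?thesis .
  qed

  \<comment> \<open>At time \<open>k\<close> the chart of \<open>y\<close> replaces the one assigned
    to \<open>f^k y\<close>, so that the return map starts and ends in the same chart.\<close>
  define s where "s n = (if n = k then \<sigma> y else \<sigma> ((f ^^ n) y))" for n
  have s: "(fst (s n), snd (s n)) \<in> J" "(f ^^ n) y \<in> snd (s n)" "fst (s n) \<in> A" "(f ^^ n) y \<in> fst (fst (s n))" for n
    using \<sigma> retK ret(1) by (auto simp: s_def)
  have s0: "s 0 = \<sigma> y" "s k = s 0" by (simp_all add: s_def)
  show ?thesis
  proof (rule sink_of_contracting_return[where ch = "\<lambda>n. fst (s n)" and y = y and k = k and r = r1 and B = B1 and ?C0.0 = C0
      and ?C1.0 = C1 and q = q and \<eta> = ?\<eta> and \<rho> = "exp (- a * real k / 4)" and C = "C0\<^sup>2 * C1"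
      and R = "3 * (C0\<^sup>2 * C1) * q ^ k * exp (- a * real k / 4)"])
    show "chart_bound f (fst (s n)) (fst (s (Suc n))) ((f ^^ n) y) r1 B1" for n
      using cb1[OF s(1) s(1) s(2)] s(2)[of "Suc n"] by simp
    show "norm (frame (fst (s n)) ((f ^^ n) y) *v e) \<le> C0 * norm e \<and>
        norm e \<le> C0 * norm (frame (fst (s n)) ((f ^^ n) y) *v e)" for n e
      by (rule C0(2)[OF s(1,2)])
    show "norm (snd (fst (s 0)) ((f ^^ k) y) - snd (fst (s 0)) y) < exp (- a * real k / 4) / 2"
      unfolding s0(1) using ret(2) Bdc close(2) by linarith
  qed (use f \<Lambda> compact_imp_closed[OF \<Lambda>(1)] y k(1) s s0 C0 C1 q r1 sub \<eta> \<beta> R(1,2) t(2) contr in auto)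
qed

end

theorem proposition12:
  fixes A :: "'a::t2_space chart set"
    and g :: "'a \<Rightarrow> 'a tangent \<Rightarrow> 'a tangent \<Rightarrow> real"
    and f :: "'a \<Rightarrow> 'a"
    and \<Lambda> :: "'a set"
    and c :: 'a
  assumes "compact_riemannian_surface A g"
    and "ck_diffeo 2 A f"
    and "compact \<Lambda>"
    and "f ` \<Lambda> = \<Lambda>"
    and "dissipative A g f \<Lambda>"
    and "limsup (\<lambda>k. ereal (1 / real k * ln (tangent_map_norm_on A g (f ^^ k) \<Lambda>))) \<le> 0"
    and "c \<in> Crit A g f \<Lambda>"
    and "liminf (\<lambda>k. ereal (1 / real k) * elog (rdist A g ((f ^^ k) c) c)) < 0"
  shows "\<exists>p\<in>\<Lambda>. is_sink A g f p"
  by (rule compact_riemannian_surface.sink_of_recurrent_critical_point[OF assms])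

end
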